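(* Let $k$ be a fixed positive integer. For each $n$, let $P_n$ be a positive integer and $\mathcal{D}_n$ a probability distribution on $\{1,2,\dots,P_n\}$, and consider the general random intersection graph $G(n,P_n,\mathcal{D}_n)$. Let $X_n$ be a random variable with distribution $\mathcal{D}_n$, and define the sequence $\alpha_n$ by $$\frac{\{\mathbb{E}[X_n]\}^2}{P_n}=\frac{\ln n+(k-1)\ln\ln n+\alpha_n}{n}.$$ If $\mathbb{E}[X_n]=\Omega\big((\ln n)^3\big)$ and $\mathrm{Var}[X_n]=o\Big(\frac{\{\mathbb{E}[X_n]\}^2}{n(\ln n)^2}\Big)$, then $$\lim_{n\to\infty}\mathbb{P}[G(n,P_n,\mathcal{D}_n)\text{ is }k\text{-robust}]=\begin{cases}0,&\text{if }\lim_{n\to\infty}\alpha_n=-\infty,\\ 1,&\text{if }\lim_{n\to\infty}\alpha_n=\infty.\end{cases}$$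
   Context: General random intersection graph $G(n,P_n,\mathcal{D}_n)$: node set $\{v_1,\dots,v_n\}$; there is a pool of $P_n$ distinct objects; independently for each node $v_i$, an object set $S_i$ is formed by first drawing its size $|S_i|$ from $\mathcal{D}_n$ and then, conditional on $|S_i|=s$, choosing $S_i$ uniformly at random among all $s$-element subsets of the pool. Two distinct nodes $v_i,v_j$ are joined by an undirected edge iff $S_i\cap S_j\neq\emptyset$. A graph with node set $\mathcal{V}$ is $k$-robust if for every pair of non-empty disjoint subsets $A,B\subseteq\mathcal{V}$, at least one of the following holds: (a) some node of $A$ has at least $k$ neighbors in $\mathcal{V}\setminus A$; (b) some node of $B$ has at least $k$ neighbors in $\mathcal{V}\setminus B$. All parameters are sequences indexed by $n$, limits are as $n\to\infty$, $k$ does not depend on $n$, and $o,\omega,O,\Omega$ are standard Landau notation. *)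

theory Defs
  imports "HOL-Probability.Probability" "HOL-Library.Landau_Symbols"
begin

text \<open>
  Simple graphs are given by a node set together with a set of edges, an edge being a two-element
  set of nodes.
\<close>

definition neighbors_in :: "'a set set \<Rightarrow> 'a \<Rightarrow> 'a set \<Rightarrow> 'a set" where
  "neighbors_in E v U = {w \<in> U. {v, w} \<in> E}"

definition k_robust :: "nat \<Rightarrow> 'a set \<Rightarrow> 'a set set \<Rightarrow> bool" where
  "k_robust k V E \<longleftrightarrow>
     (\<forall>A B. A \<subseteq> V \<and> B \<subseteq> V \<and> A \<noteq> {} \<and> B \<noteq> {} \<and> A \<inter> B = {} \<longrightarrow>
        (\<exists>v\<in>A. k \<le> card (neighbors_in E v (V - A))) \<or>
        (\<exists>v\<in>B. k \<le> card (neighbors_in E v (V - B))))"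

definition object_set_pmf :: "nat \<Rightarrow> nat pmf \<Rightarrow> nat set pmf" where
  "object_set_pmf P D = bind_pmf D (\<lambda>s. pmf_of_set {S. S \<subseteq> {1..P} \<and> card S = s})"

definition intersection_edges :: "nat \<Rightarrow> (nat \<Rightarrow> nat set) \<Rightarrow> nat set set" where
  "intersection_edges n S = {{i, j} |i j. i \<in> {1..n} \<and> j \<in> {1..n} \<and> i \<noteq> j \<and> S i \<inter> S j \<noteq> {}}"

text \<open>
  The law of the edge set of the random intersection graph on the nodes \<open>{1..n}\<close>. The size
  distribution \<open>D\<close> is meant to be supported in \<open>{1..P}\<close>: for a size \<open>s > P\<close> there is
  no subset to choose and \<^const>\<open>pmf_of_set\<close> is unspecified.
\<close>

definition intersection_graph_pmf :: "nat \<Rightarrow> nat \<Rightarrow> nat pmf \<Rightarrow> nat set set pmf" where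
  "intersection_graph_pmf n P D =
     map_pmf (intersection_edges n) (Pi_pmf {1..n} {} (\<lambda>_. object_set_pmf P D))"

end

theory Submission
  imports Defs "HOL-Real_Asymp.Real_Asymp"
begin

text \<open>
  Write \<open>m\<close> for the mean size. By Chebyshev's inequality all sizes lie within a factor
  \<open>1 \<plusminus> 1 / ln n\<close> of \<open>m\<close> with high probability, and robustness is monotone in the object sets, so
  it suffices to treat a constant size \<open>K\<close>; this changes \<open>x = n K\<^sup>2 / P\<close> only by \<open>O(1)\<close>
  in the critical range.

  One-law: if robustness fails, some \<open>A\<close> with \<open>1 \<le> |A| \<le> n / 2\<close> consists of nodes with fewer than
  \<open>k\<close> neighbours outside \<open>A\<close>. Given the object sets outside \<open>A\<close>, with union of size \<open>w\<close>, the nodes of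
  \<open>A\<close> behave independently, and each is bad with probability \<open>O(x\<^sup>k\<^sup>-\<^sup>1 exp (- K w / P))\<close>. As
  \<open>n K / P = O(1 / (ln n)\<^sup>2)\<close>, the sets hardly overlap, so \<open>w\<close> may be replaced by
  \<open>(n - |A|) K\<close>, and a union bound over \<open>A\<close> gives \<open>O(exp (- \<alpha>))\<close>. If \<open>x\<close> is much larger than \<open>ln n\<close>, a
  cruder estimate of \<open>w\<close> suffices.

  Zero-law: a node \<open>v\<close> of degree less than \<open>k\<close> violates robustness through \<open>{v}\<close> and its complement;
  such a node exists by the second moment method.
\<close>

section \<open>Uniform random subsets\<close>

text \<open>All nodes of \<open>A\<close> see the same random \<open>w\<close>, so averaging their
  joint bad event raises a random quantity to the power \<open>card A\<close>. A mean or typical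
  value of \<open>w\<close> is not enough against exponentially many sets \<open>A\<close>; the
  exponential moment of \<open>- card A * K * w / P\<close> is needed. It is obtained by adding the
  object sets one at a time and charging each for its overlap with the previous ones. Per node of
  \<open>A\<close> the charge is of order \<open>x * (n * K / P) = x ^ 2 / K\<close>; for
  \<open>x = O(ln n)\<close> the growth \<open>(ln n) ^ 3\<close> of the sizes keeps it bounded. In
  the one-law nothing bounds \<open>x\<close> from above, since \<alpha> may grow at any speed.
  Hence the second argument for \<open>x\<close> above a multiple of \<open>ln n\<close>: a lower
  bound for \<open>w\<close> of order \<open>P * ln n / K\<close> is enough there to pay for a
  factor \<open>n ^ k\<close>. In the zero-law \<open>x\<close> may lie far below
  \<open>ln n\<close>, and then isolated nodes have to do. Moreover the degrees of two nodes are
  correlated through the objects they share, which is controlled by the exponential moment of the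
  overlap of two uniform sets.\<close>

definition ksubsets :: "nat \<Rightarrow> nat \<Rightarrow> nat set set" where
  "ksubsets P K = {S. S \<subseteq> {1..P} \<and> card S = K}"

lemma finite_ksubsets [simp]: "finite (ksubsets P K)"
  unfolding ksubsets_def by (rule finite_subset[of _ "Pow {1..P}"]) auto

lemma card_ksubsets: "card (ksubsets P K) = P choose K"
  unfolding ksubsets_def using n_subsets[of "{1..P}" K] by simp

lemma ksubsets_nonempty: "K \<le> P \<Longrightarrow> ksubsets P K \<noteq> {}"
  by (metis card.empty card_ksubsets less_irrefl zero_less_binomial)

lemma ksubsetsD: "S \<in> ksubsets P K \<Longrightarrow> S \<subseteq> {1..P} \<and> card S = K \<and> finite S"
  unfolding ksubsets_def using finite_subset[of S "{1..P}"] by auto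

definition uniform_set :: "nat \<Rightarrow> nat \<Rightarrow> nat set pmf" where
  "uniform_set P K = pmf_of_set (ksubsets P K)"

lemma set_uniform_set: "K \<le> P \<Longrightarrow> set_pmf (uniform_set P K) = ksubsets P K"
  unfolding uniform_set_def by (rule set_pmf_of_set[OF ksubsets_nonempty]) auto

lemma prob_uniform_set:
  assumes "K \<le> P"
  shows "measure_pmf.prob (uniform_set P K) A = card (ksubsets P K \<inter> A) / (P choose K)"
  unfolding uniform_set_def
  by (subst measure_pmf_of_set[OF ksubsets_nonempty[OF assms]]) (auto simp: card_ksubsets)

section \<open>Quotients of binomial coefficients\<close>

text \<open>The quotient of the two binomials is the product of \<open>(K - i) / (P - i)\<close>
  over \<open>i < t\<close>; as \<open>K \<le> P\<close>, no factor exceeds \<open>K / P\<close>. It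
  is the probability that a uniform \<open>K\<close>-set contains \<open>t\<close> given
  objects.\<close>

lemma choose_shift_both_le:
  assumes "t \<le> K" "K \<le> P"
  shows "real ((P - t) choose (K - t)) \<le> (K / P) ^ t * (P choose K)"
  using assms(1)
proof (induction t)
  case (Suc t)
  then obtain a where a: "K - t = Suc a" by (metis Suc_diff_Suc Suc_le_lessD)
  from Suc.prems assms(2) obtain b where b: "P - t = Suc b"
    by (metis Suc_diff_Suc Suc_le_lessD order_less_le_trans)
  have "real (Suc b * (b choose a)) = real ((Suc b choose Suc a) * Suc a)"
    by (simp only: Suc_times_binomial_eq)
  hence eq: "real (b choose a) = (real (K - t) / real (P - t)) * real ((P - t) choose (K - t))"
    unfolding a b by (simp add: field_simps)
  have le: "real (K - t) / real (P - t) \<le> K / P"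
    using Suc.prems assms(2) by (simp add: divide_simps of_nat_diff algebra_simps mult_right_mono)
  have "real (b choose a) \<le> (K / P) * ((K / P) ^ t * (P choose K))"
    unfolding eq by (rule mult_mono[OF le]) (use Suc in auto)
  moreover have "P - Suc t = b" "K - Suc t = a" using a b by auto
  ultimately show ?case by (simp add: mult.assoc)
qed auto

text \<open>Raising \<open>w\<close> by one multiplies the binomial by
  \<open>1 - M / (N - w)\<close>, which is at most \<open>1 - M / N\<close> and so at most
  \<open>exp (- M / N)\<close>.\<close>

lemma choose_shift_upper_le:
  assumes "w \<le> N" "M \<le> N"
  shows "real ((N - w) choose M) \<le> exp (- (real M * w / N)) * (N choose M)"
  using assms(1)
proof (induction w)
  case (Suc w)
  have N: "N > 0" "N - w > 0" using Suc.prems by auto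
  show ?case
  proof (cases "M \<le> N - Suc w")
    case False
    thus ?thesis by (simp add: binomial_eq_0 not_le)
  next
    case True
    have "real ((N - w - M) * (N - w choose M)) = real ((N - w) * ((N - w - 1) choose M))"
      by (simp only: binomial_absorb_comp)
    hence eq: "real ((N - Suc w) choose M) = (1 - M / real (N - w)) * real (N - w choose M)"
      using True N by (simp add: field_simps of_nat_diff)
    have "1 - M / real (N - w) \<le> 1 - real M / N"
      using N by (simp add: divide_left_mono)
    also have "\<dots> \<le> exp (- (real M / N))"
      using exp_ge_add_one_self[of "-(real M/N)"] by simp
    finally have "real ((N - Suc w) choose M) \<le> exp (- (real M / N)) * (exp (- (real M * w / N)) * (N choose M))"
      unfolding eq using Suc by (intro mult_mono) auto
    also have "\<dots> = exp (- (real M * Suc w / N)) * (N choose M)"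
    proof -
      have "real M * Suc w / N = real M / N + real M * w / N" by (simp add: add_divide_distrib distrib_left)
      thus ?thesis by (simp add: exp_add[symmetric])
    qed
    finally show ?thesis .
  qed
qed simp

text \<open>Here the quotient is a product of \<open>(w - i) / (P - i)\<close> over
  \<open>i < K\<close>, each at most \<open>w / P\<close>. It bounds the chance that a uniform
  \<open>K\<close>-set lies inside a given \<open>w\<close>-set.\<close>

lemma choose_ratio_le:
  assumes "w \<le> P"
  shows "real (w choose K) \<le> (w / P) ^ K * (P choose K)"
proof (induction K)
  case (Suc K)
  show ?case
  proof (cases "Suc K \<le> w")
    case True
    have b: "real (Suc K) * real (m choose Suc K) = real (m - K) * real (m choose K)" if "Suc K \<le> m" for m
      by (simp only: of_nat_mult[symmetric] binomial_absorption binomial_absorb_comp)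
    have "K * w \<le> K * P" using assms by simp
    hence "real K * w \<le> real K * P" by (simp only: of_nat_mult[symmetric] of_nat_le_iff)
    hence le: "real (w - K) \<le> w / P * real (P - K)"
      using True assms by (simp add: divide_simps of_nat_diff algebra_simps)
    have "real (Suc K) * real (w choose Suc K) = real (w - K) * real (w choose K)" using b True by blast
    also have "\<dots> \<le> (w / P * real (P - K)) * ((w / P) ^ K * (P choose K))"
      by (intro mult_mono le Suc) auto
    also have "\<dots> = (w / P) ^ Suc K * (real (P - K) * (P choose K))" by simp
    also have "\<dots> = (w / P) ^ Suc K * (real (Suc K) * (P choose Suc K))"
      using b[of P] True assms by simp
    finally have "real (Suc K) * real (w choose Suc K) \<le> real (Suc K) * ((w / P) ^ Suc K * (P choose Suc K))"
      by (simp only: mult_ac)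
    thus ?thesis by (simp only: mult_le_cancel_left_pos of_nat_0_less_iff zero_less_Suc)
  qed (simp add: binomial_eq_0 not_le)
qed simp

section \<open>Containing, avoiding and meeting given objects\<close>

text \<open>The favourable sets are \<open>Y\<close> joined with \<open>K - card Y\<close> objects
  from outside \<open>Y\<close> and \<open>W\<close>. Of the two binomial estimates, the one for
  avoidance is applied to the pool of size \<open>P - card Y\<close>, the one for containment to
  what it leaves.\<close>

lemma prob_contains_avoids_le:
  assumes "K \<le> P" "Y \<subseteq> {1..P}" "W \<subseteq> {1..P}" "Y \<inter> W = {}"
  shows "measure_pmf.prob (uniform_set P K) {S. Y \<subseteq> S \<and> S \<inter> W = {}}
    \<le> (K / P) ^ card Y * exp (- ((real K - card Y) * card W / P))"
proof (cases "card Y \<le> K")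
  case False
  have "ksubsets P K \<inter> {S. Y \<subseteq> S \<and> S \<inter> W = {}} = {}"
  proof (rule ccontr)
    assume "\<not> ?thesis"
    then obtain S where "S \<in> ksubsets P K" "Y \<subseteq> S" by blast
    thus False using False card_mono[of S Y] ksubsetsD[of S P K] by auto
  qed
  thus ?thesis using assms(1) by (simp add: prob_uniform_set)
next
  case True
  let ?t = "card Y" and ?w = "card W"
  have fin: "finite Y" "finite W" using assms finite_subset by blast+
  have sub: "?t + ?w \<le> P"
    using card_mono[of "{1..P}" "Y \<union> W"] assms fin by (simp add: card_Un_disjoint)
  let ?B = "{Z. Z \<subseteq> {1..P} - (Y \<union> W) \<and> card Z = K - ?t}"
  have img: "ksubsets P K \<inter> {S. Y \<subseteq> S \<and> S \<inter> W = {}} = (\<lambda>Z. Z \<union> Y) ` ?B" (is "?L = ?R")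
  proof
    show "?L \<subseteq> ?R"
    proof
      fix S assume S: "S \<in> ?L"
      hence "S = (S - Y) \<union> Y" by auto
      moreover have "S - Y \<in> ?B" using S ksubsetsD[of S P K] fin by (auto simp: card_Diff_subset)
      ultimately show "S \<in> ?R" by blast
    qed
    show "?R \<subseteq> ?L"
    proof
      fix S assume "S \<in> ?R"
      then obtain Z where Z: "S = Z \<union> Y" "Z \<subseteq> {1..P} - (Y \<union> W)" "card Z = K - ?t" by auto
      moreover have "finite Z" using Z finite_subset[of Z "{1..P}"] by auto
      moreover have "card (Z \<union> Y) = card Z + ?t"
        using Z fin \<open>finite Z\<close> by (intro card_Un_disjoint) auto
      ultimately show "S \<in> ?L" using True assms by (auto simp: ksubsets_def)
    qed
  qed
  have "card ?L \<le> card ?B" unfolding img by (rule card_image_le) (auto intro: finite_subset[of _ "Pow {1..P}"])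
  also have "card ?B = card ({1..P} - (Y \<union> W)) choose (K - ?t)" by (rule n_subsets) auto
  also have "card ({1..P} - (Y \<union> W)) = P - ?t - ?w"
    using assms fin by (subst card_Diff_subset) (auto simp: card_Un_disjoint)
  finally have "real (card ?L) \<le> real ((P - ?t - ?w) choose (K - ?t))" by simp
  also have "\<dots> \<le> exp (- (real (K - ?t) * ?w / real (P - ?t))) * ((P - ?t) choose (K - ?t))"
    using sub assms True by (intro choose_shift_upper_le) auto
  also have "\<dots> \<le> exp (- ((real K - ?t) * ?w / P)) * ((K / P) ^ ?t * (P choose K))"
  proof (rule mult_mono)
    \<comment> \<open>If \<open>Y\<close> fills the pool, the denominator \<open>P - ?t\<close>
      vanishes; but then \<open>W\<close> is empty and both exponents are 0.\<close>
    have "(real K - ?t) * ?w / P \<le> real (K - ?t) * ?w / real (P - ?t)" if "?t < P"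
      using True that by (simp add: of_nat_diff frac_le)
    moreover have "?w = 0" if "\<not> ?t < P" using that sub by simp
    ultimately show "exp (- (real (K - ?t) * ?w / real (P - ?t))) \<le> exp (- ((real K - ?t) * ?w / P))"
      by (cases "?t < P") (auto simp del: card_0_eq card_eq_0_iff)
  qed (use True assms choose_shift_both_le in auto)
  finally show ?thesis using assms(1)
    by (simp add: prob_uniform_set divide_le_eq algebra_simps)
qed

lemma prob_contains_le:
  assumes "K \<le> P" "Y \<subseteq> {1..P}"
  shows "measure_pmf.prob (uniform_set P K) {S. Y \<subseteq> S} \<le> (K / P) ^ card Y"
  using prob_contains_avoids_le[of K P Y "{}"] assms by simp

lemma prob_avoids_le:
  assumes "K \<le> P" "W \<subseteq> {1..P}"
  shows "measure_pmf.prob (uniform_set P K) {S. S \<inter> W = {}} \<le> exp (- (real K * card W / P))"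
  using prob_contains_avoids_le[of K P "{}" W] assms by simp

lemma prob_meets_le:
  assumes "K \<le> P" "Y \<subseteq> {1..P}"
  shows "measure_pmf.prob (uniform_set P K) {S. S \<inter> Y \<noteq> {}} \<le> real K * card Y / P"
proof -
  have fin: "finite Y" using assms finite_subset by blast
  have "{S. S \<inter> Y \<noteq> {}} = (\<Union>y\<in>Y. {S. {y} \<subseteq> S})" by auto
  hence "measure_pmf.prob (uniform_set P K) {S. S \<inter> Y \<noteq> {}}
      \<le> (\<Sum>y\<in>Y. measure_pmf.prob (uniform_set P K) {S. {y} \<subseteq> S})"
    by (simp only:) (intro measure_pmf.finite_measure_subadditive_finite fin, auto)
  also have "\<dots> \<le> (\<Sum>y\<in>Y. K / P)"
    using assms by (intro sum_mono order_trans[OF prob_contains_le]) auto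
  finally show ?thesis by (simp add: field_simps)
qed

lemma prob_within_le:
  assumes "K \<le> P" "Y \<subseteq> {1..P}"
  shows "measure_pmf.prob (uniform_set P K) {S. S \<subseteq> Y} \<le> (card Y / P) ^ K"
proof -
  have fin: "finite Y" "card Y \<le> P" using assms finite_subset card_mono[of "{1..P}" Y] by auto
  have "ksubsets P K \<inter> {S. S \<subseteq> Y} = {S. S \<subseteq> Y \<and> card S = K}"
    using assms by (auto simp: ksubsets_def)
  hence "card (ksubsets P K \<inter> {S. S \<subseteq> Y}) = card Y choose K" using n_subsets[OF fin(1)] by simp
  thus ?thesis using choose_ratio_le[OF fin(2), of K] assms(1)
    by (simp add: prob_uniform_set divide_le_eq)
qed

lemma prob_avoids_eq:
  assumes "K \<le> P" "Y \<subseteq> {1..P}"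
  shows "measure_pmf.prob (uniform_set P K) {S. S \<inter> Y = {}} = ((P - card Y) choose K) / (P choose K)"
proof -
  have "ksubsets P K \<inter> {S. S \<inter> Y = {}} = {S. S \<subseteq> {1..P} - Y \<and> card S = K}"
    using assms by (auto simp: ksubsets_def)
  moreover have "card ({1..P} - Y) = P - card Y" using assms by (simp add: card_Diff_subset finite_subset)
  ultimately have "card (ksubsets P K \<inter> {S. S \<inter> Y = {}}) = (P - card Y) choose K"
    using n_subsets[of "{1..P} - Y" K] by simp
  thus ?thesis using assms(1) by (simp add: prob_uniform_set)
qed

section \<open>Exponential moment of the overlap with a fixed set\<close>

lemma sum_power_card_Pow:
  assumes "finite W"
  shows "(\<Sum>Y\<in>Pow W. c ^ card Y) = (1 + c :: real) ^ card W"
  using prod_add[OF assms, of "\<lambda>_. c" "\<lambda>_. 1"] by (simp add: add.commute)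

lemma integrable_uniform_set [simp]:
  "K \<le> P \<Longrightarrow> integrable (measure_pmf (uniform_set P K)) (f :: _ \<Rightarrow> real)"
  by (intro integrable_measure_pmf_finite) (simp add: set_uniform_set)

text \<open>The indicators of membership in \<open>S\<close> are not independent. With
  \<open>exp \<theta> = 1 + c\<close>, expanding \<open>(1 + c) ^ card (S \<inter> W)\<close> over
  the subsets \<open>Y\<close> of \<open>W\<close> contained in \<open>S\<close> reduces everything
  to the events \<open>Y \<subseteq> S\<close>. Their probability is at most
  \<open>(K / P) ^ card Y\<close>, the value for independent indicators, and
  \<open>c \<ge> 0\<close> lets this bound pass through the sum.\<close>

lemma expectation_exp_card_Int_le:
  fixes \<theta> :: real
  assumes "K \<le> P" "W \<subseteq> {1..P}" "\<theta> \<ge> 0"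
  shows "measure_pmf.expectation (uniform_set P K) (\<lambda>S. exp (\<theta> * card (S \<inter> W)))
    \<le> exp ((exp \<theta> - 1) * (real K * card W / P))"
proof -
  let ?U = "uniform_set P K" and ?c = "exp \<theta> - 1"
  have fin: "finite W" using assms finite_subset by blast
  have c: "?c \<ge> 0" using assms by simp
  have "exp (\<theta> * card (S \<inter> W)) = (\<Sum>Y\<in>Pow W. ?c ^ card Y * indicator {S. Y \<subseteq> S} S)" for S :: "nat set"
  proof -
    have "exp (\<theta> * card (S \<inter> W)) = (1 + ?c) ^ card (S \<inter> W)"
      by (simp add: exp_of_nat_mult[symmetric] mult.commute)
    also have "\<dots> = (\<Sum>Y\<in>Pow (S \<inter> W). ?c ^ card Y)" using fin by (intro sum_power_card_Pow[symmetric]) auto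
    also have "\<dots> = (\<Sum>Y\<in>Pow W. ?c ^ card Y * indicator {S. Y \<subseteq> S} S)"
      using fin by (intro sum.mono_neutral_cong_left) (auto simp: indicator_def)
    finally show ?thesis .
  qed
  hence "measure_pmf.expectation ?U (\<lambda>S. exp (\<theta> * card (S \<inter> W)))
      = (\<Sum>Y\<in>Pow W. ?c ^ card Y * measure_pmf.prob ?U {S. Y \<subseteq> S})"
    using assms by (simp add: Bochner_Integration.integral_sum)
  also have "\<dots> \<le> (\<Sum>Y\<in>Pow W. ?c ^ card Y * (K / P) ^ card Y)"
    using assms c by (intro sum_mono mult_left_mono prob_contains_le) auto
  also have "\<dots> = (1 + ?c * (K / P)) ^ card W"
    using sum_power_card_Pow[OF fin, of "?c * (K / P)"] by (simp only: power_mult_distrib)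
  also have "\<dots> \<le> exp (?c * (K / P)) ^ card W"
    using c exp_ge_add_one_self by (intro power_mono) auto
  also have "\<dots> = exp (?c * (real K * card W / P))"
    by (simp add: exp_of_nat_mult[symmetric] algebra_simps)
  finally show ?thesis .
qed

section \<open>Avoiding two overlapping sets\<close>

lemma choose_ratio_prod:
  assumes "K \<le> m" "m \<le> P"
  shows "real (m choose K) / (P choose K) = (\<Prod>i<K. real (m - i) / real (P - i))"
proof -
  have "real (m choose K) / (P choose K)
      = (\<Prod>i = 0..<K. real (m - i) / real (K - i)) / (\<Prod>i = 0..<K. real (P - i) / real (K - i))"
    using assms by (simp add: binomial_altdef_of_nat)
  also have "\<dots> = (\<Prod>i = 0..<K. (real (m - i) / real (K - i)) / (real (P - i) / real (K - i)))"
    by (simp add: prod_dividef)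
  also have "\<dots> = (\<Prod>i<K. real (m - i) / real (P - i))"
    by (rule prod.cong) auto
  finally show ?thesis .
qed

text \<open>On the left stands the probability of avoiding two \<open>K\<close>-sets that share
  \<open>L\<close> objects, on the right the square for a single set. The binomial quotients are
  compared factor by factor, \<open>1 - 2 * y + z\<close> against \<open>(1 - y)\<^sup>2\<close>,
  and the overlap costs \<open>exp (3 * (L / P))\<close> in each of the \<open>K\<close>
  factors.\<close>

lemma choose_ratio_two_sets_le:
  assumes "4 * K \<le> P" "L \<le> K"
  shows "real ((P - (2 * K - L)) choose K) / (P choose K)
    \<le> (real ((P - K) choose K) / (P choose K))\<^sup>2 * exp (3 * (real L * K / P))"
proof -
  have "real ((P - (2 * K - L)) choose K) / (P choose K)
      = (\<Prod>i<K. real (P - (2 * K - L) - i) / real (P - i))"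
    using assms by (intro choose_ratio_prod) auto
  also have "\<dots> \<le> (\<Prod>i<K. (real (P - K - i) / real (P - i))\<^sup>2 * exp (3 * (L / P)))"
  proof (intro prod_mono conjI)
    fix i assume i: "i \<in> {..<K}"
    define d y z where "d = real (P - i)" and "y = real K / d" and "z = real L / d"
    have d: "d > 0" "3 * real P / 4 \<le> d" "3 * K \<le> d" using i assms unfolding d_def by auto
    have y: "0 \<le> y" "y \<le> 1 / 3" using d unfolding y_def by (auto simp: field_simps)
    have z0: "0 \<le> z" "z \<le> 4 / 3 * (L / P)"
      using d frac_le[of L L "3 * real P / 4" d] i assms unfolding z_def by (auto simp: field_simps)
    have "real (P - (2 * K - L) - i) = d - 2 * K + L" "real (P - K - i) = d - K"
      using i assms unfolding d_def by auto
    hence e1: "real (P - (2 * K - L) - i) / real (P - i) = 1 - 2 * y + z"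
      and e2: "real (P - K - i) / real (P - i) = 1 - y"
      using d(1) unfolding y_def z_def d_def[symmetric] by (simp_all add: field_simps)
    \<comment> \<open>Dividing \<open>z\<close> by \<open>(1 - y)\<^sup>2 \<ge> 4 / 9\<close> gives
      the coefficient \<open>9 / 4\<close>; with \<open>z \<le> 4 / 3 * (L / P)\<close> this becomes
      the \<open>3\<close> of the claim.\<close>
    have "4 / 9 \<le> (1 - y)\<^sup>2" using power_mono[of "2/3" "1 - y" 2] y by (simp add: power2_eq_square)
    hence "(1 - y)\<^sup>2 * (9 / 4 * z) \<ge> z" using z0 mult_right_mono[of "4/9" "(1-y)\<^sup>2" "9/4*z"] by simp
    moreover have "1 - 2 * y \<le> (1 - y)\<^sup>2" by (simp add: power2_eq_square algebra_simps)
    ultimately have "1 - 2 * y + z \<le> (1 - y)\<^sup>2 * (1 + 9 / 4 * z)" by (simp add: algebra_simps)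
    also have "\<dots> \<le> (1 - y)\<^sup>2 * exp (3 * (L / P))"
    proof (rule mult_left_mono)
      have "1 + 9 / 4 * z \<le> 1 + 3 * (L / P)" using z0 by simp
      also have "\<dots> \<le> exp (3 * (L / P))" by (rule exp_ge_add_one_self)
      finally show "1 + 9 / 4 * z \<le> exp (3 * (L / P))" .
    qed simp
    finally show "real (P - (2 * K - L) - i) / real (P - i) \<le> (real (P - K - i) / real (P - i))\<^sup>2 * exp (3 * (L / P))"
      unfolding e1 e2 .
  qed auto
  also have "\<dots> = (\<Prod>i<K. real (P - K - i) / real (P - i))\<^sup>2 * exp (3 * (L / P)) ^ K"
    by (simp add: prod.distrib prod_power_distrib)
  also have "(\<Prod>i<K. real (P - K - i) / real (P - i)) = real ((P - K) choose K) / (P choose K)"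
    using assms by (intro choose_ratio_prod[symmetric]) auto
  also have "exp (3 * (L / P)) ^ K = exp (3 * (real L * K / P))"
    by (simp add: exp_of_nat_mult[symmetric] algebra_simps)
  finally show ?thesis .
qed

section \<open>Monotone coupling of object sets\<close>

text \<open>A bijection between the two sets is glued to one between their complements: the
  permutations of the pool act transitively on the subsets of a given size.\<close>

lemma ksubsets_permutation:
  assumes "S \<in> ksubsets P s" "S' \<in> ksubsets P s"
  obtains \<sigma> where "\<sigma> permutes {1..P}" "\<sigma> ` S = S'"
proof -
  note d = ksubsetsD[OF assms(1)] ksubsetsD[OF assms(2)]
  obtain f where f: "bij_betw f S S'"
    using d by (metis finite_same_card_bij)
  obtain g where g: "bij_betw g ({1..P} - S) ({1..P} - S')"
    using d by (metis card_Diff_subset finite_Diff finite_atLeastAtMost finite_same_card_bij)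
  define \<sigma> where "\<sigma> x = (if x \<in> S then f x else if x \<in> {1..P} then g x else x)" for x
  have "bij_betw \<sigma> S S'" using f by (subst bij_betw_cong[where g = f]) (auto simp: \<sigma>_def)
  moreover have "bij_betw \<sigma> ({1..P} - S) ({1..P} - S')"
    using g by (subst bij_betw_cong[where g = g]) (auto simp: \<sigma>_def)
  ultimately have "bij_betw \<sigma> (S \<union> ({1..P} - S)) (S' \<union> ({1..P} - S'))"
    by (rule bij_betw_combine) auto
  hence "bij_betw \<sigma> {1..P} {1..P}" using d by (simp add: Un_absorb1)
  hence "\<sigma> permutes {1..P}" using d by (intro bij_imp_permutes) (auto simp: \<sigma>_def)
  moreover have "\<sigma> ` S = S'" using \<open>bij_betw \<sigma> S S'\<close> by (simp add: bij_betw_def)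
  ultimately show ?thesis using that by blast
qed

text \<open>Composing with a fixed permutation preserves the uniform law on permutations, so by
  transitivity the image law gives the same mass to any two \<open>s\<close>-subsets; it lives on
  \<open>s\<close>-subsets, hence is uniform there.\<close>

lemma uniform_set_eq_permutation_image:
  assumes "s \<le> P"
  shows "map_pmf (\<lambda>\<pi>. \<pi> ` {1..s}) (pmf_of_set {\<pi>. \<pi> permutes {1..P}}) = uniform_set P s"
    (is "?p = _")
proof (rule pmf_eqI)
  let ?\<Pi> = "{\<pi>. \<pi> permutes {1..P}}"
  have fin: "finite ?\<Pi>" and ne: "?\<Pi> \<noteq> {}"
    using finite_permutations[of "{1..P}"] permutes_id[of "{1..P}"] by blast+
  have "\<pi> ` {1..s} \<in> ksubsets P s" if "\<pi> permutes {1..P}" for \<pi>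
    using assms permutes_image[OF that] permutes_inj_on[OF that]
    by (auto simp: ksubsets_def card_image)
  hence supp: "set_pmf ?p \<subseteq> ksubsets P s" using set_pmf_of_set[OF ne fin] by auto
  have const: "pmf ?p S = pmf ?p S'" if "S \<in> ksubsets P s" "S' \<in> ksubsets P s" for S S'
  proof -
    obtain \<sigma> where \<sigma>: "\<sigma> permutes {1..P}" "\<sigma> ` S = S'" using ksubsets_permutation \<open>S \<in> _\<close> \<open>S' \<in> _\<close> .
    have bij: "bij_betw (\<lambda>\<pi>. \<sigma> \<circ> \<pi>) ?\<Pi> ?\<Pi>"
    proof (rule bij_betw_byWitness[where f' = "\<lambda>\<pi>. Hilbert_Choice.inv \<sigma> \<circ> \<pi>"])
      show "\<forall>a\<in>?\<Pi>. Hilbert_Choice.inv \<sigma> \<circ> (\<sigma> \<circ> a) = a"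
        using permutes_inv_o(2)[OF \<sigma>(1)] by (auto simp: o_assoc)
      show "\<forall>a\<in>?\<Pi>. \<sigma> \<circ> (Hilbert_Choice.inv \<sigma> \<circ> a) = a"
        using permutes_inv_o(1)[OF \<sigma>(1)] by (auto simp: o_assoc)
    qed (use permutes_compose[OF _ \<sigma>(1)] permutes_compose[OF _ permutes_inv[OF \<sigma>(1)]] in blast)+
    have "?p = map_pmf (\<lambda>\<pi>. \<pi> ` {1..s}) (map_pmf (\<lambda>\<pi>. \<sigma> \<circ> \<pi>) (pmf_of_set ?\<Pi>))"
      by (subst map_pmf_of_set_bij_betw[OF bij ne fin]) simp
    also have "\<dots> = map_pmf ((`) \<sigma>) ?p" by (simp add: pmf.map_comp o_def image_image)
    finally have "pmf ?p (\<sigma> ` S) = pmf (map_pmf ((`) \<sigma>) ?p) (\<sigma> ` S)" by simp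
    also have "\<dots> = pmf ?p S"
      using permutes_inj[OF \<sigma>(1)] by (intro pmf_map_inj') (simp add: inj_image_eq_iff inj_def)
    finally show ?thesis using \<sigma>(2) by simp
  qed
  fix S
  show "pmf ?p S = pmf (uniform_set P s) S"
  proof (cases "S \<in> ksubsets P s")
    case False
    thus ?thesis using supp set_uniform_set[OF assms] by (metis pmf_eq_0_set_pmf subsetD)
  next
    case True
    have "1 = (\<Sum>S'\<in>ksubsets P s. pmf ?p S')" using supp by (simp add: sum_pmf_eq_1)
    also have "\<dots> = card (ksubsets P s) * pmf ?p S" using const[OF _ True] by simp
    finally show ?thesis using True ksubsets_nonempty[OF assms]
      by (simp add: uniform_set_def pmf_of_set field_simps)
  qed
qed

lemma object_set_pmf_altdef: "object_set_pmf P D = bind_pmf D (uniform_set P)"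
  by (simp add: object_set_pmf_def uniform_set_def[abs_def] ksubsets_def)

lemma object_set_pmf_return: "object_set_pmf P (return_pmf K) = uniform_set P K"
  by (simp add: object_set_pmf_altdef bind_return_pmf)

section \<open>Transfer of the coupling to graphs\<close>

lemma intersection_edges_mono:
  assumes "\<And>i. i \<in> {1..n} \<Longrightarrow> S i \<subseteq> S' i"
  shows "intersection_edges n S \<subseteq> intersection_edges n S'"
  unfolding intersection_edges_def using assms by blast

lemma k_robust_mono:
  assumes "E \<subseteq> E'" "finite V" "k_robust k V E"
  shows "k_robust k V E'"
proof -
  have "card (neighbors_in E v (V - A)) \<le> card (neighbors_in E' v (V - A))" for v A
    using assms(1,2) by (intro card_mono) (auto simp: neighbors_in_def)
  hence le: "k \<le> card (neighbors_in E' v (V - A))" if "k \<le> card (neighbors_in E v (V - A))" for v A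
    using that order_trans by blast
  show ?thesis unfolding k_robust_def
  proof (intro allI impI)
    fix A B assume AB: "A \<subseteq> V \<and> B \<subseteq> V \<and> A \<noteq> {} \<and> B \<noteq> {} \<and> A \<inter> B = {}"
    show "(\<exists>v\<in>A. k \<le> card (neighbors_in E' v (V - A))) \<or> (\<exists>v\<in>B. k \<le> card (neighbors_in E' v (V - B)))"
      using assms(3)[unfolded k_robust_def, rule_format, OF AB] le by blast
  qed
qed

lemma prob_intersection_graph:
  "measure_pmf.prob (intersection_graph_pmf n P D) A
    = measure_pmf.prob (Pi_pmf {1..n} {} (\<lambda>_. object_set_pmf P D)) {S. intersection_edges n S \<in> A}"
  by (simp add: intersection_graph_pmf_def vimage_def)

text \<open>
  Realising the uniform \<open>s\<close>-subset as the image of \<open>{1..s}\<close> under a random permutation couples the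
  object sets of all sizes monotonically.
\<close>

lemma prob_intersection_graph_mono:
  assumes mono: "\<And>E E'. E \<subseteq> E' \<Longrightarrow> Q E \<Longrightarrow> Q E'"
    and C: "set_pmf C \<subseteq> {..P} \<times> {..P}"
  shows "measure_pmf.prob (intersection_graph_pmf n P (map_pmf fst C)) {E. Q E}
    \<le> measure_pmf.prob (intersection_graph_pmf n P (map_pmf snd C)) {E. Q E}
       + n * measure_pmf.prob C {(s', s). s < s'}"
proof -
  let ?\<Pi> = "pmf_of_set {\<pi>. \<pi> permutes {1..P}}"
  \<comment> \<open>\<open>C\<close> is a joint law of two sizes for one node. Both object sets are
    cut out by the same permutation, so the first lies inside the second unless its size is the
    larger one.\<close>
  define J where "J = map_pmf (\<lambda>((s', s), \<pi>). (\<pi> ` {1..s'}, \<pi> ` {1..s})) (pair_pmf C ?\<Pi>)"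
  have J1: "map_pmf fst J = object_set_pmf P (map_pmf fst C)"
  proof -
    have "map_pmf fst J = bind_pmf C (\<lambda>c. map_pmf (\<lambda>\<pi>. \<pi> ` {1..fst c}) ?\<Pi>)"
      by (simp add: J_def pair_pmf_def map_bind_pmf pmf.map_comp o_def case_prod_beta map_pmf_def
          bind_assoc_pmf bind_return_pmf)
    also have "\<dots> = bind_pmf C (\<lambda>c. uniform_set P (fst c))"
      using C by (intro bind_pmf_cong refl uniform_set_eq_permutation_image) auto
    finally show ?thesis by (simp add: object_set_pmf_altdef bind_map_pmf)
  qed
  have J2: "map_pmf snd J = object_set_pmf P (map_pmf snd C)"
  proof -
    have "map_pmf snd J = bind_pmf C (\<lambda>c. map_pmf (\<lambda>\<pi>. \<pi> ` {1..snd c}) ?\<Pi>)"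
      by (simp add: J_def pair_pmf_def map_bind_pmf pmf.map_comp o_def case_prod_beta map_pmf_def
          bind_assoc_pmf bind_return_pmf)
    also have "\<dots> = bind_pmf C (\<lambda>c. uniform_set P (snd c))"
      using C by (intro bind_pmf_cong refl uniform_set_eq_permutation_image) auto
    finally show ?thesis by (simp add: object_set_pmf_altdef bind_map_pmf)
  qed
  have Jbad: "measure_pmf.prob J {x. \<not> fst x \<subseteq> snd x} \<le> measure_pmf.prob C {(s', s). s < s'}"
  proof -
    have "measure_pmf.prob J {x. \<not> fst x \<subseteq> snd x}
        = measure_pmf.prob (pair_pmf C ?\<Pi>) {x. \<not> snd x ` {1..fst (fst x)} \<subseteq> snd x ` {1..snd (fst x)}}"
      by (simp add: J_def vimage_def case_prod_beta)
    also have "\<dots> \<le> measure_pmf.prob (pair_pmf C ?\<Pi>) {x. snd (fst x) < fst (fst x)}"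
    proof (rule measure_pmf.finite_measure_mono)
      have sub: "\<pi> ` {1..s'} \<subseteq> \<pi> ` {1..s}" if "s' \<le> s" for s s' :: nat and \<pi> :: "nat \<Rightarrow> nat"
        using that by (intro image_mono) auto
      show "{x :: (nat \<times> nat) \<times> (nat \<Rightarrow> nat). \<not> snd x ` {1..fst (fst x)} \<subseteq> snd x ` {1..snd (fst x)}} \<subseteq> {x. snd (fst x) < fst (fst x)}"
      proof (intro subsetI CollectI)
        fix x :: "(nat \<times> nat) \<times> (nat \<Rightarrow> nat)"
        assume "x \<in> {x. \<not> snd x ` {1..fst (fst x)} \<subseteq> snd x ` {1..snd (fst x)}}"
        thus "snd (fst x) < fst (fst x)" using sub[of "fst (fst x)" "snd (fst x)" "snd x"]
          by (meson CollectD not_le_imp_less)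
      qed
    qed simp
    also have "\<dots> = measure_pmf.prob (map_pmf fst (pair_pmf C ?\<Pi>)) {c. snd c < fst c}"
      by (simp add: vimage_def case_prod_beta del: map_fst_pair_pmf)
    finally show ?thesis by (simp add: map_fst_pair_pmf case_prod_beta')
  qed
  let ?G = "Pi_pmf {1..n} ({}, {}) (\<lambda>_. J)"
  have G1: "Pi_pmf {1..n} {} (\<lambda>_. map_pmf fst J) = map_pmf (\<lambda>h. fst \<circ> h) ?G"
    by (rule Pi_pmf_map) auto
  have G2: "Pi_pmf {1..n} {} (\<lambda>_. map_pmf snd J) = map_pmf (\<lambda>h. snd \<circ> h) ?G"
    by (rule Pi_pmf_map) auto
  let ?B = "\<lambda>i. {h. \<not> fst (h i) \<subseteq> snd (h i)}"
  have comp: "measure_pmf.prob ?G (?B i) \<le> measure_pmf.prob C {(s', s). s < s'}" if "i \<in> {1..n}" for i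
  proof -
    have "measure_pmf.prob ?G (?B i) = measure_pmf.prob (map_pmf (\<lambda>h. h i) ?G) {x. \<not> fst x \<subseteq> snd x}"
      by (simp add: vimage_def)
    also have "\<dots> = measure_pmf.prob J {x. \<not> fst x \<subseteq> snd x}"
      using that by (subst Pi_pmf_component) auto
    finally show ?thesis using Jbad by simp
  qed
  have "measure_pmf.prob (intersection_graph_pmf n P (map_pmf fst C)) {E. Q E}
      = measure_pmf.prob ?G {h. Q (intersection_edges n (fst \<circ> h))}"
    unfolding prob_intersection_graph J1[symmetric] G1 by (simp add: vimage_def)
  \<comment> \<open>If the inclusion holds at every node, the two graphs are nested. The exceptional
    event is a union over the nodes, which produces the factor \<open>n\<close>.\<close>
  also have "\<dots> \<le> measure_pmf.prob ?G ({h. Q (intersection_edges n (snd \<circ> h))} \<union> (\<Union>i\<in>{1..n}. ?B i))"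
  proof (rule measure_pmf.finite_measure_mono)
    show "{h. Q (intersection_edges n (fst \<circ> h))}
        \<subseteq> {h. Q (intersection_edges n (snd \<circ> h))} \<union> (\<Union>i\<in>{1..n}. ?B i)"
    proof
      fix h :: "nat \<Rightarrow> nat set \<times> nat set"
      assume h: "h \<in> {h. Q (intersection_edges n (fst \<circ> h))}"
      show "h \<in> {h. Q (intersection_edges n (snd \<circ> h))} \<union> (\<Union>i\<in>{1..n}. ?B i)"
      proof (cases "\<forall>i\<in>{1..n}. fst (h i) \<subseteq> snd (h i)")
        case True
        hence "intersection_edges n (fst \<circ> h) \<subseteq> intersection_edges n (snd \<circ> h)"
          by (intro intersection_edges_mono) auto
        thus ?thesis using h mono by auto
      qed auto
    qed
  qed simp
  also have "\<dots> \<le> measure_pmf.prob ?G {h. Q (intersection_edges n (snd \<circ> h))}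
      + measure_pmf.prob ?G (\<Union>i\<in>{1..n}. ?B i)"
    by (rule measure_Un_le) auto
  also have "measure_pmf.prob ?G (\<Union>i\<in>{1..n}. ?B i) \<le> (\<Sum>i\<in>{1..n}. measure_pmf.prob ?G (?B i))"
    by (rule measure_pmf.finite_measure_subadditive_finite) auto
  also have "\<dots> \<le> (\<Sum>i\<in>{1..n}. measure_pmf.prob C {(s', s). s < s'})"
    by (rule sum_mono[OF comp])
  also have "measure_pmf.prob ?G {h. Q (intersection_edges n (snd \<circ> h))}
      = measure_pmf.prob (intersection_graph_pmf n P (map_pmf snd C)) {E. Q E}"
    unfolding prob_intersection_graph J2[symmetric] G2 by (simp add: vimage_def)
  finally show ?thesis by simp
qed

text \<open>The constant \<open>K\<close> is paired with the size drawn from \<open>D\<close>, and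
  the coupling fails at a node only when that size is below \<open>K\<close>. This direction
  transfers the one-law from a constant size, the next one the zero-law.\<close>

lemma prob_k_robust_ge_uniform:
  assumes "K \<le> P" "set_pmf D \<subseteq> {..P}"
  shows "measure_pmf.prob (intersection_graph_pmf n P (return_pmf K)) {E. k_robust k {1..n} E}
    \<le> measure_pmf.prob (intersection_graph_pmf n P D) {E. k_robust k {1..n} E}
       + n * measure_pmf.prob D {s. s < K}"
proof -
  let ?C = "map_pmf (\<lambda>s. (K, s)) D"
  have "map_pmf fst ?C = return_pmf K" "map_pmf snd ?C = D"
    "measure_pmf.prob ?C {(s', s). s < s'} = measure_pmf.prob D {s. s < K}"
    by (simp_all add: pmf.map_comp o_def vimage_def)
  moreover have "k_robust k {1..n} E'" if "E \<subseteq> E'" "k_robust k {1..n} E" for E E'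
    using k_robust_mono that by blast
  moreover have "set_pmf ?C \<subseteq> {..P} \<times> {..P}" using assms by auto
  ultimately show ?thesis
    using prob_intersection_graph_mono[of "k_robust k {1..n}" ?C P n] by simp
qed

lemma prob_k_robust_le_uniform:
  assumes "K \<le> P" "set_pmf D \<subseteq> {..P}"
  shows "measure_pmf.prob (intersection_graph_pmf n P D) {E. k_robust k {1..n} E}
    \<le> measure_pmf.prob (intersection_graph_pmf n P (return_pmf K)) {E. k_robust k {1..n} E}
       + n * measure_pmf.prob D {s. K < s}"
proof -
  let ?C = "map_pmf (\<lambda>s. (s, K)) D"
  have "map_pmf snd ?C = return_pmf K" "map_pmf fst ?C = D"
    "measure_pmf.prob ?C {(s', s). s < s'} = measure_pmf.prob D {s. K < s}"
    by (simp_all add: pmf.map_comp o_def vimage_def)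
  moreover have "k_robust k {1..n} E'" if "E \<subseteq> E'" "k_robust k {1..n} E" for E E'
    using k_robust_mono that by blast
  moreover have "set_pmf ?C \<subseteq> {..P} \<times> {..P}" using assms by auto
  ultimately show ?thesis
    using prob_intersection_graph_mono[of "k_robust k {1..n}" ?C P n] by simp
qed

section \<open>Conditioning on the object sets outside a node set\<close>

lemma expectation_pair_pmf_finite:
  fixes f :: "'a \<times> 'b \<Rightarrow> real"
  assumes "finite (set_pmf p)" "finite (set_pmf q)"
  shows "measure_pmf.expectation (pair_pmf p q) f
    = measure_pmf.expectation p (\<lambda>a. measure_pmf.expectation q (\<lambda>b. f (a, b)))"
proof -
  have "measure_pmf.expectation (pair_pmf p q) f
      = (\<Sum>x\<in>set_pmf p \<times> set_pmf q. f x * pmf (pair_pmf p q) x)"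
    using assms by (intro integral_measure_pmf_real) auto
  also have "\<dots> = (\<Sum>a\<in>set_pmf p. \<Sum>b\<in>set_pmf q. f (a, b) * (pmf p a * pmf q b))"
    by (subst sum.cartesian_product) (auto intro!: sum.cong simp: pmf_pair)
  also have "\<dots> = (\<Sum>a\<in>set_pmf p. (\<Sum>b\<in>set_pmf q. f (a, b) * pmf q b) * pmf p a)"
    by (intro sum.cong refl) (simp add: sum_distrib_left mult_ac)
  also have "\<dots> = (\<Sum>a\<in>set_pmf p. measure_pmf.expectation q (\<lambda>b. f (a, b)) * pmf p a)"
    using assms by (intro sum.cong refl arg_cong2[where f = "(*)"] integral_measure_pmf_real[symmetric]) auto
  also have "\<dots> = measure_pmf.expectation p (\<lambda>a. measure_pmf.expectation q (\<lambda>b. f (a, b)))"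
    using assms by (intro integral_measure_pmf_real[symmetric]) auto
  finally show ?thesis .
qed

lemma expectation_pair_pmf_finite_swap:
  fixes f :: "'a \<times> 'b \<Rightarrow> real"
  assumes "finite (set_pmf p)" "finite (set_pmf q)"
  shows "measure_pmf.expectation (pair_pmf p q) f
    = measure_pmf.expectation q (\<lambda>b. measure_pmf.expectation p (\<lambda>a. f (a, b)))"
  using expectation_pair_pmf_finite[OF assms(2,1), of "\<lambda>(b, a). f (a, b)"]
  by (subst pair_commute_pmf) (simp add: case_prod_beta')

lemma prob_pair_pmf_finite:
  assumes "finite (set_pmf p)" "finite (set_pmf q)"
  shows "measure_pmf.prob (pair_pmf p q) X
    = measure_pmf.expectation p (\<lambda>a. measure_pmf.prob q {b. (a, b) \<in> X})"
proof -
  have "measure_pmf.prob (pair_pmf p q) X = measure_pmf.expectation (pair_pmf p q) (indicator X)" by simp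
  also have "\<dots> = measure_pmf.expectation p (\<lambda>a. measure_pmf.expectation q (\<lambda>b. indicator X (a, b)))"
    by (rule expectation_pair_pmf_finite[OF assms])
  also have "\<dots> = measure_pmf.expectation p (\<lambda>a. measure_pmf.expectation q (indicator {b. (a, b) \<in> X}))"
    by (intro Bochner_Integration.integral_cong refl) (simp add: indicator_def)
  finally show ?thesis by simp
qed

lemma finite_set_Pi_pmf:
  assumes "finite A" "\<And>x. x \<in> A \<Longrightarrow> finite (set_pmf (p x))"
  shows "finite (set_pmf (Pi_pmf A d p))"
  using assms by (auto simp: set_Pi_pmf intro!: finite_PiE_dflt)

text \<open>\<open>loc\<close> says that \<open>Q\<close> reads its second argument only on
  \<open>R\<close>. With the coordinates in \<open>R\<close> frozen, the events at the nodes of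
  \<open>A\<close> are therefore independent and equally likely, which yields the power inside the
  outer expectation.\<close>

lemma prob_all_conditionally_independent:
  assumes fin: "finite A" "finite R" "A \<inter> R = {}" "finite (set_pmf p)"
    and loc: "\<And>x S S'. (\<And>j. j \<in> R \<Longrightarrow> S j = S' j) \<Longrightarrow> Q x S = Q x S'"
  shows "measure_pmf.prob (Pi_pmf (A \<union> R) d (\<lambda>_. p)) {S. \<forall>i\<in>A. Q (S i) S}
    = measure_pmf.expectation (Pi_pmf R d (\<lambda>_. p)) (\<lambda>y. measure_pmf.prob p {x. Q x y} ^ card A)"
proof -
  let ?pR = "Pi_pmf R d (\<lambda>_. p)" and ?pA = "Pi_pmf A d (\<lambda>_. p)"
  have "Pi_pmf (A \<union> R) d (\<lambda>_. p) = map_pmf (\<lambda>(f, g) x. if x \<in> R then f x else g x) (pair_pmf ?pR ?pA)"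
    using fin by (subst Un_commute, intro Pi_pmf_union) auto
  hence "measure_pmf.prob (Pi_pmf (A \<union> R) d (\<lambda>_. p)) {S. \<forall>i\<in>A. Q (S i) S}
      = measure_pmf.prob (pair_pmf ?pR ?pA)
          {fg. \<forall>i\<in>A. Q (if i \<in> R then fst fg i else snd fg i) (\<lambda>x. if x \<in> R then fst fg x else snd fg x)}"
    by (simp add: vimage_def case_prod_beta)
  also have "{fg. \<forall>i\<in>A. Q (if i \<in> R then fst fg i else snd fg i) (\<lambda>x. if x \<in> R then fst fg x else snd fg x)}
      = {fg. \<forall>i\<in>A. Q (snd fg i) (fst fg)}"
  proof (intro Collect_cong ball_cong refl)
    fix fg :: "('a \<Rightarrow> 'b) \<times> ('a \<Rightarrow> 'b)" and i assume "i \<in> A"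
    hence "i \<notin> R" using fin by auto
    thus "Q (if i \<in> R then fst fg i else snd fg i) (\<lambda>x. if x \<in> R then fst fg x else snd fg x)
        = Q (snd fg i) (fst fg)" by (simp, intro loc) auto
  qed
  also have "measure_pmf.prob (pair_pmf ?pR ?pA) {fg. \<forall>i\<in>A. Q (snd fg i) (fst fg)}
      = measure_pmf.expectation ?pR (\<lambda>y. measure_pmf.prob ?pA {g. \<forall>i\<in>A. Q (g i) y})"
    using fin by (subst prob_pair_pmf_finite) (auto intro!: finite_set_Pi_pmf)
  also have "\<dots> = measure_pmf.expectation ?pR (\<lambda>y. measure_pmf.prob ?pA (Pi A (\<lambda>_. {x. Q x y})))"
    by (simp add: Pi_def Ball_def)
  also have "\<dots> = measure_pmf.expectation ?pR (\<lambda>y. measure_pmf.prob p {x. Q x y} ^ card A)"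
    using fin by (simp add: measure_Pi_pmf_Pi)
  finally show ?thesis .
qed

text \<open>
  Deleting from each \<open>y j\<close> the objects already present in an earlier set makes the family disjoint
  without changing its union, and it can only destroy edges.
\<close>

lemma prob_few_neighbors_le:
  fixes y :: "nat \<Rightarrow> nat set"
  assumes "K \<le> P" "k \<le> K" "finite R" and y: "\<And>j. j \<in> R \<Longrightarrow> y j \<in> ksubsets P K"
  defines "w \<equiv> card (\<Union>j\<in>R. y j)"
  shows "measure_pmf.prob (uniform_set P K) {S. card {j\<in>R. S \<inter> y j \<noteq> {}} < k}
    \<le> (\<Sum>t<k. (card R choose t) * (real K ^ 2 / P) ^ t * exp (- ((real K - t) * (real w - t * real K) / P)))"
proof -
  let ?U = "uniform_set P K"
  define N where "N j = y j - (\<Union>i\<in>{i\<in>R. i < j}. y i)" for j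
  have N_sub: "N j \<subseteq> y j" for j by (auto simp: N_def)
  have yd: "finite (y j)" "y j \<subseteq> {1..P}" "card (y j) = K" if "j \<in> R" for j
    using y[OF that] ksubsetsD by auto
  have N_fin: "finite (N j)" "N j \<subseteq> {1..P}" "card (N j) \<le> K" if "j \<in> R" for j
    using yd[OF that] N_sub[of j] finite_subset card_mono by auto
  have N_Un: "(\<Union>j\<in>R. N j) = (\<Union>j\<in>R. y j)"
  proof (intro equalityI subsetI)
    fix x assume "x \<in> (\<Union>j\<in>R. y j)"
    hence ex: "\<exists>j. j \<in> R \<and> x \<in> y j" by auto
    define j where "j = (LEAST j. j \<in> R \<and> x \<in> y j)"
    have "j \<in> R \<and> x \<in> y j" unfolding j_def by (rule LeastI_ex[OF ex])
    moreover have "\<not> (i \<in> R \<and> x \<in> y i)" if "i < j" for i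
      using not_less_Least that unfolding j_def by blast
    ultimately show "x \<in> (\<Union>j\<in>R. N j)" by (auto simp: N_def)
  qed (use N_sub in blast)
  have N_disj: "N i \<inter> N j = {}" if "i \<in> R" "j \<in> R" "i \<noteq> j" for i j
    using that by (cases "i < j") (auto simp: N_def)
  \<comment> \<open>For \<open>T \<subseteq> R\<close> the event is that exactly the sets
    \<open>N j\<close> with \<open>j \<in> T\<close> are met. As \<open>N j \<subseteq> y j\<close>,
    fewer than \<open>k\<close> of them are met whenever fewer than \<open>k\<close> of the
    \<open>y j\<close> are.\<close>
  define F where "F T = {S. (\<forall>j\<in>T. S \<inter> N j \<noteq> {}) \<and> S \<inter> (\<Union>j\<in>R-T. N j) = {}}" for T
  have F: "measure_pmf.prob ?U (F T)
      \<le> (real K ^ 2 / P) ^ t * exp (- ((real K - t) * (real w - t * real K) / P))"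
    if T: "T \<subseteq> R" "card T = t" "t < k" for T t
  proof -
    have finT: "finite T" using T assms(3) finite_subset by blast
    let ?W = "\<Union>j\<in>R-T. N j"
    have W: "?W \<subseteq> {1..P}" "finite ?W" using N_fin assms(3) by auto
    \<comment> \<open>Leaving out the \<open>t\<close> sets indexed by \<open>T\<close> removes at
      most \<open>t * K\<close> objects from the union.\<close>
    have "w \<le> card (?W \<union> (\<Union>j\<in>T. N j))"
      unfolding w_def N_Un[symmetric] using N_fin assms(3) T finT by (intro card_mono) auto
    also have "\<dots> \<le> card ?W + (\<Sum>j\<in>T. card (N j))"
      using card_Un_le[of ?W "\<Union>j\<in>T. N j"] card_UN_le[OF finT, of N] by linarith
    also have "(\<Sum>j\<in>T. card (N j)) \<le> (\<Sum>j\<in>T. K)" using N_fin T by (intro sum_mono) auto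
    finally have "w \<le> card ?W + t * K" using T by simp
    hence "real w \<le> real (card ?W + t * K)" by (simp only: of_nat_le_iff)
    hence wW: "real w - t * real K \<le> card ?W" by simp
    \<comment> \<open>A selection \<open>x\<close> picks one object of \<open>S\<close> from each
      \<open>N j\<close> with \<open>j \<in> T\<close>. Since the \<open>N j\<close> are disjoint,
      these are \<open>t\<close> different objects outside \<open>?W\<close>. There are at most
      \<open>K ^ t\<close> selections, and
      \<open>K ^ t * (K / P) ^ t = (K\<^sup>2 / P) ^ t\<close>.\<close>
    have "F T \<subseteq> (\<Union>x\<in>PiE T N. {S. x ` T \<subseteq> S \<and> S \<inter> ?W = {}})"
    proof
      fix S assume S: "S \<in> F T"
      hence "\<forall>j\<in>T. \<exists>x. x \<in> S \<inter> N j" unfolding F_def by blast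
      then obtain x where x: "\<And>j. j \<in> T \<Longrightarrow> x j \<in> S \<inter> N j" by metis
      have "restrict x T \<in> PiE T N" using x by auto
      moreover have "restrict x T ` T \<subseteq> S" using x by auto
      ultimately show "S \<in> (\<Union>x\<in>PiE T N. {S. x ` T \<subseteq> S \<and> S \<inter> ?W = {}})"
        using S unfolding F_def by blast
    qed
    hence "measure_pmf.prob ?U (F T) \<le> measure_pmf.prob ?U (\<Union>x\<in>PiE T N. {S. x ` T \<subseteq> S \<and> S \<inter> ?W = {}})"
      by (intro measure_pmf.finite_measure_mono) auto
    also have "\<dots> \<le> (\<Sum>x\<in>PiE T N. measure_pmf.prob ?U {S. x ` T \<subseteq> S \<and> S \<inter> ?W = {}})"
      using finT N_fin T by (intro measure_pmf.finite_measure_subadditive_finite finite_PiE) auto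
    also have "\<dots> \<le> (\<Sum>x\<in>PiE T N. (K / P) ^ t * exp (- ((real K - t) * (real w - t * real K) / P)))"
    proof (rule sum_mono)
      fix x assume x: "x \<in> PiE T N"
      have xN: "x j \<in> N j" if "j \<in> T" for j using x that by auto
      have xT: "x ` T \<subseteq> {1..P}" using xN N_fin T by blast
      have "inj_on x T"
      proof (rule inj_onI, rule ccontr)
        fix i j assume ij: "i \<in> T" "j \<in> T" "x i = x j" "i \<noteq> j"
        hence "x i \<in> N i \<inter> N j" using xN[of i] xN[of j] by auto
        thus False using N_disj[of i j] ij T by auto
      qed
      hence c: "card (x ` T) = t" using T by (simp add: card_image)
      have "x ` T \<inter> ?W = {}"
      proof (rule ccontr)
        assume "x ` T \<inter> ?W \<noteq> {}"
        then obtain i j where "i \<in> T" "j \<in> R - T" "x i \<in> N j" by auto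
        thus False using xN[of i] N_disj[of i j] T by auto
      qed
      hence "measure_pmf.prob ?U {S. x ` T \<subseteq> S \<and> S \<inter> ?W = {}}
          \<le> (K / P) ^ t * exp (- ((real K - t) * card ?W / P))"
        using prob_contains_avoids_le[of K P "x ` T" ?W] assms(1) W xT unfolding c by blast
      also have "\<dots> \<le> (K / P) ^ t * exp (- ((real K - t) * (real w - t * real K) / P))"
      proof -
        have "(real K - t) * (real w - t * real K) / P \<le> (real K - t) * card ?W / P"
          using wW T assms(2) by (intro divide_right_mono mult_left_mono) auto
        thus ?thesis by (intro mult_left_mono) auto
      qed
      finally show "measure_pmf.prob ?U {S. x ` T \<subseteq> S \<and> S \<inter> ?W = {}}
          \<le> (K / P) ^ t * exp (- ((real K - t) * (real w - t * real K) / P))" .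
    qed
    also have "\<dots> = card (PiE T N) * ((K / P) ^ t * exp (- ((real K - t) * (real w - t * real K) / P)))"
      by simp
    also have "\<dots> \<le> real K ^ t * ((K / P) ^ t * exp (- ((real K - t) * (real w - t * real K) / P)))"
    proof (rule mult_right_mono)
      have "card (PiE T N) = (\<Prod>j\<in>T. card (N j))" using finT by (rule card_PiE)
      also have "\<dots> \<le> (\<Prod>j\<in>T. K)" using N_fin T by (intro prod_mono) auto
      finally have "card (PiE T N) \<le> K ^ t" using T by simp
      thus "real (card (PiE T N)) \<le> real K ^ t" by (simp only: of_nat_power[symmetric] of_nat_le_iff)
    qed auto
    also have "\<dots> = (real K ^ 2 / P) ^ t * exp (- ((real K - t) * (real w - t * real K) / P))"
      by (simp add: power_mult_distrib[symmetric] power2_eq_square mult.assoc[symmetric])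
    finally show ?thesis .
  qed
  have "{S. card {j\<in>R. S \<inter> y j \<noteq> {}} < k} \<subseteq> (\<Union>t\<in>{..<k}. \<Union>T\<in>{T. T \<subseteq> R \<and> card T = t}. F T)"
  proof
    fix S assume "S \<in> {S. card {j\<in>R. S \<inter> y j \<noteq> {}} < k}"
    hence S: "card {j\<in>R. S \<inter> y j \<noteq> {}} < k" by simp
    let ?T = "{j\<in>R. S \<inter> N j \<noteq> {}}"
    have "card ?T \<le> card {j\<in>R. S \<inter> y j \<noteq> {}}" using N_sub assms(3) by (intro card_mono) auto
    hence "card ?T \<in> {..<k}" using S by simp
    moreover have "?T \<in> {T. T \<subseteq> R \<and> card T = card ?T}" by simp
    moreover have "S \<in> F ?T" unfolding F_def by auto
    ultimately show "S \<in> (\<Union>t\<in>{..<k}. \<Union>T\<in>{T. T \<subseteq> R \<and> card T = t}. F T)"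
      by (intro UN_I)
  qed
  hence "measure_pmf.prob ?U {S. card {j\<in>R. S \<inter> y j \<noteq> {}} < k}
      \<le> measure_pmf.prob ?U (\<Union>t\<in>{..<k}. \<Union>T\<in>{T. T \<subseteq> R \<and> card T = t}. F T)"
    by (intro measure_pmf.finite_measure_mono) auto
  also have "\<dots> \<le> (\<Sum>t<k. measure_pmf.prob ?U (\<Union>T\<in>{T. T \<subseteq> R \<and> card T = t}. F T))"
    by (rule measure_pmf.finite_measure_subadditive_finite) auto
  also have "\<dots> \<le> (\<Sum>t<k. \<Sum>T\<in>{T. T \<subseteq> R \<and> card T = t}. measure_pmf.prob ?U (F T))"
    using assms(3) by (intro sum_mono measure_pmf.finite_measure_subadditive_finite) auto
  also have "\<dots> \<le> (\<Sum>t<k. \<Sum>T\<in>{T. T \<subseteq> R \<and> card T = t}.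
      (real K ^ 2 / P) ^ t * exp (- ((real K - t) * (real w - t * real K) / P)))"
    using F by (intro sum_mono) auto
  also have "\<dots> = (\<Sum>t<k. (card R choose t) * (real K ^ 2 / P) ^ t
      * exp (- ((real K - t) * (real w - t * real K) / P)))"
    by (simp add: n_subsets[OF assms(3)] mult.assoc)
  finally show ?thesis .
qed

text \<open>The neighbours in \<open>T\<close> are left unconstrained and only the avoidance of all
  other sets is used. The price is the number of possible \<open>T\<close>, at most
  \<open>n ^ k\<close>, in place of a power of \<open>x\<close>; it is affordable once
  \<open>K * w / P\<close> exceeds \<open>k * ln n\<close> with room to spare.\<close>

lemma prob_few_neighbors_le_crude:
  assumes "K \<le> P" "finite R" "card R \<le> n" "2 \<le> n" and y: "\<And>j. j \<in> R \<Longrightarrow> y j \<in> ksubsets P K"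
    and big: "\<And>T. T \<subseteq> R \<Longrightarrow> card T < k \<Longrightarrow> w \<le> real (card (\<Union>j\<in>R-T. y j))"
  shows "measure_pmf.prob (uniform_set P K) {S. card {j\<in>R. S \<inter> y j \<noteq> {}} < k}
    \<le> real n ^ k * exp (- (real K * w / P))"
proof -
  let ?U = "uniform_set P K"
  define F where "F T = {S. S \<inter> (\<Union>j\<in>R-T. y j) = {}}" for T
  have F: "measure_pmf.prob ?U (F T) \<le> exp (- (real K * w / P))" if "T \<subseteq> R" "card T < k" for T
  proof -
    have "(\<Union>j\<in>R-T. y j) \<subseteq> {1..P}" using y ksubsetsD by blast
    hence "measure_pmf.prob ?U (F T) \<le> exp (- (real K * real (card (\<Union>j\<in>R-T. y j)) / P))"
      unfolding F_def by (rule prob_avoids_le[OF assms(1)])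
    also have "\<dots> \<le> exp (- (real K * w / P))"
      using big[OF that] by (auto intro!: divide_right_mono mult_left_mono)
    finally show ?thesis .
  qed
  have sub: "{S. card {j\<in>R. S \<inter> y j \<noteq> {}} < k} \<subseteq> (\<Union>t\<in>{..<k}. \<Union>T\<in>{T. T \<subseteq> R \<and> card T = t}. F T)"
  proof
    fix S assume "S \<in> {S. card {j\<in>R. S \<inter> y j \<noteq> {}} < k}"
    hence "card {j\<in>R. S \<inter> y j \<noteq> {}} \<in> {..<k}" by simp
    moreover have "{j\<in>R. S \<inter> y j \<noteq> {}} \<in> {T. T \<subseteq> R \<and> card T = card {j\<in>R. S \<inter> y j \<noteq> {}}}" by simp
    moreover have "S \<in> F {j\<in>R. S \<inter> y j \<noteq> {}}" unfolding F_def by auto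
    ultimately show "S \<in> (\<Union>t\<in>{..<k}. \<Union>T\<in>{T. T \<subseteq> R \<and> card T = t}. F T)"
      by (intro UN_I)
  qed
  have geo: "(\<Sum>t<m. real n ^ t) \<le> real n ^ m" for m
  proof (induction m)
    case (Suc m)
    have "(\<Sum>t<Suc m. real n ^ t) \<le> 2 * real n ^ m" using Suc by simp
    also have "\<dots> \<le> real n * real n ^ m" using assms(4) by (intro mult_right_mono) auto
    finally show ?case by simp
  qed simp
  from sub have "measure_pmf.prob ?U {S. card {j\<in>R. S \<inter> y j \<noteq> {}} < k}
      \<le> measure_pmf.prob ?U (\<Union>t\<in>{..<k}. \<Union>T\<in>{T. T \<subseteq> R \<and> card T = t}. F T)"
    by (intro measure_pmf.finite_measure_mono) auto
  also have "\<dots> \<le> (\<Sum>t<k. measure_pmf.prob ?U (\<Union>T\<in>{T. T \<subseteq> R \<and> card T = t}. F T))"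
    by (rule measure_pmf.finite_measure_subadditive_finite) auto
  also have "\<dots> \<le> (\<Sum>t<k. \<Sum>T\<in>{T. T \<subseteq> R \<and> card T = t}. measure_pmf.prob ?U (F T))"
    using assms(2) by (intro sum_mono measure_pmf.finite_measure_subadditive_finite) auto
  also have "\<dots> \<le> (\<Sum>t<k. \<Sum>T\<in>{T. T \<subseteq> R \<and> card T = t}. exp (- (real K * w / P)))"
    using F by (intro sum_mono) auto
  also have "\<dots> = (\<Sum>t<k. real (card R choose t) * exp (- (real K * w / P)))"
    by (simp add: n_subsets[OF assms(2)])
  also have "\<dots> \<le> (\<Sum>t<k. real n ^ t * exp (- (real K * w / P)))"
  proof (intro sum_mono mult_right_mono)
    fix t
    have "card R choose t \<le> card R ^ t"
      by (cases "t \<le> card R") (auto intro: binomial_le_pow simp: binomial_eq_0)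
    also have "\<dots> \<le> n ^ t" using assms(3) by (rule power_mono) simp
    finally show "real (card R choose t) \<le> real n ^ t" by (simp only: of_nat_power[symmetric] of_nat_le_iff)
  qed auto
  also have "\<dots> \<le> real n ^ k * exp (- (real K * w / P))"
    using geo[of k] by (simp add: sum_distrib_right[symmetric])
  finally show ?thesis .
qed

section \<open>Size of a union of independent sets\<close>

lemma set_Pi_uniform_set:
  assumes "K \<le> P" "finite R" "y \<in> set_pmf (Pi_pmf R {} (\<lambda>_. uniform_set P K))" "j \<in> R"
  shows "y j \<in> ksubsets P K"
  using assms by (auto simp: set_Pi_pmf PiE_dflt_def set_uniform_set)

lemma finite_set_Pi_uniform_set [simp]:
  "K \<le> P \<Longrightarrow> finite R \<Longrightarrow> finite (set_pmf (Pi_pmf R d (\<lambda>_. uniform_set P K)))"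
  by (intro finite_set_Pi_pmf) (auto simp: set_uniform_set)

lemma card_Union_le_of_ksubsets:
  assumes "finite R" "\<And>j. j \<in> R \<Longrightarrow> y j \<in> ksubsets P K"
  shows "card (\<Union>j\<in>R. y j) \<le> card R * K"
proof -
  have "card (\<Union>j\<in>R. y j) \<le> (\<Sum>j\<in>R. card (y j))" using assms by (intro card_UN_le)
  also have "\<dots> = (\<Sum>j\<in>R. K)" using assms ksubsetsD by (intro sum.cong) auto
  finally show ?thesis by simp
qed

text \<open>One set \<open>S\<close> at a time is added to the union \<open>W\<close> of the others,
  with \<open>card (S \<union> W) = K + card W - card (S \<inter> W)\<close>. The overlap is charged
  by its exponential moment, whose exponent is at most \<open>2 * lam * K * M / P\<close>; the fixed
  bound \<open>M\<close> on the number of objects makes the charge the same in every round.\<close>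

lemma expectation_exp_neg_card_Union_le:
  fixes lam M :: real
  assumes "K \<le> P" "finite R" "0 \<le> lam" "lam \<le> 1" "real (card R * K) \<le> M"
  shows "measure_pmf.expectation (Pi_pmf R {} (\<lambda>_. uniform_set P K)) (\<lambda>y. exp (- (lam * card (\<Union>j\<in>R. y j))))
    \<le> exp (- (lam * K * card R * (1 - 2 * M / P)))"
  using assms(2,5)
proof (induction R rule: finite_induct)
  case (insert r R)
  let ?U = "uniform_set P K" and ?p = "Pi_pmf R {} (\<lambda>_. uniform_set P K)"
  let ?g = "exp (- (lam * K * (1 - 2 * M / P)))"
  have M: "real (card R * K) \<le> M" using insert by (simp add: algebra_simps)
  have step: "measure_pmf.expectation ?U (\<lambda>S. exp (- (lam * card (S \<union> W)))) \<le> exp (- (lam * card W)) * ?g"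
    if W: "W \<subseteq> {1..P}" "real (card W) \<le> M" for W
  proof -
    have finW: "finite W" using W finite_subset by blast
    have "measure_pmf.expectation ?U (\<lambda>S. exp (- (lam * card (S \<union> W))))
       = measure_pmf.expectation ?U (\<lambda>S. exp (- (lam * card W) - lam * K) * exp (lam * card (S \<inter> W)))"
    proof (intro integral_cong_AE AE_pmfI)
      fix S assume "S \<in> set_pmf ?U"
      hence S: "finite S" "card S = K" using set_uniform_set[OF assms(1)] ksubsetsD by auto
      have "card S + card W = card (S \<union> W) + card (S \<inter> W)" using S finW by (rule_tac card_Un_Int) auto
      hence "real (card (S \<union> W)) = real K + card W - card (S \<inter> W)" using S(2) by linarith
      hence "- (lam * card (S \<union> W)) = (- (lam * card W) - lam * K) + lam * card (S \<inter> W)"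
        by (simp only:) (simp add: algebra_simps)
      thus "exp (- (lam * card (S \<union> W))) = exp (- (lam * card W) - lam * K) * exp (lam * card (S \<inter> W))"
        by (simp only: exp_add)
    qed auto
    also have "\<dots> = exp (- (lam * card W) - lam * K) * measure_pmf.expectation ?U (\<lambda>S. exp (lam * card (S \<inter> W)))"
      by simp
    also have "\<dots> \<le> exp (- (lam * card W) - lam * K) * exp ((exp lam - 1) * (real K * card W / P))"
      using W assms by (intro mult_left_mono expectation_exp_card_Int_le) auto
    also have "\<dots> \<le> exp (- (lam * card W) - lam * K) * exp (2 * lam * (real K * M / P))"
    proof -
      have "exp lam \<le> 1 + lam + lam\<^sup>2" using assms by (intro exp_bound) auto
      also have "lam\<^sup>2 \<le> lam" using assms by (simp add: power2_eq_square mult_left_le)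
      finally have "exp lam - 1 \<le> 2 * lam" by simp
      moreover have "real K * card W / P \<le> real K * M / P"
        using W by (intro divide_right_mono mult_left_mono) auto
      ultimately have "(exp lam - 1) * (real K * card W / P) \<le> 2 * lam * (real K * M / P)"
        using assms by (intro mult_mono) auto
      thus ?thesis by simp
    qed
    also have "\<dots> = exp (- (lam * card W)) * ?g"
      by (simp add: exp_add[symmetric] algebra_simps)
    finally show ?thesis .
  qed
  have "measure_pmf.expectation (Pi_pmf (insert r R) {} (\<lambda>_. ?U)) (\<lambda>y. exp (- (lam * card (\<Union>j\<in>insert r R. y j))))
     = measure_pmf.expectation (pair_pmf ?U ?p) (\<lambda>Sf. exp (- (lam * card (\<Union>j\<in>insert r R. ((snd Sf)(r := fst Sf)) j))))"
    using insert by (simp add: Pi_pmf_insert case_prod_beta)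
  also have "\<dots> = measure_pmf.expectation (pair_pmf ?U ?p) (\<lambda>Sf. exp (- (lam * card (fst Sf \<union> (\<Union>j\<in>R. snd Sf j)))))"
  proof -
    have "(\<Union>j\<in>insert r R. (f(r := S)) j) = S \<union> (\<Union>j\<in>R. f j)" for f :: "'a \<Rightarrow> nat set" and S
      using insert by (auto split: if_splits)
    thus ?thesis by simp
  qed
  also have "\<dots> = measure_pmf.expectation ?p (\<lambda>y. measure_pmf.expectation ?U (\<lambda>S. exp (- (lam * card (S \<union> (\<Union>j\<in>R. y j))))))"
    using insert assms by (subst expectation_pair_pmf_finite_swap) (auto simp: set_uniform_set)
  also have "\<dots> \<le> measure_pmf.expectation ?p (\<lambda>y. exp (- (lam * card (\<Union>j\<in>R. y j))) * ?g)"
  proof (intro integral_mono_AE integrable_measure_pmf_finite AE_pmfI)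
    fix y assume "y \<in> set_pmf ?p"
    hence y: "y j \<in> ksubsets P K" if "j \<in> R" for j
      using set_Pi_uniform_set[OF assms(1) insert.hyps(1)] that by blast
    have "(\<Union>j\<in>R. y j) \<subseteq> {1..P}" using y ksubsetsD by blast
    moreover have "real (card (\<Union>j\<in>R. y j)) \<le> M"
      using card_Union_le_of_ksubsets[OF insert.hyps(1) y] M by (meson of_nat_le_iff order_trans)
    ultimately show "measure_pmf.expectation ?U (\<lambda>S. exp (- (lam * card (S \<union> (\<Union>j\<in>R. y j)))))
        \<le> exp (- (lam * card (\<Union>j\<in>R. y j))) * ?g" by (rule step)
  qed (use insert assms in auto)
  also have "\<dots> = measure_pmf.expectation ?p (\<lambda>y. exp (- (lam * card (\<Union>j\<in>R. y j)))) * ?g" by simp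
  also have "\<dots> \<le> exp (- (lam * K * card R * (1 - 2 * M / P))) * ?g"
    by (intro mult_right_mono insert.IH M) auto
  also have "\<dots> = exp (- (lam * K * card (insert r R) * (1 - 2 * M / P)))"
    using insert.hyps by (simp add: exp_add[symmetric] algebra_simps)
  finally show ?case .
qed simp

section \<open>Poorly connected node sets\<close>

text \<open>The failure of the robustness clause for \<open>A\<close>, phrased with object sets
  instead of edges so that conditioning on the sets outside \<open>A\<close> applies
  directly.\<close>

definition poorly_connected :: "nat \<Rightarrow> nat \<Rightarrow> nat set \<Rightarrow> (nat \<Rightarrow> nat set) \<Rightarrow> bool" where
  "poorly_connected k n A S \<longleftrightarrow> (\<forall>i\<in>A. card {j \<in> {1..n} - A. S i \<inter> S j \<noteq> {}} < k)"

lemma neighbors_in_intersection_edges: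
  assumes "v \<in> {1..n}" "U \<subseteq> {1..n}" "v \<notin> U"
  shows "neighbors_in (intersection_edges n S) v U = {w \<in> U. S v \<inter> S w \<noteq> {}}"
proof -
  have "{v, w} \<in> intersection_edges n S \<longleftrightarrow> S v \<inter> S w \<noteq> {}" if "w \<in> U" for w
  proof
    assume "{v, w} \<in> intersection_edges n S"
    thus "S v \<inter> S w \<noteq> {}" unfolding intersection_edges_def by (auto simp: doubleton_eq_iff)
  next
    assume "S v \<inter> S w \<noteq> {}"
    moreover have "w \<in> {1..n}" "v \<noteq> w" using assms that by auto
    ultimately show "{v, w} \<in> intersection_edges n S"
      using assms(1) unfolding intersection_edges_def by blast
  qed
  thus ?thesis unfolding neighbors_in_def by auto
qed

text \<open>Of two disjoint sets violating robustness, the smaller one has at most \<open>n / 2\<close> elements.\<close>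

lemma not_k_robust_imp_poorly_connected:
  assumes "\<not> k_robust k {1..n} (intersection_edges n S)"
  obtains A where "A \<subseteq> {1..n}" "A \<noteq> {}" "2 * card A \<le> n" "poorly_connected k n A S"
proof -
  obtain A B where AB: "A \<subseteq> {1..n}" "B \<subseteq> {1..n}" "A \<noteq> {}" "B \<noteq> {}" "A \<inter> B = {}"
    and A': "\<not> (\<exists>v\<in>A. k \<le> card (neighbors_in (intersection_edges n S) v ({1..n} - A)))"
    and B': "\<not> (\<exists>v\<in>B. k \<le> card (neighbors_in (intersection_edges n S) v ({1..n} - B)))"
    using assms unfolding k_robust_def by blast
  have A: "card (neighbors_in (intersection_edges n S) v ({1..n} - A)) < k" if "v \<in> A" for v
    using A' that not_le by blast
  have B: "card (neighbors_in (intersection_edges n S) v ({1..n} - B)) < k" if "v \<in> B" for v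
    using B' that not_le by blast
  have pc: "poorly_connected k n X S" if "X \<subseteq> {1..n}"
    "\<And>v. v \<in> X \<Longrightarrow> card (neighbors_in (intersection_edges n S) v ({1..n} - X)) < k" for X
    unfolding poorly_connected_def
  proof
    fix i assume "i \<in> X"
    thus "card {j \<in> {1..n} - X. S i \<inter> S j \<noteq> {}} < k"
      using that(2)[of i] that(1) neighbors_in_intersection_edges[of i n "{1..n} - X" S] by auto
  qed
  have fin: "finite A" "finite B" using AB finite_subset by blast+
  have "card A + card B = card (A \<union> B)" using AB fin by (simp add: card_Un_disjoint)
  also have "\<dots> \<le> card {1..n}" using AB by (intro card_mono) auto
  finally have "2 * card A \<le> n \<or> 2 * card B \<le> n" by auto
  thus ?thesis using that[of A] that[of B] pc[of A] pc[of B] A B AB by blast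
qed

lemma prob_not_k_robust_le:
  "1 - measure_pmf.prob (intersection_graph_pmf n P (return_pmf K)) {E. k_robust k {1..n} E}
    \<le> (\<Sum>A | A \<subseteq> {1..n} \<and> A \<noteq> {} \<and> 2 * card A \<le> n.
         measure_pmf.prob (Pi_pmf {1..n} {} (\<lambda>_. uniform_set P K)) {S. poorly_connected k n A S})"
proof -
  let ?p = "Pi_pmf {1..n} {} (\<lambda>_. uniform_set P K)"
  let ?I = "{A. A \<subseteq> {1..n} \<and> A \<noteq> {} \<and> 2 * card A \<le> n}"
  have fin: "finite ?I" by (rule finite_subset[of _ "Pow {1..n}"]) auto
  have "1 - measure_pmf.prob (intersection_graph_pmf n P (return_pmf K)) {E. k_robust k {1..n} E}
      = 1 - measure_pmf.prob ?p {S. k_robust k {1..n} (intersection_edges n S)}"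
    by (simp add: prob_intersection_graph object_set_pmf_return)
  also have "\<dots> = measure_pmf.prob ?p (space (measure_pmf ?p) - {S. k_robust k {1..n} (intersection_edges n S)})"
    by (subst measure_pmf.prob_compl) auto
  also have "\<dots> \<le> measure_pmf.prob ?p (\<Union>A\<in>?I. {S. poorly_connected k n A S})"
  proof (rule measure_pmf.finite_measure_mono)
    show "space (measure_pmf ?p) - {S. k_robust k {1..n} (intersection_edges n S)}
        \<subseteq> (\<Union>A\<in>?I. {S. poorly_connected k n A S})"
    proof
      fix S assume "S \<in> space (measure_pmf ?p) - {S. k_robust k {1..n} (intersection_edges n S)}"
      hence "\<not> k_robust k {1..n} (intersection_edges n S)" by simp
      then obtain A where "A \<subseteq> {1..n}" "A \<noteq> {}" "2 * card A \<le> n" "poorly_connected k n A S"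
        by (rule not_k_robust_imp_poorly_connected)
      thus "S \<in> (\<Union>A\<in>?I. {S. poorly_connected k n A S})" by blast
    qed
  qed simp
  also have "\<dots> \<le> (\<Sum>A\<in>?I. measure_pmf.prob ?p {S. poorly_connected k n A S})"
    using fin by (rule measure_pmf.finite_measure_subadditive_finite) auto
  finally show ?thesis .
qed

lemma prob_poorly_connected:
  assumes "K \<le> P" "A \<subseteq> {1..n}"
  shows "measure_pmf.prob (Pi_pmf {1..n} {} (\<lambda>_. uniform_set P K)) {S. poorly_connected k n A S}
    = measure_pmf.expectation (Pi_pmf ({1..n} - A) {} (\<lambda>_. uniform_set P K))
        (\<lambda>y. measure_pmf.prob (uniform_set P K) {S. card {j \<in> {1..n} - A. S \<inter> y j \<noteq> {}} < k} ^ card A)"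
proof -
  let ?R = "{1..n} - A"
  have "{1..n} = A \<union> ?R" using assms by auto
  hence "measure_pmf.prob (Pi_pmf {1..n} {} (\<lambda>_. uniform_set P K)) {S. poorly_connected k n A S}
    = measure_pmf.prob (Pi_pmf (A \<union> ?R) {} (\<lambda>_. uniform_set P K))
        {S. \<forall>i\<in>A. card {j \<in> ?R. S i \<inter> S j \<noteq> {}} < k}"
    by (simp add: poorly_connected_def)
  also have "\<dots> = measure_pmf.expectation (Pi_pmf ?R {} (\<lambda>_. uniform_set P K))
        (\<lambda>y. measure_pmf.prob (uniform_set P K) {S. card {j \<in> ?R. S \<inter> y j \<noteq> {}} < k} ^ card A)"
  proof (rule prob_all_conditionally_independent)
    fix x :: "nat set" and S S' :: "nat \<Rightarrow> nat set"
    assume "\<And>j. j \<in> ?R \<Longrightarrow> S j = S' j"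
    hence "{j \<in> ?R. x \<inter> S j \<noteq> {}} = {j \<in> ?R. x \<inter> S' j \<noteq> {}}" by auto
    thus "(card {j \<in> ?R. x \<inter> S j \<noteq> {}} < k) = (card {j \<in> ?R. x \<inter> S' j \<noteq> {}} < k)" by simp
  qed (use assms finite_subset[of A "{1..n}"] in \<open>auto simp: set_uniform_set\<close>)
  finally show ?thesis .
qed

section \<open>Sparse range: the object sets hardly overlap\<close>

text \<open>The constant \<open>exp 3\<close> collects three unit losses per node of
  \<open>A\<close>: \<open>h1\<close> and \<open>h2\<close> bound the difference between
  \<open>(K - t) * (w - t * K) / P\<close> and \<open>K * w / P\<close>, and \<open>h3\<close>
  bounds the loss from overlaps among the sets outside \<open>A\<close>. It is \<open>h3\<close>
  that asks for \<open>n * K / P\<close> to be small compared with \<open>1 / x\<close>.\<close>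

lemma prob_poorly_connected_sparse_le:
  fixes n k K P :: nat and x :: real
  defines "x \<equiv> real n * real K ^ 2 / P"
  assumes "K \<le> P" "k \<le> K" "1 \<le> n" "1 \<le> k" "A \<subseteq> {1..n}"
    and x: "1 \<le> x" and h1: "real k * (real n * K / P) \<le> 1" and h2: "real k * (real K ^ 2 / P) \<le> 1"
    and h3: "2 * x * (real n * K / P) \<le> 1"
  shows "measure_pmf.prob (Pi_pmf {1..n} {} (\<lambda>_. uniform_set P K)) {S. poorly_connected k n A S}
    \<le> (k * exp 3 * x ^ (k - 1) * exp (- (x * (1 - card A / n)))) ^ card A"
proof -
  let ?R = "{1..n} - A" and ?a = "card A"
  let ?p = "Pi_pmf ?R {} (\<lambda>_. uniform_set P K)"
  let ?B = "k * exp 2 * x ^ (k - 1)"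
  have finA: "finite A" and a: "?a \<le> n" using assms(6) finite_subset card_mono[of "{1..n}" A] by auto
  have R: "card ?R = n - ?a" using assms(6) finA by (simp add: card_Diff_subset)
  have nKP: "real n * K / P \<le> 1" using h1 assms(5) mult_right_mono[of 1 "real k" "real n * K / P"] by simp
  have f: "measure_pmf.prob (uniform_set P K) {S. card {j \<in> ?R. S \<inter> y j \<noteq> {}} < k}
      \<le> ?B * exp (- (K * real (card (\<Union>j\<in>?R. y j)) / P))" if y: "y \<in> set_pmf ?p" for y
  proof -
    let ?w = "card (\<Union>j\<in>?R. y j)"
    have yk: "y j \<in> ksubsets P K" if "j \<in> ?R" for j
      using set_Pi_uniform_set[OF assms(2) _ y that] by simp
    have "?w \<le> card ?R * K" using yk by (intro card_Union_le_of_ksubsets) auto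
    also have "\<dots> \<le> n * K" unfolding R by simp
    finally have w: "real ?w \<le> real n * K" by (simp only: of_nat_mult[symmetric] of_nat_le_iff)
    have "measure_pmf.prob (uniform_set P K) {S. card {j \<in> ?R. S \<inter> y j \<noteq> {}} < k}
      \<le> (\<Sum>t<k. (card ?R choose t) * (real K ^ 2 / P) ^ t * exp (- ((real K - t) * (real ?w - t * real K) / P)))"
      using yk assms(2,3) by (intro prob_few_neighbors_le) auto
    also have "\<dots> \<le> (\<Sum>t<k. x ^ (k - 1) * (exp 2 * exp (- (K * real ?w / P))))"
    proof (intro sum_mono mult_mono)
      fix t assume t: "t \<in> {..<k}"
      have "card ?R choose t \<le> card ?R ^ t"
        by (cases "t \<le> card ?R") (auto intro: binomial_le_pow simp: binomial_eq_0)
      also have "\<dots> \<le> n ^ t" unfolding R by (rule power_mono) auto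
      finally have "real (card ?R choose t) \<le> real n ^ t" by (simp only: of_nat_power[symmetric] of_nat_le_iff)
      hence "(card ?R choose t) * (real K ^ 2 / P) ^ t \<le> real n ^ t * (real K ^ 2 / P) ^ t"
        by (intro mult_right_mono) auto
      also have "\<dots> = x ^ t" by (simp add: x_def power_mult_distrib[symmetric])
      \<comment> \<open>Since \<open>x \<ge> 1\<close>, the largest exponent can stand for all
        \<open>t < k\<close>. This is the factor that the term \<open>(k - 1) * ln (ln n)\<close>
        later absorbs.\<close>
      also have "\<dots> \<le> x ^ (k - 1)" using x t by (intro power_increasing) auto
      finally show "(card ?R choose t) * (real K ^ 2 / P) ^ t \<le> x ^ (k - 1)" .
      have "t * real ?w / P \<le> real k * (real n * K) / P"
        using w t by (intro divide_right_mono mult_mono) auto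
      hence 1: "t * real ?w / P \<le> 1" using h1 by simp
      have "t * real K ^ 2 / P \<le> real k * real K ^ 2 / P" using t by (intro divide_right_mono mult_right_mono) auto
      hence 2: "t * real K ^ 2 / P \<le> 1" using h2 by simp
      have "(real K - t) * (real ?w - t * real K) / P
          = K * real ?w / P - t * real ?w / P - t * real K ^ 2 / P + real t ^ 2 * K / P"
        by (simp add: power2_eq_square algebra_simps diff_divide_distrib add_divide_distrib)
      moreover have "0 \<le> real t ^ 2 * K / P" by simp
      ultimately have "- ((real K - t) * (real ?w - t * real K) / P) \<le> 2 + (- (K * real ?w / P))"
        using 1 2 by linarith
      thus "exp (- ((real K - t) * (real ?w - t * real K) / P)) \<le> exp 2 * exp (- (K * real ?w / P))"
        unfolding exp_add[symmetric] by simp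
    qed (use x in auto)
    finally show ?thesis by (simp add: mult_ac)
  qed
  have "measure_pmf.prob (Pi_pmf {1..n} {} (\<lambda>_. uniform_set P K)) {S. poorly_connected k n A S}
    = measure_pmf.expectation ?p
        (\<lambda>y. measure_pmf.prob (uniform_set P K) {S. card {j \<in> ?R. S \<inter> y j \<noteq> {}} < k} ^ ?a)"
    using assms by (intro prob_poorly_connected)
  also have "\<dots> \<le> measure_pmf.expectation ?p (\<lambda>y. ?B ^ ?a * exp (- ((?a * real K / P) * card (\<Union>j\<in>?R. y j))))"
  proof (intro integral_mono_AE integrable_measure_pmf_finite AE_pmfI)
    fix y assume "y \<in> set_pmf ?p"
    hence "measure_pmf.prob (uniform_set P K) {S. card {j \<in> ?R. S \<inter> y j \<noteq> {}} < k} ^ ?a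
      \<le> (?B * exp (- (K * real (card (\<Union>j\<in>?R. y j)) / P))) ^ ?a" by (intro power_mono f) auto
    also have "\<dots> = ?B ^ ?a * exp (- ((?a * real K / P) * card (\<Union>j\<in>?R. y j)))"
      by (simp add: power_mult_distrib exp_of_nat_mult[symmetric])
    finally show "measure_pmf.prob (uniform_set P K) {S. card {j \<in> ?R. S \<inter> y j \<noteq> {}} < k} ^ ?a
      \<le> ?B ^ ?a * exp (- ((?a * real K / P) * card (\<Union>j\<in>?R. y j)))" .
  qed (use assms in auto)
  also have "\<dots> = ?B ^ ?a * measure_pmf.expectation ?p (\<lambda>y. exp (- ((?a * real K / P) * card (\<Union>j\<in>?R. y j))))"
    by simp
  \<comment> \<open>The exponential moment is taken at \<open>lam = card A * K / P\<close>, because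
    the common union enters once for every node of \<open>A\<close>; \<open>M = n * K\<close> bounds
    the number of objects in it.\<close>
  also have "\<dots> \<le> ?B ^ ?a * exp (- ((?a * real K / P) * K * card ?R * (1 - 2 * (real n * K) / P)))"
  proof (intro mult_left_mono expectation_exp_neg_card_Union_le)
    have "?a * real K / P \<le> real n * K / P" using a by (intro divide_right_mono mult_right_mono) auto
    thus "?a * real K / P \<le> 1" using nKP by simp
    have "card ?R * K \<le> n * K" unfolding R by simp
    thus "real (card ?R * K) \<le> real n * K" by (simp only: of_nat_mult[symmetric] of_nat_le_iff)
  qed (use assms x in auto)
  also have "\<dots> \<le> ?B ^ ?a * exp (?a * (1 - x * (1 - ?a / n)))"
  proof -
    have "real n * (1 - ?a / n) = card ?R" unfolding R using a assms(4) by (simp add: of_nat_diff field_simps)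
    hence "x * (1 - ?a / n) = real K ^ 2 / P * card ?R" unfolding x_def by (metis mult.commute mult.left_commute times_divide_eq_right)
    hence eq: "(?a * real K / P) * K * card ?R = ?a * (x * (1 - ?a / n))"
      by (simp add: power2_eq_square)
    have "x * (1 - ?a / n) * (2 * (real n * K) / P) \<le> x * 1 * (2 * (real n * K) / P)"
      using x assms(4) by (intro mult_right_mono mult_left_mono) auto
    also have "\<dots> \<le> 1" using h3 by (simp add: mult_ac)
    finally have "x * (1 - ?a / n) - 1 \<le> x * (1 - ?a / n) * (1 - 2 * (real n * K) / P)"
      by (simp add: algebra_simps)
    hence "?a * (x * (1 - ?a / n) - 1) \<le> ?a * (x * (1 - ?a / n) * (1 - 2 * (real n * K) / P))"
      by (intro mult_left_mono) auto
    moreover have "- (b * v * c) \<le> b * (1 - v)" if "b * (v - 1) \<le> b * (v * c)" for b v c :: real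
      using that by (simp add: algebra_simps)
    ultimately have "- ((?a * real K / P) * K * card ?R * (1 - 2 * (real n * K) / P)) \<le> ?a * (1 - x * (1 - ?a / n))"
      unfolding eq by blast
    thus ?thesis using x by (intro mult_left_mono) auto
  qed
  also have "\<dots> = (k * exp 3 * x ^ (k - 1) * exp (- (x * (1 - card A / n)))) ^ ?a"
  proof -
    have "exp (?a * (1 - x * (1 - ?a / n))) = exp (1 - x * (1 - ?a / n)) ^ ?a" by (simp add: exp_of_nat_mult)
    also have "exp (1 - x * (1 - ?a / n)) = exp 1 * exp (- (x * (1 - ?a / n)))"
      by (simp only: exp_add[symmetric] diff_conv_add_uminus)
    finally have "exp (?a * (1 - x * (1 - ?a / n))) = (exp 1 * exp (- (x * (1 - ?a / n)))) ^ ?a" .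
    moreover have "exp (3::real) = exp 2 * exp 1" by (simp add: exp_add[symmetric])
    ultimately show ?thesis by (simp add: power_mult_distrib mult_ac)
  qed
  finally show ?thesis .
qed

section \<open>Dense range: crude bounds for the union\<close>

text \<open>A union of at most \<open>w\<close> objects lies inside some \<open>w\<close>-subset
  \<open>Y\<close> of the pool. The number of candidates \<open>Y\<close> gives the first factor,
  the independence of the sets in \<open>R'\<close> the second.\<close>

lemma prob_card_Union_le:
  assumes "K \<le> P" "finite R" "R' \<subseteq> R" "w \<le> P"
  shows "measure_pmf.prob (Pi_pmf R {} (\<lambda>_. uniform_set P K)) {y. card (\<Union>j\<in>R'. y j) \<le> w}
    \<le> (P choose w) * (w / P) ^ (K * card R')"
proof -
  let ?p = "Pi_pmf R {} (\<lambda>_. uniform_set P K)" and ?U = "uniform_set P K"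
  have finR': "finite R'" using assms finite_subset by blast
  have "measure_pmf.prob ?p {y. card (\<Union>j\<in>R'. y j) \<le> w}
      \<le> measure_pmf.prob ?p (\<Union>Y\<in>ksubsets P w. Pi R (\<lambda>j. if j \<in> R' then Pow Y else UNIV))"
  proof (intro measure_pmf.finite_measure_mono_AE AE_pmfI impI)
    fix y assume y: "y \<in> set_pmf ?p" and "y \<in> {y. card (\<Union>j\<in>R'. y j) \<le> w}"
    hence c: "card (\<Union>j\<in>R'. y j) \<le> w" by simp
    have "(\<Union>j\<in>R'. y j) \<subseteq> {1..P}"
      using set_Pi_uniform_set[OF assms(1,2) y] ksubsetsD assms(3) by blast
    then obtain Y where "(\<Union>j\<in>R'. y j) \<subseteq> Y" "Y \<subseteq> {1..P}" "card Y = w"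
      using exists_subset_between[of "\<Union>j\<in>R'. y j" w "{1..P}"] c assms(4) by auto
    thus "y \<in> (\<Union>Y\<in>ksubsets P w. Pi R (\<lambda>j. if j \<in> R' then Pow Y else UNIV))"
      by (intro UN_I[of Y]) (auto simp: ksubsets_def Pi_def)
  qed simp
  also have "\<dots> \<le> (\<Sum>Y\<in>ksubsets P w. measure_pmf.prob ?p (Pi R (\<lambda>j. if j \<in> R' then Pow Y else UNIV)))"
    by (rule measure_pmf.finite_measure_subadditive_finite) auto
  also have "\<dots> \<le> (\<Sum>Y\<in>ksubsets P w. (w / P) ^ (K * card R'))"
  proof (rule sum_mono)
    fix Y assume Y: "Y \<in> ksubsets P w"
    have "measure_pmf.prob ?p (Pi R (\<lambda>j. if j \<in> R' then Pow Y else UNIV))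
        = (\<Prod>j\<in>R. if j \<in> R' then measure_pmf.prob ?U (Pow Y) else 1)"
      using assms(2) by (subst measure_Pi_pmf_Pi) (auto intro!: prod.cong)
    also have "\<dots> = (\<Prod>j\<in>R'. measure_pmf.prob ?U (Pow Y))"
      using assms(2,3) by (intro prod.mono_neutral_cong_right) auto
    also have "\<dots> = measure_pmf.prob ?U {S. S \<subseteq> Y} ^ card R'" by (simp add: Pow_def)
    also have "\<dots> \<le> ((w / P) ^ K) ^ card R'"
      using prob_within_le[OF assms(1), of Y] Y ksubsetsD by (intro power_mono) auto
    finally show "measure_pmf.prob ?p (Pi R (\<lambda>j. if j \<in> R' then Pow Y else UNIV)) \<le> (w / P) ^ (K * card R')"
      by (simp add: power_mult)
  qed
  finally show ?thesis by (simp add: card_ksubsets)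
qed

text \<open>The left side is one term in the binomial expansion of \<open>(1 + w / P) ^ P\<close>,
  whose value is at most \<open>exp w\<close>.\<close>

lemma choose_mult_power_le_exp:
  assumes "w \<le> P"
  shows "(P choose w) * (w / P) ^ w \<le> exp (real w)"
proof -
  let ?d = "real w / P"
  have "(P choose w) * ?d ^ w \<le> (\<Sum>j\<le>P. (P choose j) * ?d ^ j)"
    using assms by (intro member_le_sum) auto
  also have "\<dots> = (?d + 1) ^ P" by (simp add: binomial_ring)
  also have "\<dots> \<le> exp ?d ^ P" using exp_ge_add_one_self[of ?d] by (intro power_mono) (auto simp: add.commute)
  also have "\<dots> = exp (P * ?d)" by (simp only: exp_of_nat_mult)
  also have "P * ?d = w" using assms by (cases "P = 0") auto
  finally show ?thesis .
qed

text \<open>\<open>w\<close> is a threshold for the union of the outer sets after deletion of fewer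
  than \<open>k\<close> of them. Above it, \<open>w1\<close> makes a node of \<open>A\<close> bad
  with probability at most \<open>n ^ k / n ^ (k + 2) = 1 / n\<^sup>2\<close>. By \<open>w2\<close>
  and \<open>w3\<close>, not exceeding it has probability at most \<open>exp (- 3 * n)\<close> for
  each deleted family \<open>T\<close>, and there are at most \<open>2 ^ n\<close> such
  \<open>T\<close>.\<close>

lemma prob_poorly_connected_dense_le:
  fixes n k K P w :: nat
  assumes "10 \<le> K" "K \<le> P" "4 * k \<le> n" "2 \<le> n" "A \<subseteq> {1..n}" "2 * card A \<le> n"
    and w1: "(k + 2) * ln n * P \<le> real K * w" and w2: "16 * w \<le> K * n" and w3: "w \<le> exp (-2) * P"
  shows "measure_pmf.prob (Pi_pmf {1..n} {} (\<lambda>_. uniform_set P K)) {S. poorly_connected k n A S}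
    \<le> (1 / real n ^ 2) ^ card A + 2 ^ n * exp (- 3 * real n)"
proof -
  let ?R = "{1..n} - A" and ?a = "card A"
  let ?p = "Pi_pmf ?R {} (\<lambda>_. uniform_set P K)"
  let ?f = "\<lambda>y. measure_pmf.prob (uniform_set P K) {S. card {j \<in> ?R. S \<inter> y j \<noteq> {}} < k}"
  define bad where "bad T = {y :: nat \<Rightarrow> nat set. card (\<Union>j\<in>?R-T. y j) \<le> w}" for T
  let ?B = "\<Union>T\<in>{T. T \<subseteq> ?R \<and> card T < k}. bad T"
  have finA: "finite A" using assms(5) finite_subset by blast
  have R: "card ?R = n - ?a" using assms(5) finA by (simp add: card_Diff_subset)
  have P0: "P > 0" using assms(1,2) by simp
  have "exp (-2) \<le> (1::real)" by simp
  hence "exp (-2) * P \<le> 1 * real P" by (rule mult_right_mono) simp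
  hence wP: "w \<le> P" using w3 by linarith
  have bad: "measure_pmf.prob ?p (bad T) \<le> exp (- 3 * real n)" if T: "T \<subseteq> ?R" "card T < k" for T
  proof -
    have finT: "finite T" using T finite_subset by blast
    have "card (?R - T) = n - ?a - card T" using T finT R by (simp add: card_Diff_subset)
    \<comment> \<open>\<open>card A \<le> n / 2\<close> and \<open>card T < k \<le> n / 4\<close>
      leave at least \<open>n / 4\<close> sets, so
      \<open>?m \<ge> K * n / 4 \<ge> 4 * w\<close>.\<close>
    hence c4: "n \<le> 4 * card (?R - T)" using T assms(3,6) by linarith
    let ?m = "K * card (?R - T)"
    have m4: "K * n \<le> 4 * ?m" using c4 by (metis mult.left_commute mult_le_mono2)
    hence wm: "w \<le> ?m" using w2 by linarith
    have "measure_pmf.prob ?p (bad T) \<le> (P choose w) * (w / P) ^ ?m"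
      unfolding bad_def using assms wP by (intro prob_card_Union_le) auto
    also have "?m = w + (?m - w)" using wm by simp
    hence "(P choose w) * (w / P) ^ ?m = ((P choose w) * (w / P) ^ w) * (w / P) ^ (?m - w)"
      by (metis mult.assoc power_add)
    also have "\<dots> \<le> exp (real w) * exp (-2) ^ (?m - w)"
      using choose_mult_power_le_exp[OF wP] w3 P0
      by (intro mult_mono power_mono) (auto simp: field_simps)
    also have "\<dots> = exp (real w - 2 * real (?m - w))" by (simp add: exp_of_nat_mult[symmetric] exp_add[symmetric])
    also have "\<dots> \<le> exp (- 3 * real n)"
    proof -
      \<comment> \<open>Here \<open>2 * ?m - 3 * w \<ge> (1 / 2 - 3 / 16) * K * n = 5 / 16 * K *
        n\<close>, which exceeds \<open>3 * n\<close> because \<open>K \<ge> 10\<close>.\<close>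
      have "10 * n \<le> K * n" using assms(1) by simp
      hence "w + 3 * n \<le> 2 * (?m - w)" using m4 w2 by linarith
      hence "real (w + 3 * n) \<le> real (2 * (?m - w))" by (simp only: of_nat_le_iff)
      hence "real w - 2 * real (?m - w) \<le> - 3 * real n" by linarith
      thus ?thesis by (simp only: exp_le_cancel_iff)
    qed
    finally show ?thesis .
  qed
  have cardB: "card {T. T \<subseteq> ?R \<and> card T < k} \<le> 2 ^ n"
  proof -
    have "card {T. T \<subseteq> ?R \<and> card T < k} \<le> card (Pow {1..n})" by (intro card_mono) auto
    thus ?thesis by (simp add: card_Pow)
  qed
  have finB: "finite {T. T \<subseteq> ?R \<and> card T < k}" by (rule finite_subset[of _ "Pow ?R"]) auto
  have "measure_pmf.prob ?p ?B \<le> (\<Sum>T | T \<subseteq> ?R \<and> card T < k. measure_pmf.prob ?p (bad T))"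
    using finB by (rule measure_pmf.finite_measure_subadditive_finite) auto
  also have "\<dots> \<le> (\<Sum>T | T \<subseteq> ?R \<and> card T < k. exp (- 3 * real n))" using bad by (intro sum_mono) auto
  also have "\<dots> = real (card {T. T \<subseteq> ?R \<and> card T < k}) * exp (- 3 * real n)" by simp
  also have "\<dots> \<le> 2 ^ n * exp (- 3 * real n)"
    using cardB by (intro mult_right_mono) (simp_all add: numeral_power_le_of_nat_cancel_iff of_nat_le_numeral_power_cancel_iff)
  finally have pB: "measure_pmf.prob ?p ?B \<le> 2 ^ n * exp (- 3 * real n)" .
  have "measure_pmf.prob (Pi_pmf {1..n} {} (\<lambda>_. uniform_set P K)) {S. poorly_connected k n A S}
    = measure_pmf.expectation ?p (\<lambda>y. ?f y ^ ?a)"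
    using assms by (intro prob_poorly_connected)
  also have "\<dots> \<le> measure_pmf.expectation ?p (\<lambda>y. (1 / real n ^ 2) ^ ?a + indicator ?B y)"
  proof (intro integral_mono_AE integrable_measure_pmf_finite AE_pmfI)
    fix y assume y: "y \<in> set_pmf ?p"
    have yk: "y j \<in> ksubsets P K" if "j \<in> ?R" for j
      using set_Pi_uniform_set[OF assms(2) _ y that] by simp
    show "?f y ^ ?a \<le> (1 / real n ^ 2) ^ ?a + indicator ?B y"
    proof (cases "y \<in> ?B")
      case True
      have "?f y ^ ?a \<le> 1" by (intro power_le_one) auto
      thus ?thesis using True by (simp add: add_increasing)
    next
      case False
      have "?f y \<le> real n ^ k * exp (- (real K * real w / P))"
        using yk assms(2,4) False R by (intro prob_few_neighbors_le_crude) (auto simp: bad_def not_le)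
      also have "\<dots> \<le> real n ^ k * exp (- ((k + 2) * ln n))"
        using w1 P0 by (intro mult_left_mono) (auto simp: field_simps)
      also have "exp (- ((k + 2) * ln n)) = 1 / real n ^ (k + 2)"
        using assms(4) by (simp only: exp_minus exp_of_nat_mult) (simp add: inverse_eq_divide)
      also have "real n ^ k * (1 / real n ^ (k + 2)) = 1 / real n ^ 2"
        using assms(4) by (simp add: power_add field_simps power2_eq_square)
      finally have "?f y ^ ?a \<le> (1 / real n ^ 2) ^ ?a" by (intro power_mono) auto
      thus ?thesis using False by simp
    qed
  qed (use assms in auto)
  also have "\<dots> = (1 / real n ^ 2) ^ ?a + measure_pmf.prob ?p ?B"
    using assms by (subst Bochner_Integration.integral_add) (auto intro!: integrable_measure_pmf_finite)
  finally show ?thesis using pB by simp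
qed

text \<open>Summing \<open>(1 / n\<^sup>2) ^ card A\<close> over nonempty \<open>A\<close> gives
  \<open>(1 + 1 / n\<^sup>2) ^ n - 1\<close>, of order \<open>1 / n\<close>. In the other term the
  number of sets \<open>A\<close> contributes a second factor \<open>2 ^ n\<close>, and the rate
  \<open>3\<close> leaves a base \<open>4 * exp (-3)\<close> below 1.\<close>

lemma prob_not_k_robust_dense_le:
  fixes n k K P w :: nat
  assumes "10 \<le> K" "K \<le> P" "4 * k \<le> n" "2 \<le> n"
    and "(k + 2) * ln n * P \<le> real K * w" and "16 * w \<le> K * n" and "w \<le> exp (-2) * P"
  shows "1 - measure_pmf.prob (intersection_graph_pmf n P (return_pmf K)) {E. k_robust k {1..n} E}
    \<le> (1 + 1 / real n ^ 2) ^ n - 1 + (4 * exp (-3)) ^ n"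
proof -
  let ?I = "{A. A \<subseteq> {1..n} \<and> A \<noteq> {} \<and> 2 * card A \<le> n}"
  have sub: "?I \<subseteq> Pow {1..n} - {{}}" by auto
  have fin: "finite ?I" by (rule finite_subset[OF sub]) auto
  have "1 - measure_pmf.prob (intersection_graph_pmf n P (return_pmf K)) {E. k_robust k {1..n} E}
      \<le> (\<Sum>A\<in>?I. measure_pmf.prob (Pi_pmf {1..n} {} (\<lambda>_. uniform_set P K)) {S. poorly_connected k n A S})"
    by (rule prob_not_k_robust_le)
  also have "\<dots> \<le> (\<Sum>A\<in>?I. (1 / real n ^ 2) ^ card A + 2 ^ n * exp (- 3 * real n))"
    using assms by (intro sum_mono prob_poorly_connected_dense_le) auto
  also have "\<dots> \<le> (\<Sum>A\<in>Pow {1..n} - {{}}. (1 / real n ^ 2) ^ card A + 2 ^ n * exp (- 3 * real n))"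
    using sub by (intro sum_mono2) auto
  also have "\<dots> = (\<Sum>A\<in>Pow {1..n} - {{}}. (1 / real n ^ 2) ^ card A)
      + real (card (Pow {1..n} - {{}})) * (2 ^ n * exp (- 3 * real n))"
    by (simp add: sum.distrib)
  also have "(\<Sum>A\<in>Pow {1..n} - {{}}. (1 / real n ^ 2) ^ card A) = (1 + 1 / real n ^ 2) ^ n - 1"
    using sum_power_card_Pow[of "{1..n}" "1 / real n ^ 2"] by (simp add: sum_diff1)
  also have "real (card (Pow {1..n} - {{}})) * (2 ^ n * exp (- 3 * real n)) \<le> 2 ^ n * (2 ^ n * exp (- 3 * real n))"
    by (intro mult_right_mono) (auto simp: card_Diff_subset card_Pow)
  also have "2 ^ n * (2 ^ n * exp (- 3 * real n)) = (4 * exp (-3)) ^ n"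
    by (simp add: power_mult_distrib[symmetric] exp_of_nat_mult[symmetric] mult.assoc[symmetric] mult.commute)
  finally show ?thesis by simp
qed

text \<open>
  Sets \<open>A\<close> with fewer than \<open>n z\<close> elements are counted exactly; for larger ones the weight
  \<open>s ^ card A\<close> is compared with \<open>z ^ card A\<close>, whose sum is at most \<open>exp (n z)\<close>.
\<close>

lemma prob_not_k_robust_sparse_le:
  fixes n k K P :: nat and x z :: real
  defines "x \<equiv> real n * real K ^ 2 / P"
  assumes "K \<le> P" "k \<le> K" "1 \<le> n" "1 \<le> k"
    and x: "1 \<le> x" and h1: "real k * (real n * K / P) \<le> 1" and h2: "real k * (real K ^ 2 / P) \<le> 1"
    and h3: "2 * x * (real n * K / P) \<le> 1" and z: "0 < z" "x * z \<le> 1"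
    and s: "k * exp 3 * x ^ (k - 1) * exp (- (x / 2)) \<le> exp (-2) * z"
  shows "1 - measure_pmf.prob (intersection_graph_pmf n P (return_pmf K)) {E. k_robust k {1..n} E}
    \<le> exp (k * exp 4 * (n * x ^ (k - 1) * exp (- x))) - 1 + exp (- (n * z))"
proof -
  let ?I = "{A. A \<subseteq> {1..n} \<and> A \<noteq> {} \<and> 2 * card A \<le> n}"
  let ?s1 = "k * exp 4 * x ^ (k - 1) * exp (- x)"
  have sub: "?I \<subseteq> Pow {1..n} - {{}}" by auto
  have fin: "finite ?I" by (rule finite_subset[OF sub]) auto
  have bound: "measure_pmf.prob (Pi_pmf {1..n} {} (\<lambda>_. uniform_set P K)) {S. poorly_connected k n A S}
      \<le> ?s1 ^ card A + z ^ card A * exp (- 2 * (n * z))" if A: "A \<in> ?I" for A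
  proof -
    let ?a = "card A"
    let ?g = "k * exp 3 * x ^ (k - 1) * exp (- (x * (1 - ?a / n)))"
    have "measure_pmf.prob (Pi_pmf {1..n} {} (\<lambda>_. uniform_set P K)) {S. poorly_connected k n A S} \<le> ?g ^ ?a"
      using A assms unfolding x_def by (intro prob_poorly_connected_sparse_le) auto
    also have "?g ^ ?a \<le> ?s1 ^ ?a + z ^ ?a * exp (- 2 * (n * z))"
    proof (cases "?a \<le> n * z")
      case True
      \<comment> \<open>For \<open>card A \<le> n * z\<close> the exponent falls short of
        \<open>x\<close> by at most \<open>x * z \<le> 1\<close>, which turns \<open>exp 3\<close>
        into \<open>exp 4\<close>.\<close>
      have "x * (?a / n) \<le> x * z" using True x assms(4) by (intro mult_left_mono) (auto simp: field_simps)
      hence "- (x * (1 - ?a / n)) \<le> 1 + (- x)" using z(2) by (simp add: algebra_simps)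
      hence "exp (- (x * (1 - ?a / n))) \<le> exp 1 * exp (- x)" unfolding exp_add[symmetric] by simp
      hence "?g \<le> k * exp 3 * x ^ (k - 1) * (exp 1 * exp (- x))" using x by (intro mult_left_mono) auto
      also have "\<dots> = k * (exp 3 * exp 1) * x ^ (k - 1) * exp (- x)" by simp
      also have "exp 3 * exp 1 = exp (4::real)" by (simp add: exp_add[symmetric])
      finally have "?g ^ ?a \<le> ?s1 ^ ?a" using x by (intro power_mono) auto
      thus ?thesis using z by (simp add: add_increasing2)
    next
      case False
      \<comment> \<open>Only half of the exponent is certain when \<open>card A\<close> may reach
        \<open>n / 2\<close>. Hypothesis \<open>s\<close> then yields \<open>exp (-2) * z\<close>
        per node, and \<open>exp (- 2 * card A) \<le> exp (- 2 * (n * z))\<close> outweighs the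
        total \<open>(1 + z) ^ n \<le> exp (n * z)\<close> over all \<open>A\<close>.\<close>
      have "?a / n \<le> 1 / 2" using A assms(4) by (auto simp: field_simps)
      hence "x * (?a / n) \<le> x * (1 / 2)" using x by (intro mult_left_mono) auto
      hence "- (x * (1 - ?a / n)) \<le> - (x / 2)" by (simp add: algebra_simps)
      hence "?g \<le> k * exp 3 * x ^ (k - 1) * exp (- (x / 2))" using x by (intro mult_left_mono) auto
      also have "\<dots> \<le> exp (-2) * z" by (rule s)
      finally have "?g ^ ?a \<le> (exp (-2) * z) ^ ?a" using x by (intro power_mono) auto
      also have "\<dots> = z ^ ?a * exp (- 2 * real ?a)" by (simp add: power_mult_distrib exp_of_nat_mult[symmetric] mult.commute)
      also have "\<dots> \<le> z ^ ?a * exp (- 2 * (n * z))" using False z by (intro mult_left_mono) auto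
      finally show ?thesis using x by (simp add: add_increasing)
    qed
    finally show ?thesis .
  qed
  have "1 - measure_pmf.prob (intersection_graph_pmf n P (return_pmf K)) {E. k_robust k {1..n} E}
      \<le> (\<Sum>A\<in>?I. measure_pmf.prob (Pi_pmf {1..n} {} (\<lambda>_. uniform_set P K)) {S. poorly_connected k n A S})"
    by (rule prob_not_k_robust_le)
  also have "\<dots> \<le> (\<Sum>A\<in>?I. ?s1 ^ card A + z ^ card A * exp (- 2 * (n * z)))"
    by (rule sum_mono[OF bound])
  also have "\<dots> \<le> (\<Sum>A\<in>Pow {1..n} - {{}}. ?s1 ^ card A + z ^ card A * exp (- 2 * (n * z)))"
    using sub x z by (intro sum_mono2) auto
  also have "\<dots> = ((1 + ?s1) ^ n - 1) + ((1 + z) ^ n - 1) * exp (- 2 * (n * z))"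
    using sum_power_card_Pow[of "{1..n}" ?s1] sum_power_card_Pow[of "{1..n}" z]
    by (simp add: sum.distrib sum_distrib_right[symmetric] sum_diff1)
  also have "\<dots> \<le> (exp (k * exp 4 * (n * x ^ (k - 1) * exp (- x))) - 1) + exp (- (n * z))"
  proof (rule add_mono)
    have "(1 + ?s1) ^ n \<le> exp ?s1 ^ n" using x exp_ge_add_one_self[of ?s1] by (intro power_mono) auto
    also have "\<dots> = exp (k * exp 4 * (n * x ^ (k - 1) * exp (- x)))" by (simp add: exp_of_nat_mult[symmetric] mult_ac)
    finally show "(1 + ?s1) ^ n - 1 \<le> exp (k * exp 4 * (n * x ^ (k - 1) * exp (- x))) - 1" by simp
    have "(1 + z) ^ n \<le> exp z ^ n" using z exp_ge_add_one_self[of z] by (intro power_mono) auto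
    hence "(1 + z) ^ n \<le> exp (n * z)" by (simp add: exp_of_nat_mult)
    hence "((1 + z) ^ n - 1) * exp (- 2 * (n * z)) \<le> exp (n * z) * exp (- 2 * (n * z))"
      by (intro mult_right_mono) auto
    also have "exp (n * z) * exp (- 2 * (n * z)) = exp (n * z + - 2 * (n * z))" by (simp only: exp_add)
    also have "n * z + - 2 * (n * z) = - (n * z)" by simp
    finally show "((1 + z) ^ n - 1) * exp (- 2 * (n * z)) \<le> exp (- (n * z))" .
  qed
  finally show ?thesis .
qed

section \<open>The one-law for a constant size\<close>

text \<open>The sequence may alternate between \<open>x n \<ge> C * ln n\<close> and
  \<open>x n < C * ln n\<close>. Each \<open>n\<close> is treated by the dense or the sparse
  estimate, and the sum of both error terms serves for every \<open>n\<close>, so no passage to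
  subsequences occurs.\<close>

lemma uniform_k_robust_limit_1:
  fixes k :: nat and K P :: "nat \<Rightarrow> nat" and c :: real
  defines "x \<equiv> \<lambda>n. real n * real (K n) ^ 2 / P n"
  assumes k: "1 \<le> k" and c: "0 < c"
    and KP: "\<forall>\<^sub>F n in sequentially. K n \<le> P n"
    and Kbig: "\<forall>\<^sub>F n in sequentially. c * ln (real n) ^ 3 \<le> K n"
    and lim: "filterlim (\<lambda>n. x n - ln (real n) - (real k - 1) * ln (ln (real n))) at_top sequentially"
  shows "(\<lambda>n. measure_pmf.prob (intersection_graph_pmf n (P n) (return_pmf (K n)))
                {E. k_robust k {1..n} E}) \<longlonglongrightarrow> 1"
proof -
  \<comment> \<open>The \<open>32\<close> makes room for \<open>16 * w \<le> K * n\<close>: one half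
    of \<open>K * n\<close> pays for \<open>w\<close> before rounding up, the other half for the
    rounding.\<close>
  define C where "C = 32 * (real k + 2)"
  define a where "a n = x n - ln (real n) - (real k - 1) * ln (ln (real n))" for n
  have C: "0 < C" unfolding C_def by simp
  let ?prob = "\<lambda>n. measure_pmf.prob (intersection_graph_pmf n (P n) (return_pmf (K n))) {E. k_robust k {1..n} E}"
  let ?b1 = "\<lambda>n. exp (1 / real n) - 1 + (4 * exp (-3)) ^ n"
  let ?b2 = "\<lambda>n. exp (k * exp 4 * (C ^ (k - 1) * exp (- a n))) - 1 + exp (- (n * (1 / (C * ln (real n)))))"
  have alim: "filterlim a at_top sequentially" using lim unfolding a_def .
  have "(1::real) + 3 + 3\<^sup>2 / 2 \<le> exp 3" by (rule exp_lower_Taylor_quadratic) simp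
  hence "4 * exp (-3) < (1::real)" by (simp add: exp_minus field_simps)
  hence "(\<lambda>n. (4 * exp (-3) :: real) ^ n) \<longlonglongrightarrow> 0" by (intro LIMSEQ_realpow_zero) auto
  moreover have "(\<lambda>n. exp (1 / real n) - 1) \<longlonglongrightarrow> 0" by real_asymp
  ultimately have b1: "?b1 \<longlonglongrightarrow> 0" using tendsto_add by fastforce
  have "((\<lambda>t. exp (k * exp 4 * (C ^ (k - 1) * exp (- t))) - 1) \<longlongrightarrow> 0) at_top"
    using C k by real_asymp
  hence "(\<lambda>n. exp (k * exp 4 * (C ^ (k - 1) * exp (- a n))) - 1) \<longlonglongrightarrow> 0"
    using alim by (rule filterlim_compose)
  moreover have "(\<lambda>n. exp (- (n * (1 / (C * ln (real n)))))) \<longlonglongrightarrow> 0"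
    using C by real_asymp
  ultimately have b2: "?b2 \<longlonglongrightarrow> 0" using tendsto_add by fastforce
  have ev: "\<forall>\<^sub>F n in sequentially. 1 - (?b1 n + ?b2 n) \<le> ?prob n"
  proof -
    have e0: "\<forall>\<^sub>F n in sequentially. 0 \<le> a n" using alim by (simp add: filterlim_at_top)
    have e1: "\<forall>\<^sub>F n in sequentially. 1 \<le> ln (ln (real n))" by real_asymp
    have e2: "\<forall>\<^sub>F n in sequentially. 10 + real k \<le> c * ln (real n) ^ 3" using c by real_asymp
    have e3: "\<forall>\<^sub>F n in sequentially. 4 * real k + 4 \<le> real n" by real_asymp
    have e4: "\<forall>\<^sub>F n in sequentially. (real k + 2) * ln (real n) / (c * ln (real n) ^ 3) + 1 / (c * ln (real n) ^ 3) \<le> exp (-2)"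
      using c by real_asymp
    have e5: "\<forall>\<^sub>F n in sequentially. 32 \<le> (c * ln (real n) ^ 3) * real n" using c by real_asymp
    have e6: "\<forall>\<^sub>F n in sequentially. real k * (C * ln (real n) / (c * ln (real n) ^ 3)) \<le> 1" using c C by real_asymp
    have e7: "\<forall>\<^sub>F n in sequentially. real k * (C * ln (real n) / real n) \<le> 1" using C by real_asymp
    have e8: "\<forall>\<^sub>F n in sequentially. 2 * (C * ln (real n)) * (C * ln (real n) / (c * ln (real n) ^ 3)) \<le> 1"
      using c C by real_asymp
    have e9: "\<forall>\<^sub>F n in sequentially. k * exp 3 * (C * ln (real n)) ^ (k - 1) * exp (- (ln (real n) / 2)) \<le> exp (-2) * (1 / (C * ln (real n)))"
      using c C k by real_asymp
    show ?thesis
      using e0 e1 e2 e3 e4 e5 e6 e7 e8 e9 KP Kbig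
    proof eventually_elim
      case (elim n)
      let ?K = "K n" and ?P = "P n" and ?L = "ln (real n)"
      have n: "2 \<le> n" "4 * k \<le> n" "1 \<le> n" using elim(4) by linarith+
      have "real 10 \<le> real ?K" "real k \<le> real ?K" using elim(3,12) by linarith+
      hence K: "10 \<le> ?K" "k \<le> ?K" by (simp_all only: of_nat_le_iff)
      have pos: "0 < real ?K" "0 < real ?P" "0 < real n" using K elim(11) n by auto
      have L0: "1 \<le> ?L"
      proof (rule ccontr)
        assume "\<not> 1 \<le> ?L"
        hence "?L < 1" by simp
        moreover have "0 \<le> ?L" using n by simp
        ultimately have "ln ?L \<le> 0" by (cases "?L = 0") auto
        thus False using elim(2) by simp
      qed
      have xdef: "x n = real n * real ?K ^ 2 / ?P" by (simp add: x_def)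
      have "x n = ?L + (real k - 1) * ln ?L + a n" unfolding a_def by simp
      moreover have "0 \<le> (real k - 1) * ln ?L" using elim(2) k by simp
      ultimately have xL: "?L \<le> x n" using elim(1) by linarith
      have b1': "0 \<le> ?b1 n" by (simp add: add_nonneg_nonneg)
      have b2': "0 \<le> ?b2 n" using C by (simp add: add_nonneg_nonneg)
      have cL: "0 < c * ?L ^ 3" using c L0 by simp
      show ?case
      proof (cases "C * ?L \<le> x n")
        case True
        \<comment> \<open>The smallest threshold at which \<open>exp (- K * w / P)\<close> brings
          the factor \<open>n ^ k\<close> down to \<open>1 / n\<^sup>2\<close>.\<close>
        define w where "w = nat \<lceil>(real k + 2) * ?L * ?P / ?K\<rceil>"
        have arg0: "0 \<le> (real k + 2) * ?L * ?P / ?K" using L0 by simp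
        have w_ge: "(real k + 2) * ?L * ?P / ?K \<le> w" unfolding w_def by (rule real_nat_ceiling_ge)
        have w_le: "w \<le> (real k + 2) * ?L * ?P / ?K + 1"
          unfolding w_def using arg0 by linarith
        have "1 - ?prob n \<le> (1 + 1 / real n ^ 2) ^ n - 1 + (4 * exp (-3)) ^ n"
        proof (rule prob_not_k_robust_dense_le)
          show "real (k + 2) * ?L * ?P \<le> real ?K * w" using w_ge pos by (simp add: field_simps)
          have "C * ?L * ?P \<le> real n * real ?K ^ 2" using True pos unfolding xdef by (simp add: field_simps)
          hence "32 * ((real k + 2) * ?L * ?P) \<le> (real n * ?K) * ?K" by (simp add: C_def power2_eq_square mult_ac)
          hence "32 * ((real k + 2) * ?L * ?P / ?K) \<le> real n * ?K" using pos by (simp add: field_simps)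
          moreover have "32 \<le> real n * ?K"
            using elim(6) mult_right_mono[OF elim(12), of "real n"] by (simp add: mult.commute)
          ultimately have "16 * real w \<le> real n * ?K" using w_le by linarith
          hence "real (16 * w) \<le> real (?K * n)" by (simp add: mult.commute)
          thus "16 * w \<le> ?K * n" by (simp only: of_nat_le_iff)
          have "real w / ?P \<le> (real k + 2) * ?L / ?K + 1 / ?P"
            using divide_right_mono[OF w_le, of "real ?P"] pos by (simp add: add_divide_distrib)
          also have "\<dots> \<le> (real k + 2) * ?L / (c * ?L ^ 3) + 1 / (c * ?L ^ 3)"
          proof (rule add_mono)
            show "(real k + 2) * ?L / ?K \<le> (real k + 2) * ?L / (c * ?L ^ 3)"
              using elim(12) cL L0 by (intro divide_left_mono) auto
            have "c * ?L ^ 3 \<le> real ?P" using elim(11,12) by linarith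
            thus "1 / real ?P \<le> 1 / (c * ?L ^ 3)" using cL by (intro divide_left_mono) auto
          qed
          also have "\<dots> \<le> exp (-2)" by (rule elim(5))
          finally show "real w \<le> exp (-2) * ?P" using pos by (simp add: field_simps)
        qed (use K n elim(11) in auto)
        also have "(1 + 1 / real n ^ 2) ^ n \<le> exp (1 / real n ^ 2) ^ n"
          using exp_ge_add_one_self[of "1 / real n ^ 2"] by (intro power_mono) auto
        also have "exp (1 / real n ^ 2) ^ n = exp (n * (1 / real n ^ 2))" by (simp only: exp_of_nat_mult)
        also have "n * (1 / real n ^ 2) = 1 / real n" using pos by (simp add: power2_eq_square)
        finally show ?thesis using b2' by linarith
      next
        case False
        hence xC: "x n \<le> C * ?L" by simp
        have nKP: "real n * ?K / ?P = x n / ?K" using pos by (simp add: xdef power2_eq_square)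
        also have "\<dots> \<le> C * ?L / (c * ?L ^ 3)"
          using xC elim(12) cL L0 xL by (intro frac_le) auto
        finally have r: "real n * ?K / ?P \<le> C * ?L / (c * ?L ^ 3)" .
        have r0: "0 \<le> real n * ?K / ?P" by simp
        \<comment> \<open>\<open>z = 1 / (C * ln n)\<close> is the largest choice for which
          \<open>x n \<le> C * ln n\<close> guarantees \<open>x n * z \<le> 1\<close>;
          \<open>n * z\<close> still tends to infinity.\<close>
        have "1 - ?prob n \<le> exp (k * exp 4 * (n * x n ^ (k - 1) * exp (- x n))) - 1 + exp (- (n * (1 / (C * ?L))))"
          unfolding xdef
        proof (rule prob_not_k_robust_sparse_le, unfold xdef[symmetric])
          show "real k * (real n * ?K / ?P) \<le> 1"
            using elim(7) mult_left_mono[OF r, of "real k"] by simp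
          have "real ?K ^ 2 / ?P = x n / n" using pos by (simp add: xdef)
          also have "\<dots> \<le> C * ?L / n" using xC by (intro divide_right_mono) auto
          finally show "real k * (real ?K ^ 2 / ?P) \<le> 1"
            using elim(8) mult_left_mono[of "real ?K ^ 2 / ?P" "C * ?L / n" "real k"] by simp
          have "2 * x n * (real n * ?K / ?P) \<le> 2 * (C * ?L) * (C * ?L / (c * ?L ^ 3))"
            using xC xL r r0 C L0 by (intro mult_mono) auto
          thus "2 * x n * (real n * ?K / ?P) \<le> 1" using elim(9) by linarith
          show "x n * (1 / (C * ?L)) \<le> 1" using xC C L0 by (simp add: field_simps)
          show "0 < 1 / (C * ?L)" using C L0 by simp
          show "1 \<le> x n" using xL L0 by simp
          have "k * exp 3 * x n ^ (k - 1) * exp (- (x n / 2)) \<le> k * exp 3 * (C * ?L) ^ (k - 1) * exp (- (?L / 2))"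
            using xC xL L0 C by (intro mult_mono mult_left_mono power_mono) auto
          thus "k * exp 3 * x n ^ (k - 1) * exp (- (x n / 2)) \<le> exp (-2) * (1 / (C * ?L))"
            using elim(10) by linarith
        qed (use K n k elim(11) in auto)
        also have "exp (k * exp 4 * (n * x n ^ (k - 1) * exp (- x n))) \<le> exp (k * exp 4 * (C ^ (k - 1) * exp (- a n)))"
        proof -
          \<comment> \<open>The \<open>ln (ln n)\<close> term in \<open>x n\<close> puts
            \<open>ln n ^ (k - 1)\<close> into the denominator, where it cancels the growth of
            \<open>x n ^ (k - 1)\<close>; up to a constant, \<open>exp (- a n)\<close>
            remains.\<close>
          have "exp (- x n) = exp (- ?L) * exp (- ((real k - 1) * ln ?L)) * exp (- a n)"
            unfolding a_def by (simp add: exp_add[symmetric])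
          also have "exp (- ?L) = 1 / n" using pos by (simp add: exp_minus inverse_eq_divide)
          also have "(real k - 1) * ln ?L = real (k - 1) * ln ?L" using k by (simp add: of_nat_diff)
          also have "exp (- (real (k - 1) * ln ?L)) = 1 / ?L ^ (k - 1)"
            using L0 by (simp only: exp_minus exp_of_nat_mult) (simp add: inverse_eq_divide)
          finally have ex: "n * exp (- x n) = 1 / ?L ^ (k - 1) * exp (- a n)" using pos by simp
          have "n * x n ^ (k - 1) * exp (- x n) \<le> n * (C * ?L) ^ (k - 1) * exp (- x n)"
            using xC xL L0 by (intro mult_right_mono mult_left_mono power_mono) auto
          also have "\<dots> = (C * ?L) ^ (k - 1) * (n * exp (- x n))" by simp
          also have "\<dots> = C ^ (k - 1) * exp (- a n)"
            unfolding ex using L0 by (simp add: power_mult_distrib)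
          finally show ?thesis by (simp add: mult_left_mono)
        qed
        finally show ?thesis using b1' by linarith
      qed
    qed
  qed
  have "(\<lambda>n. 1 - (?b1 n + ?b2 n)) \<longlonglongrightarrow> 1 - (0 + 0)" by (intro tendsto_intros b1 b2)
  hence lower: "(\<lambda>n. 1 - (?b1 n + ?b2 n)) \<longlonglongrightarrow> 1" by simp
  show ?thesis
    by (rule tendsto_sandwich[OF ev _ lower tendsto_const]) auto
qed

section \<open>Low-degree nodes\<close>

text \<open>From the complement of \<open>{v}\<close> only \<open>v\<close> itself can be reached,
  so that set can pass the robustness test only for \<open>k = 1\<close>. In that case
  \<open>v\<close> is isolated, and no node is adjacent to it. \<open>2 \<le> n\<close> keeps the
  complement nonempty.\<close>

lemma low_degree_not_k_robust:
  assumes "2 \<le> n" "1 \<le> k" "v \<in> {1..n}" "poorly_connected k n {v} S"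
  shows "\<not> k_robust k {1..n} (intersection_edges n S)"
proof
  let ?E = "intersection_edges n S" and ?B = "{1..n} - {v}"
  assume rob: "k_robust k {1..n} ?E"
  have deg: "card {j \<in> ?B. S v \<inter> S j \<noteq> {}} < k" using assms(4) by (simp add: poorly_connected_def)
  have "card ?B = n - 1" using assms(3) by simp
  hence "?B \<noteq> {}" using assms(1) by (metis Suc_1 card.empty diff_is_0_eq not_less_eq_eq)
  hence AB: "{v} \<subseteq> {1..n} \<and> ?B \<subseteq> {1..n} \<and> {v} \<noteq> {} \<and> ?B \<noteq> {} \<and> {v} \<inter> ?B = {}"
    using assms(3) by simp
  have "neighbors_in ?E v ?B = {j \<in> ?B. S v \<inter> S j \<noteq> {}}"
    using assms(3) by (intro neighbors_in_intersection_edges) auto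
  hence "\<not> (\<exists>w\<in>{v}. k \<le> card (neighbors_in ?E w ({1..n} - {v})))" using deg by simp
  hence "\<exists>w\<in>?B. k \<le> card (neighbors_in ?E w ({1..n} - ?B))"
    using rob[unfolded k_robust_def, rule_format, OF AB] by blast
  then obtain w where w: "w \<in> ?B" "k \<le> card (neighbors_in ?E w ({1..n} - ?B))" by blast
  have V: "{1..n} - ?B = {v}" using assms(3) by auto
  have nb: "neighbors_in ?E w {v} = {j \<in> {v}. S w \<inter> S j \<noteq> {}}"
    using w(1) assms(3) by (intro neighbors_in_intersection_edges) auto
  have "card (neighbors_in ?E w {v}) \<le> card {v}" unfolding nb by (intro card_mono) auto
  hence "k = 1" using w(2) assms(2) unfolding V by simp
  hence "{j \<in> ?B. S v \<inter> S j \<noteq> {}} = {}" using deg by simp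
  hence "S w \<inter> S v = {}" using w(1) by auto
  hence "neighbors_in ?E w {v} = {}" unfolding nb by auto
  thus False using w(2) assms(2) unfolding V by simp
qed

section \<open>Second moment inequality\<close>

text \<open>With \<open>N\<close> the number of events that occur, \<open>N = 0\<close> forces
  \<open>(\<mu> - N)\<^sup>2 = \<mu>\<^sup>2\<close>, so Chebyshev's argument applies. The right
  side is the variance of \<open>N\<close> over \<open>\<mu>\<^sup>2\<close>, with the second moment
  written as a sum of pair probabilities.\<close>

lemma second_moment_none_le:
  fixes X :: "'i \<Rightarrow> 'a set"
  assumes "finite V" "finite (set_pmf M)"
  defines "\<mu> \<equiv> (\<Sum>v\<in>V. measure_pmf.prob M (X v))"
  assumes "0 < \<mu>"
  shows "measure_pmf.prob M {S. \<forall>v\<in>V. S \<notin> X v}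
    \<le> (\<Sum>u\<in>V. \<Sum>v\<in>V. measure_pmf.prob M (X u \<inter> X v)) / \<mu>\<^sup>2 - 1"
proof -
  note int [simp] = integrable_measure_pmf_finite[OF assms(2)]
  define N where "N S = (\<Sum>v\<in>V. indicator (X v) S :: real)" for S
  have EN: "measure_pmf.expectation M N = \<mu>" unfolding N_def \<mu>_def by simp
  have "measure_pmf.expectation M (\<lambda>S. (N S)\<^sup>2)
      = measure_pmf.expectation M (\<lambda>S. \<Sum>u\<in>V. \<Sum>v\<in>V. indicator (X u \<inter> X v) S)"
    unfolding N_def by (simp add: power2_eq_square sum_product indicator_inter_arith)
  also have "\<dots> = (\<Sum>u\<in>V. \<Sum>v\<in>V. measure_pmf.prob M (X u \<inter> X v))" by simp
  finally have EN2: "measure_pmf.expectation M (\<lambda>S. (N S)\<^sup>2) = (\<Sum>u\<in>V. \<Sum>v\<in>V. measure_pmf.prob M (X u \<inter> X v))" .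
  let ?Z = "{S. \<forall>v\<in>V. S \<notin> X v}"
  have "\<mu>\<^sup>2 * measure_pmf.prob M ?Z = measure_pmf.expectation M (\<lambda>S. \<mu>\<^sup>2 * indicator ?Z S)" by simp
  also have "\<dots> \<le> measure_pmf.expectation M (\<lambda>S. (\<mu> - N S)\<^sup>2)"
  proof (intro integral_mono int)
    fix S
    have "N S = 0" if "S \<in> ?Z" unfolding N_def using that by (intro sum.neutral) auto
    thus "\<mu>\<^sup>2 * indicator ?Z S \<le> (\<mu> - N S)\<^sup>2" by (cases "S \<in> ?Z") auto
  qed
  also have "\<dots> = measure_pmf.expectation M (\<lambda>S. \<mu>\<^sup>2 - 2 * \<mu> * N S + (N S)\<^sup>2)"
    by (simp add: power2_diff mult_ac add_ac diff_add_eq)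
  also have "\<dots> = \<mu>\<^sup>2 - 2 * \<mu> * \<mu> + measure_pmf.expectation M (\<lambda>S. (N S)\<^sup>2)"
    by (simp add: EN)
  finally have "\<mu>\<^sup>2 * measure_pmf.prob M ?Z \<le> (\<Sum>u\<in>V. \<Sum>v\<in>V. measure_pmf.prob M (X u \<inter> X v)) - \<mu>\<^sup>2"
    unfolding EN2 by (simp add: power2_eq_square)
  thus ?thesis using assms(4) by (simp add: field_simps)
qed

text \<open>The object set of a distinguished node is revealed before all others. Two applications
  reveal the sets of a pair of nodes.\<close>

lemma prob_Pi_pmf_insert:
  assumes "finite R" "v \<notin> R" "finite (set_pmf p)"
    and loc: "\<And>Y S S'. (\<And>j. j \<in> R \<Longrightarrow> S j = S' j) \<Longrightarrow> Q Y S = Q Y S'"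
  shows "measure_pmf.prob (Pi_pmf (insert v R) d (\<lambda>_. p)) {S. Q (S v) S}
    = measure_pmf.expectation p (\<lambda>Y. measure_pmf.prob (Pi_pmf R d (\<lambda>_. p)) {y. Q Y y})"
proof -
  have "measure_pmf.prob (Pi_pmf (insert v R) d (\<lambda>_. p)) {S. Q (S v) S}
      = measure_pmf.prob (pair_pmf p (Pi_pmf R d (\<lambda>_. p))) {Yf. Q (fst Yf) ((snd Yf)(v := fst Yf))}"
    using assms(1,2) by (simp add: Pi_pmf_insert vimage_def case_prod_beta)
  also have "{Yf. Q (fst Yf) ((snd Yf)(v := fst Yf))} = {Yf. Q (fst Yf) (snd Yf)}"
    using assms(2) by (intro Collect_cong loc) auto
  also have "measure_pmf.prob (pair_pmf p (Pi_pmf R d (\<lambda>_. p))) \<dots>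
      = measure_pmf.expectation p (\<lambda>Y. measure_pmf.prob (Pi_pmf R d (\<lambda>_. p)) {y. Q Y y})"
    using assms(1,3) by (subst prob_pair_pmf_finite) (auto intro!: finite_set_Pi_pmf)
  finally show ?thesis .
qed

section \<open>The degree of a single node\<close>

lemma sum_power_card_bounded:
  assumes "finite R"
  shows "(\<Sum>T | T \<subseteq> R \<and> card T < k. c ^ card T) = (\<Sum>t<k. (card R choose t) * (c :: real) ^ t)"
proof -
  let ?I = "{T. T \<subseteq> R \<and> card T < k}"
  have fin: "finite ?I" by (rule finite_subset[of _ "Pow R"]) (use assms in auto)
  have "(\<Sum>T\<in>?I. c ^ card T) = (\<Sum>t<k. \<Sum>T\<in>{T\<in>?I. card T = t}. c ^ card T)"
    by (rule sum.group[OF fin, of "{..<k}" card, symmetric]) auto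
  also have "\<dots> = (\<Sum>t<k. \<Sum>T | T \<subseteq> R \<and> card T = t. c ^ t)"
  proof (rule sum.cong[OF refl])
    fix t assume "t \<in> {..<k}"
    hence "{T\<in>?I. card T = t} = {T. T \<subseteq> R \<and> card T = t}" by auto
    thus "(\<Sum>T\<in>{T\<in>?I. card T = t}. c ^ card T) = (\<Sum>T | T \<subseteq> R \<and> card T = t. c ^ t)" by simp
  qed
  finally show ?thesis by (simp add: n_subsets[OF assms])
qed

lemma prod_if_mem_eq_power:
  assumes "finite R" "X \<subseteq> R"
  shows "(\<Prod>j\<in>R. if j \<in> X then c else (1::real)) = c ^ card X"
proof -
  have "(\<Prod>j\<in>R. if j \<in> X then c else 1) = (\<Prod>j\<in>X. c)"
    using assms by (intro prod.mono_neutral_cong_right) auto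
  thus ?thesis by simp
qed

text \<open>The probability that two nodes with object sets of size \<open>K\<close> are not
  adjacent; by symmetry it is the same when one of the two sets is fixed. Its complement is the edge
  probability.\<close>

definition avoid_prob :: "nat \<Rightarrow> nat \<Rightarrow> real" where
  "avoid_prob P K = real ((P - K) choose K) / (P choose K)"

lemma prob_avoids:
  assumes "K \<le> P" "Y \<in> ksubsets P K"
  shows "measure_pmf.prob (uniform_set P K) {S. Y \<inter> S = {}} = avoid_prob P K"
    and "measure_pmf.prob (uniform_set P K) {S. Y \<inter> S \<noteq> {}} = 1 - avoid_prob P K"
proof -
  show 1: "measure_pmf.prob (uniform_set P K) {S. Y \<inter> S = {}} = avoid_prob P K"
    using prob_avoids_eq[OF assms(1), of Y] ksubsetsD[OF assms(2)]
    by (simp add: avoid_prob_def Int_commute)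
  have "measure_pmf.prob (uniform_set P K) (space (measure_pmf (uniform_set P K)) - {S. Y \<inter> S = {}})
      = 1 - avoid_prob P K"
    using 1 by (subst measure_pmf.prob_compl) auto
  moreover have "space (measure_pmf (uniform_set P K)) - {S. Y \<inter> S = {}} = {S. Y \<inter> S \<noteq> {}}" by auto
  ultimately show "measure_pmf.prob (uniform_set P K) {S. Y \<inter> S \<noteq> {}} = 1 - avoid_prob P K" by simp
qed

lemma avoid_prob_bounds:
  assumes "K \<le> P"
  shows "0 \<le> avoid_prob P K" "avoid_prob P K \<le> 1" "1 - avoid_prob P K \<le> real K ^ 2 / P"
proof -
  obtain Y where Y: "Y \<in> ksubsets P K" using ksubsets_nonempty[OF assms] by auto
  show "0 \<le> avoid_prob P K" by (simp add: avoid_prob_def)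
  show "avoid_prob P K \<le> 1" using prob_avoids(1)[OF assms Y] by (metis measure_pmf.prob_le_1)
  show "1 - avoid_prob P K \<le> real K ^ 2 / P"
    using prob_avoids(2)[OF assms Y] prob_meets_le[OF assms, of Y] ksubsetsD[OF Y]
    by (simp add: Int_commute power2_eq_square)
qed

text \<open>Once \<open>Y\<close> is fixed, the other nodes are adjacent independently, with a
  probability that does not depend on \<open>Y\<close>, so the degree is binomial. The power of
  \<open>avoid_prob P K\<close> belonging to the non-neighbours is lowered to the common value
  \<open>avoid_prob P K ^ card R\<close>.\<close>

lemma prob_few_neighbors_ge:
  assumes "K \<le> P" "Y \<in> ksubsets P K" "finite R"
  shows "avoid_prob P K ^ card R * (\<Sum>t<k. (card R choose t) * (1 - avoid_prob P K) ^ t)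
    \<le> measure_pmf.prob (Pi_pmf R {} (\<lambda>_. uniform_set P K)) {y. card {j\<in>R. Y \<inter> y j \<noteq> {}} < k}"
proof -
  let ?p = "Pi_pmf R {} (\<lambda>_. uniform_set P K)" and ?U = "uniform_set P K"
  let ?h = "avoid_prob P K"
  let ?I = "{T. T \<subseteq> R \<and> card T < k}"
  note h = avoid_prob_bounds[OF assms(1)]
  have fin: "finite ?I" by (rule finite_subset[of _ "Pow R"]) (use assms(3) in auto)
  define F where "F T = Pi R (\<lambda>j. if j \<in> T then {S. Y \<inter> S \<noteq> {}} else {S. Y \<inter> S = {}})" for T
  have FT: "T = {j\<in>R. Y \<inter> y j \<noteq> {}}" if "y \<in> F T" "T \<subseteq> R" for y T
    using that unfolding F_def by (auto simp: Pi_iff split: if_splits)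
  have pF: "?h ^ card R * (1 - ?h) ^ card T \<le> measure_pmf.prob ?p (F T)" if T: "T \<subseteq> R" for T
  proof -
    have "measure_pmf.prob ?p (F T) = (\<Prod>j\<in>R. if j \<in> T then 1 - ?h else ?h)"
      unfolding F_def using assms(3) prob_avoids[OF assms(1,2)]
      by (subst measure_Pi_pmf_Pi) (auto intro!: prod.cong)
    also have "\<dots> = (\<Prod>j\<in>R. (if j \<in> T then 1 - ?h else 1) * (if j \<in> R - T then ?h else 1))"
      by (intro prod.cong) auto
    also have "\<dots> = (1 - ?h) ^ card T * ?h ^ card (R - T)"
      using assms(3) T by (simp only: prod.distrib prod_if_mem_eq_power Diff_subset)
    finally have "measure_pmf.prob ?p (F T) = (1 - ?h) ^ card T * ?h ^ card (R - T)" .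
    moreover have "?h ^ card R \<le> ?h ^ card (R - T)"
      using h assms(3) by (intro power_decreasing card_mono) auto
    ultimately show ?thesis using h by (simp add: mult.commute mult_right_mono)
  qed
  have "?h ^ card R * (\<Sum>t<k. (card R choose t) * (1 - ?h) ^ t) = (\<Sum>T\<in>?I. ?h ^ card R * (1 - ?h) ^ card T)"
    by (simp only: sum_power_card_bounded[OF assms(3), symmetric] sum_distrib_left)
  also have "\<dots> \<le> (\<Sum>T\<in>?I. measure_pmf.prob ?p (F T))" using pF by (intro sum_mono) auto
  also have "\<dots> = measure_pmf.prob ?p (\<Union>T\<in>?I. F T)"
  proof (intro measure_pmf.finite_measure_finite_Union[symmetric] fin)
    show "disjoint_family_on F ?I"
      unfolding disjoint_family_on_def using FT by blast
  qed auto
  also have "\<dots> \<le> measure_pmf.prob ?p {y. card {j\<in>R. Y \<inter> y j \<noteq> {}} < k}"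
  proof (rule measure_pmf.finite_measure_mono)
    show "(\<Union>T\<in>?I. F T) \<subseteq> {y. card {j\<in>R. Y \<inter> y j \<noteq> {}} < k}"
    proof
      fix y assume "y \<in> (\<Union>T\<in>?I. F T)"
      then obtain T where "T \<subseteq> R" "card T < k" "y \<in> F T" by auto
      thus "y \<in> {y. card {j\<in>R. Y \<inter> y j \<noteq> {}} < k}" using FT[of y T] by simp
    qed
  qed simp
  finally show ?thesis .
qed

section \<open>The degrees of two nodes\<close>

text \<open>Either \<open>S\<close> hits an object common to \<open>Y\<close> and \<open>Z\<close>,
  or it contains two different objects, one from each. The second case gives the square expected
  under independence; the first is the correlation caused by the overlap.\<close>

lemma prob_meets_both_le:
  assumes "K \<le> P" "Y \<in> ksubsets P K" "Z \<in> ksubsets P K"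
  shows "measure_pmf.prob (uniform_set P K) {S. Y \<inter> S \<noteq> {} \<and> Z \<inter> S \<noteq> {}}
    \<le> card (Y \<inter> Z) * (K / P) + (real K ^ 2 / P) ^ 2"
proof -
  let ?U = "uniform_set P K"
  let ?D = "{(y, z) \<in> Y \<times> Z. y \<noteq> z}"
  note Y = ksubsetsD[OF assms(2)] and Z = ksubsetsD[OF assms(3)]
  have finD: "finite ?D" by (rule finite_subset[of _ "Y \<times> Z"]) (use Y Z in auto)
  have "card ?D \<le> card (Y \<times> Z)" using Y Z by (intro card_mono) auto
  hence cD: "card ?D \<le> K * K" using Y Z by (simp add: card_cartesian_product)
  have "{S. Y \<inter> S \<noteq> {} \<and> Z \<inter> S \<noteq> {}} \<subseteq> {S. S \<inter> (Y \<inter> Z) \<noteq> {}} \<union> (\<Union>yz\<in>?D. {S. {fst yz, snd yz} \<subseteq> S})"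
  proof
    fix S assume "S \<in> {S. Y \<inter> S \<noteq> {} \<and> Z \<inter> S \<noteq> {}}"
    then obtain y z where yz: "y \<in> Y" "y \<in> S" "z \<in> Z" "z \<in> S" by auto
    show "S \<in> {S. S \<inter> (Y \<inter> Z) \<noteq> {}} \<union> (\<Union>yz\<in>?D. {S. {fst yz, snd yz} \<subseteq> S})"
    proof (cases "y = z")
      case True thus ?thesis using yz by auto
    next
      case False
      hence "(y, z) \<in> ?D" "S \<in> {S. {fst (y, z), snd (y, z)} \<subseteq> S}" using yz by auto
      thus ?thesis by blast
    qed
  qed
  hence "measure_pmf.prob ?U {S. Y \<inter> S \<noteq> {} \<and> Z \<inter> S \<noteq> {}}
      \<le> measure_pmf.prob ?U ({S. S \<inter> (Y \<inter> Z) \<noteq> {}} \<union> (\<Union>yz\<in>?D. {S. {fst yz, snd yz} \<subseteq> S}))"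
    by (intro measure_pmf.finite_measure_mono) auto
  also have "\<dots> \<le> measure_pmf.prob ?U {S. S \<inter> (Y \<inter> Z) \<noteq> {}} + measure_pmf.prob ?U (\<Union>yz\<in>?D. {S. {fst yz, snd yz} \<subseteq> S})"
    by (rule measure_Un_le) auto
  also have "measure_pmf.prob ?U {S. S \<inter> (Y \<inter> Z) \<noteq> {}} \<le> real K * card (Y \<inter> Z) / P"
    using assms(1) Y by (intro prob_meets_le) auto
  also have "measure_pmf.prob ?U (\<Union>yz\<in>?D. {S. {fst yz, snd yz} \<subseteq> S}) \<le> (\<Sum>yz\<in>?D. measure_pmf.prob ?U {S. {fst yz, snd yz} \<subseteq> S})"
    using finD by (rule measure_pmf.finite_measure_subadditive_finite) auto
  also have "\<dots> \<le> (\<Sum>yz\<in>?D. (K / P) ^ 2)"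
  proof (rule sum_mono)
    fix yz assume yz: "yz \<in> ?D"
    hence "{fst yz, snd yz} \<subseteq> {1..P}" "card {fst yz, snd yz} = 2" using Y Z by auto
    thus "measure_pmf.prob ?U {S. {fst yz, snd yz} \<subseteq> S} \<le> (K / P) ^ 2"
      using prob_contains_le[OF assms(1), of "{fst yz, snd yz}"] by simp
  qed
  also have "\<dots> = real (card ?D) * (K / P) ^ 2" by simp
  also have "\<dots> \<le> real (K * K) * (K / P) ^ 2" using cD by (intro mult_right_mono) (simp_all only: of_nat_le_iff zero_le_power2)
  also have "real (K * K) * (K / P) ^ 2 = (real K ^ 2 / P) ^ 2" by (simp add: power2_eq_square)
  finally show ?thesis by (simp add: mult.commute)
qed

lemma prob_avoids_both_le:
  assumes "4 * K \<le> P" "Y \<in> ksubsets P K" "Z \<in> ksubsets P K"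
  shows "measure_pmf.prob (uniform_set P K) {S. Y \<inter> S = {} \<and> Z \<inter> S = {}}
    \<le> (avoid_prob P K)\<^sup>2 * exp (3 * (real (card (Y \<inter> Z)) * K / P))"
proof -
  note Y = ksubsetsD[OF assms(2)] and Z = ksubsetsD[OF assms(3)]
  let ?L = "card (Y \<inter> Z)"
  have L: "?L \<le> K" using Y card_mono[of Y "Y \<inter> Z"] by auto
  have "card Y + card Z = card (Y \<union> Z) + ?L" using Y Z by (intro card_Un_Int) auto
  hence c: "card (Y \<union> Z) = 2 * K - ?L" using Y Z by simp
  have "{S. Y \<inter> S = {} \<and> Z \<inter> S = {}} = {S. S \<inter> (Y \<union> Z) = {}}" by auto
  hence "measure_pmf.prob (uniform_set P K) {S. Y \<inter> S = {} \<and> Z \<inter> S = {}}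
      = ((P - (2 * K - ?L)) choose K) / (P choose K)"
    using prob_avoids_eq[of K P "Y \<union> Z"] assms(1) Y Z c by simp
  also have "\<dots> \<le> (avoid_prob P K)\<^sup>2 * exp (3 * (real ?L * K / P))"
    unfolding avoid_prob_def using assms(1) L by (rule choose_ratio_two_sets_le)
  finally show ?thesis .
qed

text \<open>The neighbourhoods \<open>T\<close> and \<open>T'\<close> of the two nodes within
  \<open>R\<close> are enumerated, and each node of \<open>R\<close> contributes by type:
  \<open>\<rho>\<close> for a common neighbour, \<open>1 - avoid_prob P K\<close> for a neighbour of
  just one, \<open>g\<close> for neither. The result is the square of a one-node estimate times
  corrections; the overlap \<open>L\<close> stays as a parameter, to be averaged later.\<close>

lemma prob_both_few_neighbors_le:
  assumes "4 * K \<le> P" "Y \<in> ksubsets P K" "Z \<in> ksubsets P K" "finite R"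
    "card R = n - 2" "2 + 2 * k \<le> n" and h: "0 < avoid_prob P K"
  defines "L \<equiv> card (Y \<inter> Z)"
  shows "measure_pmf.prob (Pi_pmf R {} (\<lambda>_. uniform_set P K))
      {y. card {j\<in>R. Y \<inter> y j \<noteq> {}} < k \<and> card {j\<in>R. Z \<inter> y j \<noteq> {}} < k}
    \<le> avoid_prob P K ^ (2 * n) / avoid_prob P K ^ (4 + 4 * k)
      * (\<Sum>t<k. (real n * (1 - avoid_prob P K)) ^ t / fact t)\<^sup>2
      * exp (real n * (real K ^ 2 / P) ^ 2) * exp (4 * (real n * K / P) * L)"
proof -
  let ?p = "Pi_pmf R {} (\<lambda>_. uniform_set P K)" and ?U = "uniform_set P K"
  let ?h = "avoid_prob P K"
  let ?q = "1 - ?h"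
  let ?I = "{T. T \<subseteq> R \<and> card T < k}"
  define \<rho> where "\<rho> = L * (K / P) + (real K ^ 2 / P) ^ 2"
  define g where "g = ?h\<^sup>2 * exp (3 * (real L * K / P))"
  define b where "b = ?h ^ (2 * n) / ?h ^ (4 + 4 * k) * exp (3 * (real n * K / P) * L)"
  have KP: "K \<le> P" using assms(1) by simp
  note hb = avoid_prob_bounds[OF KP]
  have \<rho>0: "0 \<le> \<rho>" and g0: "0 \<le> g" unfolding \<rho>_def g_def by auto
  have b0: "0 \<le> b" unfolding b_def using hb by simp
  have finI: "finite ?I" by (rule finite_subset[of _ "Pow R"]) (use assms(4) in auto)
  define F where "F T T' = Pi R (\<lambda>j. {S. (Y \<inter> S \<noteq> {} \<longleftrightarrow> j \<in> T) \<and> (Z \<inter> S \<noteq> {} \<longleftrightarrow> j \<in> T')})" for T T'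
  have pF: "measure_pmf.prob ?p (F T T') \<le> b * (\<rho> ^ card (T \<inter> T') * (?q ^ card (T - T') * ?q ^ card (T' - T)))"
    if T: "T \<in> ?I" "T' \<in> ?I" for T T'
  proof -
    have "measure_pmf.prob ?p (F T T')
        = (\<Prod>j\<in>R. measure_pmf.prob ?U {S. (Y \<inter> S \<noteq> {} \<longleftrightarrow> j \<in> T) \<and> (Z \<inter> S \<noteq> {} \<longleftrightarrow> j \<in> T')})"
      unfolding F_def using assms(4) by (subst measure_Pi_pmf_Pi) auto
    also have "\<dots> \<le> (\<Prod>j\<in>R. (if j \<in> T \<inter> T' then \<rho> else 1) * ((if j \<in> T - T' then ?q else 1) *
        ((if j \<in> T' - T then ?q else 1) * (if j \<in> R - (T \<union> T') then g else 1))))"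
    proof (intro prod_mono conjI)
      fix j assume j: "j \<in> R"
      let ?m = "measure_pmf.prob ?U {S. (Y \<inter> S \<noteq> {} \<longleftrightarrow> j \<in> T) \<and> (Z \<inter> S \<noteq> {} \<longleftrightarrow> j \<in> T')}"
      have 1: "?m \<le> \<rho>" if "j \<in> T" "j \<in> T'"
        using that prob_meets_both_le[OF KP assms(2,3)] unfolding \<rho>_def L_def by simp
      have 2: "?m \<le> ?q" if "j \<in> T" "j \<notin> T'"
        unfolding prob_avoids(2)[OF KP assms(2), symmetric]
        using that by (intro measure_pmf.finite_measure_mono) auto
      have 3: "?m \<le> ?q" if "j \<notin> T" "j \<in> T'"
        unfolding prob_avoids(2)[OF KP assms(3), symmetric]
        using that by (intro measure_pmf.finite_measure_mono) auto
      have 4: "?m \<le> g" if "j \<notin> T" "j \<notin> T'"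
        using that prob_avoids_both_le[OF assms(1,2,3)] unfolding g_def L_def by simp
      show "?m \<le> (if j \<in> T \<inter> T' then \<rho> else 1) * ((if j \<in> T - T' then ?q else 1) *
          ((if j \<in> T' - T then ?q else 1) * (if j \<in> R - (T \<union> T') then g else 1)))"
        using j 1 2 3 4 by (cases "j \<in> T"; cases "j \<in> T'") simp_all
    qed auto
    also have "\<dots> = \<rho> ^ card (T \<inter> T') * (?q ^ card (T - T') * (?q ^ card (T' - T) * g ^ card (R - (T \<union> T'))))"
    proof -
      have "T \<inter> T' \<subseteq> R" "T - T' \<subseteq> R" "T' - T \<subseteq> R" "R - (T \<union> T') \<subseteq> R" using T by auto
      thus ?thesis using assms(4) by (simp only: prod.distrib prod_if_mem_eq_power)
    qed
    also have "\<dots> \<le> \<rho> ^ card (T \<inter> T') * (?q ^ card (T - T') * (?q ^ card (T' - T) * b))"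
    proof -
      let ?r = "card (R - (T \<union> T'))"
      have finT: "finite T" "finite T'" using T assms(4) finite_subset by auto
      \<comment> \<open>At most \<open>2 * k\<close> nodes lie in \<open>T \<union> T'\<close>, so
        at least \<open>n - 2 - 2 * k\<close> factors \<open>g\<close> remain; the missing ones
        account for the exponent \<open>4 + 4 * k\<close> in the denominator.\<close>
      have "?r = n - 2 - card (T \<union> T')" using T finT assms(5) by (subst card_Diff_subset) auto
      moreover have "card (T \<union> T') \<le> 2 * k" using card_Un_le[of T T'] T by auto
      ultimately have r: "n - 2 - 2 * k \<le> ?r" "?r \<le> n" by auto
      have "g ^ ?r = ?h ^ (2 * ?r) * exp (?r * (3 * (real L * K / P)))"
        unfolding g_def by (simp only: power_mult_distrib power_mult exp_of_nat_mult)
      also have "\<dots> \<le> ?h ^ (2 * (n - 2 - 2 * k)) * exp (n * (3 * (real L * K / P)))"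
        using hb r by (intro mult_mono power_decreasing) (auto intro!: divide_right_mono mult_right_mono)
      also have "?h ^ (2 * (n - 2 - 2 * k)) = ?h ^ (2 * n) / ?h ^ (4 + 4 * k)"
      proof -
        have "2 * n = 2 * (n - 2 - 2 * k) + (4 + 4 * k)" using assms(6) by simp
        hence "?h ^ (2 * n) = ?h ^ (2 * (n - 2 - 2 * k)) * ?h ^ (4 + 4 * k)" by (metis power_add)
        thus ?thesis using h by simp
      qed
      also have "n * (3 * (real L * K / P)) = 3 * (real n * K / P) * L" by simp
      finally have "g ^ ?r \<le> b" unfolding b_def .
      thus ?thesis using \<rho>0 hb by (intro mult_left_mono) auto
    qed
    finally show ?thesis by (simp only: mult_ac)
  qed
  let ?G = "\<lambda>(C, A, B). \<rho> ^ card C * (?q ^ card A * ?q ^ card B)"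
  have G: "(\<Sum>(T, T')\<in>?I \<times> ?I. \<rho> ^ card (T \<inter> T') * (?q ^ card (T - T') * ?q ^ card (T' - T)))
      \<le> exp (n * \<rho>) * (\<Sum>t<k. (real n * ?q) ^ t / fact t)\<^sup>2"
  proof -
    \<comment> \<open>A pair \<open>(T, T')\<close> is determined by its common part and its two
      differences. Letting these three sets vary freely only enlarges the sum and makes it a
      product: the common part gives \<open>(1 + \<rho>) ^ card R\<close>, the differences two
      truncated exponential sums.\<close>
    let ?\<phi> = "\<lambda>(T, T'). (T \<inter> T', T - T', T' - T)"
    have inj: "inj_on ?\<phi> (?I \<times> ?I)"
    proof (rule inj_onI, clarify)
      fix T T' U U' assume e: "T \<inter> T' = U \<inter> U'" "T - T' = U - U'" "T' - T = U' - U"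
      have "T = (T \<inter> T') \<union> (T - T')" "T' = (T \<inter> T') \<union> (T' - T)"
        "U = (U \<inter> U') \<union> (U - U')" "U' = (U \<inter> U') \<union> (U' - U)" by auto
      thus "T = U \<and> T' = U'" using e by metis
    qed
    have small: "T - T' \<in> ?I" if "T \<in> ?I" for T T'
    proof -
      have "finite T" using that assms(4) finite_subset by auto
      hence "card (T - T') \<le> card T" by (intro card_mono) auto
      thus ?thesis using that by auto
    qed
    have "(\<Sum>(T, T')\<in>?I \<times> ?I. \<rho> ^ card (T \<inter> T') * (?q ^ card (T - T') * ?q ^ card (T' - T)))
        = (\<Sum>x\<in>?I \<times> ?I. ?G (?\<phi> x))" by (intro sum.cong) auto
    also have "\<dots> = (\<Sum>x\<in>?\<phi> ` (?I \<times> ?I). ?G x)"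
      using inj by (simp only: sum.reindex o_def)
    also have "\<dots> \<le> (\<Sum>x\<in>Pow R \<times> ?I \<times> ?I. ?G x)"
    proof (rule sum_mono2)
      show "?\<phi> ` (?I \<times> ?I) \<subseteq> Pow R \<times> ?I \<times> ?I" using small by (auto split: prod.splits)
      show "0 \<le> ?G x" for x using \<rho>0 hb by (auto split: prod.splits)
    qed (use finI assms(4) in auto)
    also have "\<dots> = (\<Sum>C\<in>Pow R. \<rho> ^ card C) * ((\<Sum>A\<in>?I. ?q ^ card A) * (\<Sum>B\<in>?I. ?q ^ card B))"
      by (simp only: sum_product sum.cartesian_product) (auto intro!: sum.cong)
    also have "\<dots> \<le> exp (n * \<rho>) * ((\<Sum>t<k. (real n * ?q) ^ t / fact t) * (\<Sum>t<k. (real n * ?q) ^ t / fact t))"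
    proof (intro mult_mono)
      have "(\<Sum>C\<in>Pow R. \<rho> ^ card C) = (1 + \<rho>) ^ card R" by (rule sum_power_card_Pow[OF assms(4)])
      also have "\<dots> \<le> (1 + \<rho>) ^ n" using \<rho>0 assms(5) by (intro power_increasing) auto
      also have "\<dots> \<le> exp \<rho> ^ n" using \<rho>0 exp_ge_add_one_self[of \<rho>] by (intro power_mono) auto
      finally show "(\<Sum>C\<in>Pow R. \<rho> ^ card C) \<le> exp (n * \<rho>)" by (simp only: exp_of_nat_mult)
      have *: "(\<Sum>A\<in>?I. ?q ^ card A) \<le> (\<Sum>t<k. (real n * ?q) ^ t / fact t)"
        unfolding sum_power_card_bounded[OF assms(4)]
      proof (rule sum_mono)
        fix t
        have "(card R choose t) * fact t \<le> card R ^ t" by (rule binomial_fact_pow)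
        also have "\<dots> \<le> n ^ t" using assms(5) by (intro power_mono) auto
        finally have "real ((card R choose t) * fact t) \<le> real (n ^ t)" by (simp only: of_nat_le_iff)
        hence "real (card R choose t) \<le> real n ^ t / fact t" by (simp add: field_simps)
        hence "real (card R choose t) * ?q ^ t \<le> real n ^ t / fact t * ?q ^ t" using hb by (intro mult_right_mono) auto
        thus "real (card R choose t) * ?q ^ t \<le> (real n * ?q) ^ t / fact t" by (simp add: power_mult_distrib)
      qed
      show "(\<Sum>A\<in>?I. ?q ^ card A) \<le> (\<Sum>t<k. (real n * ?q) ^ t / fact t)" by (rule *)
      show "(\<Sum>A\<in>?I. ?q ^ card A) \<le> (\<Sum>t<k. (real n * ?q) ^ t / fact t)" by (rule *)
    qed (use hb \<rho>0 in \<open>auto intro!: sum_nonneg mult_nonneg_nonneg\<close>)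
    finally show ?thesis by (simp add: power2_eq_square)
  qed
  have "{y. card {j\<in>R. Y \<inter> y j \<noteq> {}} < k \<and> card {j\<in>R. Z \<inter> y j \<noteq> {}} < k} \<subseteq> (\<Union>TT\<in>?I \<times> ?I. F (fst TT) (snd TT))"
  proof
    fix y :: "'a \<Rightarrow> nat set"
    assume "y \<in> {y. card {j\<in>R. Y \<inter> y j \<noteq> {}} < k \<and> card {j\<in>R. Z \<inter> y j \<noteq> {}} < k}"
    hence "({j\<in>R. Y \<inter> y j \<noteq> {}}, {j\<in>R. Z \<inter> y j \<noteq> {}}) \<in> ?I \<times> ?I" by auto
    moreover have "y \<in> F (fst ({j\<in>R. Y \<inter> y j \<noteq> {}}, {j\<in>R. Z \<inter> y j \<noteq> {}}))
        (snd ({j\<in>R. Y \<inter> y j \<noteq> {}}, {j\<in>R. Z \<inter> y j \<noteq> {}}))" by (auto simp: F_def)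
    ultimately show "y \<in> (\<Union>TT\<in>?I \<times> ?I. F (fst TT) (snd TT))" by (rule UN_I)
  qed
  hence "measure_pmf.prob ?p {y. card {j\<in>R. Y \<inter> y j \<noteq> {}} < k \<and> card {j\<in>R. Z \<inter> y j \<noteq> {}} < k}
      \<le> measure_pmf.prob ?p (\<Union>TT\<in>?I \<times> ?I. F (fst TT) (snd TT))"
    by (intro measure_pmf.finite_measure_mono) auto
  also have "\<dots> \<le> (\<Sum>TT\<in>?I \<times> ?I. measure_pmf.prob ?p (F (fst TT) (snd TT)))"
    using finI by (intro measure_pmf.finite_measure_subadditive_finite) auto
  also have "\<dots> \<le> (\<Sum>(T, T')\<in>?I \<times> ?I. b * (\<rho> ^ card (T \<inter> T') * (?q ^ card (T - T') * ?q ^ card (T' - T))))"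
    by (intro sum_mono) (auto simp: pF split: prod.splits)
  also have "\<dots> = b * (\<Sum>(T, T')\<in>?I \<times> ?I. \<rho> ^ card (T \<inter> T') * (?q ^ card (T - T') * ?q ^ card (T' - T)))"
    by (simp add: sum_distrib_left case_prod_beta)
  also have "\<dots> \<le> b * (exp (n * \<rho>) * (\<Sum>t<k. (real n * ?q) ^ t / fact t)\<^sup>2)"
    using G b0 by (rule mult_left_mono)
  also have "\<dots> = ?h ^ (2 * n) / ?h ^ (4 + 4 * k) * (\<Sum>t<k. (real n * ?q) ^ t / fact t)\<^sup>2
      * exp (real n * (real K ^ 2 / P) ^ 2) * exp (4 * (real n * K / P) * L)"
  proof -
    \<comment> \<open>\<open>n * \<rho>\<close> contributes one more \<open>(n * K / P) * L\<close>
      to the \<open>3\<close> that come from avoidance.\<close>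
    have "exp (n * \<rho>) * exp (3 * (real n * K / P) * L) = exp (real n * (real K ^ 2 / P) ^ 2) * exp (4 * (real n * K / P) * L)"
      unfolding exp_add[symmetric] \<rho>_def by (simp add: algebra_simps)
    thus ?thesis unfolding b_def by (simp add: mult_ac)
  qed
  finally show ?thesis .
qed

text \<open>The falling factorial behind the binomial has \<open>t\<close> factors, each at least
  \<open>n - k\<close>. The power \<open>k\<close> in place of \<open>t\<close> makes the correction
  independent of \<open>t\<close>, so that it can be pulled out of a sum over
  \<open>t < k\<close>.\<close>

lemma choose_ge_power:
  assumes "t < k" "k \<le> n"
  shows "(1 - k / n) ^ k * (real n ^ t / fact t) \<le> real ((n - 1) choose t)"
proof -
  have "real n * (1 - k / n) = real n - k" using assms by (simp add: field_simps)
  hence "(1 - k / n) ^ t * real n ^ t = (real n - k) ^ t" by (simp add: power_mult_distrib[symmetric] mult.commute)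
  moreover have "(1 - k / n) ^ k \<le> (1 - k / n) ^ t" using assms by (intro power_decreasing) auto
  ultimately have 1: "(1 - k / n) ^ k * real n ^ t \<le> (real n - k) ^ t"
    using mult_right_mono[of "(1 - k / n) ^ k" "(1 - k / n) ^ t" "real n ^ t"] by simp
  have "(real n - k) ^ t = (\<Prod>i = 0..<t. real n - k)" by simp
  also have "\<dots> \<le> (\<Prod>i = 0..<t. real (n - 1) - real i)"
    using assms by (intro prod_mono) (auto simp: of_nat_diff)
  also have "\<dots> = fact t * real ((n - 1) choose t)"
    by (simp only: gbinomial_mult_fact[symmetric] binomial_gbinomial)
  finally have "(1 - k / n) ^ k * real n ^ t \<le> fact t * real ((n - 1) choose t)" using 1 by linarith
  thus ?thesis by (simp add: field_simps)
qed

section \<open>Second moment bound for robustness\<close>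

text \<open>\<open>b\<close> bounds the probability of one low degree from below, \<open>G\<close>
  that of two low degrees from above. The powers of \<open>h\<close> with exponent growing in
  \<open>n\<close> and the truncated sums cancel in \<open>G / b\<^sup>2\<close>, leaving only
  corrections meant to be close to 1. The diagonal pairs give \<open>1 / (n * b)\<close>.\<close>

lemma prob_k_robust_second_moment_le:
  fixes n k K P :: nat and h b :: real
  defines "h \<equiv> avoid_prob P K"
  defines "b \<equiv> (1 - k / n) ^ k * (h ^ n * (\<Sum>t<k. (real n * (1 - h)) ^ t / fact t))"
  assumes KP: "4 * K \<le> P" and n: "2 + 2 * k \<le> n" and k: "1 \<le> k" and h: "0 < h"
    and \<theta>: "4 * (real n * K / P) \<le> 1"
  shows "measure_pmf.prob (intersection_graph_pmf n P (return_pmf K)) {E. k_robust k {1..n} E}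
    \<le> 1 / (n * b) + exp (real n * (real K ^ 2 / P) ^ 2 + 2 * (real K ^ 2 / P))
        / (h ^ (4 + 4 * k) * (1 - k / n) ^ (2 * k)) - 1"
proof -
  let ?U = "uniform_set P K" and ?V = "{1..n}"
  let ?M = "Pi_pmf ?V {} (\<lambda>_. ?U)"
  let ?E = "\<Sum>t<k. (real n * (1 - h)) ^ t / fact t"
  have KP': "K \<le> P" using KP by simp
  note hb = avoid_prob_bounds[OF KP', folded h_def]
  have finU: "finite (set_pmf ?U)" using KP' by (simp add: set_uniform_set)
  have knn: "0 < 1 - real k / n" using n by (simp add: field_simps)
  have E1: "1 \<le> ?E"
  proof -
    have "(\<Sum>t\<in>{0::nat}. (real n * (1 - h)) ^ t / fact t) \<le> ?E"
      using k hb by (intro sum_mono2) auto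
    thus ?thesis by simp
  qed
  have b: "0 < b" unfolding b_def using knn h E1 by (intro mult_pos_pos) auto
  define X where "X v = {S. poorly_connected k n {v} S}" for v
  define G where "G = h ^ (2 * n) / h ^ (4 + 4 * k) * ?E\<^sup>2 * exp (real n * (real K ^ 2 / P) ^ 2) * exp (2 * (real K ^ 2 / P))"
  have G0: "0 \<le> G" unfolding G_def using h by simp
  have X1: "b \<le> measure_pmf.prob ?M (X v)" if v: "v \<in> ?V" for v
  proof -
    let ?R = "?V - {v}"
    have V: "?V = insert v ?R" using v by auto
    have "measure_pmf.prob ?M (X v) = measure_pmf.prob (Pi_pmf (insert v ?R) {} (\<lambda>_. ?U)) {S. card {j\<in>?R. S v \<inter> S j \<noteq> {}} < k}"
      unfolding X_def poorly_connected_def V[symmetric] by simp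
    also have "\<dots> = measure_pmf.expectation ?U (\<lambda>Y. measure_pmf.prob (Pi_pmf ?R {} (\<lambda>_. ?U)) {y. card {j\<in>?R. Y \<inter> y j \<noteq> {}} < k})"
    proof (rule prob_Pi_pmf_insert)
      fix Y :: "nat set" and S S' :: "nat \<Rightarrow> nat set"
      assume "\<And>j. j \<in> ?R \<Longrightarrow> S j = S' j"
      hence "{j\<in>?R. Y \<inter> S j \<noteq> {}} = {j\<in>?R. Y \<inter> S' j \<noteq> {}}" by auto
      thus "(card {j\<in>?R. Y \<inter> S j \<noteq> {}} < k) = (card {j\<in>?R. Y \<inter> S' j \<noteq> {}} < k)" by simp
    qed (use finU in auto)
    finally have eq: "measure_pmf.prob ?M (X v)
      = measure_pmf.expectation ?U (\<lambda>Y. measure_pmf.prob (Pi_pmf ?R {} (\<lambda>_. ?U)) {y. card {j\<in>?R. Y \<inter> y j \<noteq> {}} < k})" .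
    have "b = h ^ n * (\<Sum>t<k. (1 - k / n) ^ k * (real n ^ t / fact t) * (1 - h) ^ t)"
      unfolding b_def by (simp add: sum_distrib_left power_mult_distrib mult_ac)
    also have "\<dots> \<le> h ^ (n - 1) * (\<Sum>t<k. ((n - 1) choose t) * (1 - h) ^ t)"
    proof (rule mult_mono)
      show "h ^ n \<le> h ^ (n - 1)" using hb by (intro power_decreasing) auto
      show "(\<Sum>t<k. (1 - k / n) ^ k * (real n ^ t / fact t) * (1 - h) ^ t) \<le> (\<Sum>t<k. ((n - 1) choose t) * (1 - h) ^ t)"
        using hb n by (intro sum_mono mult_right_mono choose_ge_power) auto
    qed (use hb knn in \<open>auto intro!: sum_nonneg mult_nonneg_nonneg\<close>)
    also have "\<dots> = measure_pmf.expectation ?U (\<lambda>_. h ^ (n - 1) * (\<Sum>t<k. ((n - 1) choose t) * (1 - h) ^ t))"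
      by simp
    also have "\<dots> \<le> measure_pmf.prob ?M (X v)" unfolding eq
    proof (intro integral_mono_AE AE_pmfI)
      fix Y assume "Y \<in> set_pmf ?U"
      hence "Y \<in> ksubsets P K" using set_uniform_set[OF KP'] by simp
      thus "h ^ (n - 1) * (\<Sum>t<k. ((n - 1) choose t) * (1 - h) ^ t)
          \<le> measure_pmf.prob (Pi_pmf ?R {} (\<lambda>_. ?U)) {y. card {j\<in>?R. Y \<inter> y j \<noteq> {}} < k}"
        using prob_few_neighbors_ge[OF KP', of Y ?R k] v unfolding h_def by simp
    qed (use KP' in auto)
    finally show ?thesis .
  qed
  have X2: "measure_pmf.prob ?M (X u \<inter> X v) \<le> G" if uv: "u \<in> ?V" "v \<in> ?V" "u \<noteq> v" for u v
  proof -
    let ?R = "?V - {u, v}"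
    have V: "?V = insert u (insert v ?R)" using uv by auto
    have cR: "card ?R = n - 2" using uv by (simp add: card_Diff_subset)
    let ?c = "h ^ (2 * n) / h ^ (4 + 4 * k) * ?E\<^sup>2 * exp (real n * (real K ^ 2 / P) ^ 2)"
    let ?Q = "\<lambda>Y Z y. card {j\<in>?R. Y \<inter> y j \<noteq> {}} < k \<and> card {j\<in>?R. Z \<inter> y j \<noteq> {}} < k"
    have loc: "?Q Y Z S = ?Q Y Z S'" if "\<And>j. j \<in> ?R \<Longrightarrow> S j = S' j" for Y Z and S S' :: "nat \<Rightarrow> nat set"
    proof -
      have "{j\<in>?R. W \<inter> S j \<noteq> {}} = {j\<in>?R. W \<inter> S' j \<noteq> {}}" for W using that by auto
      thus ?thesis by simp
    qed
    \<comment> \<open>Counting only neighbours outside \<open>{u, v}\<close> enlarges the event and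
      disregards a possible edge between \<open>u\<close> and \<open>v\<close>, so that the sets
      being counted are independent of those of \<open>u\<close> and \<open>v\<close>.\<close>
    have "X u \<inter> X v \<subseteq> {S. ?Q (S u) (S v) S}"
    proof
      fix S assume S: "S \<in> X u \<inter> X v"
      have "card {j\<in>?R. S w \<inter> S j \<noteq> {}} < k" if "w \<in> {u, v}" for w
      proof -
        have "card {j\<in>?R. S w \<inter> S j \<noteq> {}} \<le> card {j\<in>?V - {w}. S w \<inter> S j \<noteq> {}}"
          using that by (intro card_mono) auto
        also have "\<dots> < k" using S that by (auto simp: X_def poorly_connected_def)
        finally show ?thesis .
      qed
      thus "S \<in> {S. ?Q (S u) (S v) S}" by blast
    qed
    hence "measure_pmf.prob ?M (X u \<inter> X v) \<le> measure_pmf.prob (Pi_pmf (insert u (insert v ?R)) {} (\<lambda>_. ?U)) {S. ?Q (S u) (S v) S}"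
      unfolding V[symmetric] by (intro measure_pmf.finite_measure_mono) auto
    also have "\<dots> = measure_pmf.expectation ?U (\<lambda>Y. measure_pmf.prob (Pi_pmf (insert v ?R) {} (\<lambda>_. ?U)) {S. ?Q Y (S v) S})"
    proof (rule prob_Pi_pmf_insert)
      fix Y :: "nat set" and S S' :: "nat \<Rightarrow> nat set"
      assume e: "\<And>j. j \<in> insert v ?R \<Longrightarrow> S j = S' j"
      hence "?Q Y (S v) S = ?Q Y (S v) S'" by (intro loc) auto
      thus "?Q Y (S v) S = ?Q Y (S' v) S'" using e[of v] by simp
    qed (use finU uv in auto)
    also have "\<dots> = measure_pmf.expectation ?U (\<lambda>Y. measure_pmf.expectation ?U (\<lambda>Z.
        measure_pmf.prob (Pi_pmf ?R {} (\<lambda>_. ?U)) {S. ?Q Y Z S}))"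
    proof (rule Bochner_Integration.integral_cong[OF refl])
      fix Y
      show "measure_pmf.prob (Pi_pmf (insert v ?R) {} (\<lambda>_. ?U)) {S. ?Q Y (S v) S}
          = measure_pmf.expectation ?U (\<lambda>Z. measure_pmf.prob (Pi_pmf ?R {} (\<lambda>_. ?U)) {S. ?Q Y Z S})"
      proof (rule prob_Pi_pmf_insert)
        fix Z and S S' :: "nat \<Rightarrow> nat set" assume "\<And>j. j \<in> ?R \<Longrightarrow> S j = S' j"
        thus "?Q Y Z S = ?Q Y Z S'" by (rule loc)
      qed (use finU uv in auto)
    qed
    also have "\<dots> \<le> measure_pmf.expectation ?U (\<lambda>Y. G)"
    proof (intro integral_mono_AE AE_pmfI)
      fix Y assume "Y \<in> set_pmf ?U"
      hence Y: "Y \<in> ksubsets P K" using set_uniform_set[OF KP'] by simp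
      have "measure_pmf.expectation ?U (\<lambda>Z. measure_pmf.prob (Pi_pmf ?R {} (\<lambda>_. ?U)) {S. ?Q Y Z S})
          \<le> measure_pmf.expectation ?U (\<lambda>Z. ?c * exp (4 * (real n * K / P) * card (Z \<inter> Y)))"
      proof (intro integral_mono_AE AE_pmfI)
        fix Z assume "Z \<in> set_pmf ?U"
        hence Z: "Z \<in> ksubsets P K" using set_uniform_set[OF KP'] by simp
        show "measure_pmf.prob (Pi_pmf ?R {} (\<lambda>_. ?U)) {S. ?Q Y Z S} \<le> ?c * exp (4 * (real n * K / P) * card (Z \<inter> Y))"
          using prob_both_few_neighbors_le[OF KP Y Z _ cR n] h unfolding h_def by (simp add: Int_commute)
      qed (use KP' in auto)
      also have "\<dots> = ?c * measure_pmf.expectation ?U (\<lambda>Z. exp (4 * (real n * K / P) * card (Z \<inter> Y)))" by simp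
      also have "\<dots> \<le> ?c * exp (2 * (real K ^ 2 / P))"
      proof (rule mult_left_mono)
        \<comment> \<open>For fixed \<open>Y\<close> the overlap with \<open>Z\<close> is averaged
          by its exponential moment; \<open>\<theta>\<close> gives
          \<open>exp ?t - 1 \<le> exp 1 - 1 \<le> 2\<close>.\<close>
        let ?t = "4 * (real n * K / P)"
        have "measure_pmf.expectation ?U (\<lambda>Z. exp (?t * card (Z \<inter> Y))) \<le> exp ((exp ?t - 1) * (real K * card Y / P))"
          using ksubsetsD[OF Y] KP' by (intro expectation_exp_card_Int_le) auto
        also have "real K * card Y / P = real K ^ 2 / P" using ksubsetsD[OF Y] by (simp add: power2_eq_square)
        also have "exp ((exp ?t - 1) * (real K ^ 2 / P)) \<le> exp (2 * (real K ^ 2 / P))"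
        proof -
          have "exp ?t \<le> exp 1" using \<theta> by (simp only: exp_le_cancel_iff)
          also have "exp 1 \<le> (3::real)" by (rule exp_le)
          finally have "exp ?t - 1 \<le> 2" by simp
          hence "(exp ?t - 1) * (real K ^ 2 / P) \<le> 2 * (real K ^ 2 / P)" by (rule mult_right_mono) simp
          thus ?thesis by (simp only: exp_le_cancel_iff)
        qed
        finally show "measure_pmf.expectation ?U (\<lambda>Z. exp (?t * card (Z \<inter> Y))) \<le> exp (2 * (real K ^ 2 / P))" .
        show "0 \<le> ?c" using h by simp
      qed
      finally show "measure_pmf.expectation ?U (\<lambda>Z. measure_pmf.prob (Pi_pmf ?R {} (\<lambda>_. ?U)) {S. ?Q Y Z S}) \<le> G"
        unfolding G_def .
    qed (use KP' in auto)
    finally show ?thesis by simp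
  qed
  define \<mu> where "\<mu> = (\<Sum>v\<in>?V. measure_pmf.prob ?M (X v))"
  have n0: "0 < real n" using n by simp
  have "n * b = (\<Sum>v\<in>?V. b)" by simp
  also have "\<dots> \<le> \<mu>" unfolding \<mu>_def by (rule sum_mono[OF X1])
  finally have \<mu>: "n * b \<le> \<mu>" .
  have nb: "0 < n * b" using b n0 by simp
  have \<mu>0: "0 < \<mu>" using \<mu> nb by linarith
  have "(\<Sum>u\<in>?V. \<Sum>v\<in>?V. measure_pmf.prob ?M (X u \<inter> X v)) \<le> (\<Sum>u\<in>?V. measure_pmf.prob ?M (X u) + n * G)"
  proof (rule sum_mono)
    fix u assume u: "u \<in> ?V"
    have "(\<Sum>v\<in>?V. measure_pmf.prob ?M (X u \<inter> X v))
        = measure_pmf.prob ?M (X u) + (\<Sum>v\<in>?V - {u}. measure_pmf.prob ?M (X u \<inter> X v))"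
      using u by (subst sum.remove[of _ u]) auto
    also have "(\<Sum>v\<in>?V - {u}. measure_pmf.prob ?M (X u \<inter> X v)) \<le> (\<Sum>v\<in>?V - {u}. G)"
      using u by (intro sum_mono X2) auto
    also have "\<dots> \<le> (\<Sum>v\<in>?V. G)" using G0 by (intro sum_mono2) auto
    finally show "(\<Sum>v\<in>?V. measure_pmf.prob ?M (X u \<inter> X v)) \<le> measure_pmf.prob ?M (X u) + n * G" by simp
  qed
  also have "\<dots> = \<mu> + real n ^ 2 * G" by (simp add: sum.distrib \<mu>_def power2_eq_square)
  finally have S2: "(\<Sum>u\<in>?V. \<Sum>v\<in>?V. measure_pmf.prob ?M (X u \<inter> X v)) \<le> \<mu> + real n ^ 2 * G" .
  have "measure_pmf.prob (intersection_graph_pmf n P (return_pmf K)) {E. k_robust k {1..n} E}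
      = measure_pmf.prob ?M {S. k_robust k {1..n} (intersection_edges n S)}"
    by (simp add: prob_intersection_graph object_set_pmf_return)
  also have "\<dots> \<le> measure_pmf.prob ?M {S. \<forall>v\<in>?V. S \<notin> X v}"
  proof (rule measure_pmf.finite_measure_mono)
    show "{S. k_robust k {1..n} (intersection_edges n S)} \<subseteq> {S. \<forall>v\<in>?V. S \<notin> X v}"
      using low_degree_not_k_robust[of n k] n k unfolding X_def by auto
  qed simp
  also have "\<dots> \<le> (\<Sum>u\<in>?V. \<Sum>v\<in>?V. measure_pmf.prob ?M (X u \<inter> X v)) / \<mu>\<^sup>2 - 1"
    unfolding \<mu>_def by (rule second_moment_none_le) (use KP' \<mu>0 in \<open>auto simp: \<mu>_def\<close>)
  also have "\<dots> \<le> (\<mu> + real n ^ 2 * G) / \<mu>\<^sup>2 - 1"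
    using S2 by (intro diff_mono divide_right_mono) auto
  also have "(\<mu> + real n ^ 2 * G) / \<mu>\<^sup>2 = 1 / \<mu> + real n ^ 2 * G / \<mu>\<^sup>2"
    using \<mu>0 by (simp add: power2_eq_square add_divide_distrib)
  also have "\<dots> \<le> 1 / (n * b) + real n ^ 2 * G / (n * b)\<^sup>2"
    using \<mu> nb \<mu>0 G0 b n0 by (intro add_mono divide_left_mono mult_nonneg_nonneg power_mono mult_pos_pos) auto
  also have "real n ^ 2 * G / (n * b)\<^sup>2 = G / b\<^sup>2" using n0 by (simp add: power_mult_distrib)
  also have "G / b\<^sup>2 = exp (real n * (real K ^ 2 / P) ^ 2 + 2 * (real K ^ 2 / P)) / (h ^ (4 + 4 * k) * (1 - k / n) ^ (2 * k))"
  proof -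
    have b2: "b\<^sup>2 = (1 - k / n) ^ (2 * k) * (h ^ (2 * n) * ?E\<^sup>2)"
      unfolding b_def by (simp only: power_mult_distrib power_mult[symmetric] mult.commute[of _ 2])
    have nz: "0 < h ^ (2 * n)" "0 < ?E\<^sup>2" "0 < h ^ (4 + 4 * k)" "0 < (1 - k / n) ^ (2 * k)"
      using h E1 knn by (auto intro!: zero_less_power)
    have alg: "A / B * F * e1 * e2 / (D * (A * F)) = (e1 * e2) / (B * D)"
      if "0 < A" "0 < F" "0 < B" "0 < D" for A B F D e1 e2 :: real
      using that by (simp add: field_simps)
    show ?thesis unfolding G_def b2 exp_add by (rule alg) (fact nz)+
  qed
  finally show ?thesis by simp
qed

section \<open>The zero-law for a constant size\<close>

text \<open>Eventually \<open>x n \<le> k * ln n\<close>, so the edge probability is at most of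
  order \<open>ln n / n\<close> and the corrections in the second moment bound tend to 1. It remains
  to see that the lower bound \<open>n * b\<close> for the expected number of low-degree nodes
  diverges; which term of the truncated sum shows this depends on the size of
  \<open>n * q\<close>.\<close>

lemma uniform_k_robust_limit_0:
  fixes k :: nat and K P :: "nat \<Rightarrow> nat" and c :: real
  defines "x \<equiv> \<lambda>n. real n * real (K n) ^ 2 / P n"
  assumes k: "1 \<le> k" and c: "0 < c"
    and P: "\<forall>\<^sub>F n in sequentially. 0 < P n"
    and Kbig: "\<forall>\<^sub>F n in sequentially. c * ln (real n) ^ 3 \<le> K n"
    and lim: "filterlim (\<lambda>n. x n - ln (real n) - (real k - 1) * ln (ln (real n))) at_bot sequentially"
  shows "(\<lambda>n. measure_pmf.prob (intersection_graph_pmf n (P n) (return_pmf (K n)))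
                {E. k_robust k {1..n} E}) \<longlonglongrightarrow> 0"
proof -
  define a where "a n = x n - ln (real n) - (real k - 1) * ln (ln (real n))" for n
  let ?prob = "\<lambda>n. measure_pmf.prob (intersection_graph_pmf n (P n) (return_pmf (K n))) {E. k_robust k {1..n} E}"
  let ?b1 = "\<lambda>n. 2 * exp (1 - ln (real n) / 2) + 2 * exp 1 * (2 ^ (k - 1) * fact (k - 1)) * exp (a n)"
  let ?b2 = "\<lambda>n. exp ((k * ln (real n)) ^ 2 / n + 2 * (k * ln (real n) / n))
      / ((1 - k * ln (real n) / n) ^ (4 + 4 * k) * (1 - k / real n) ^ (2 * k))"
  have alim: "filterlim a at_bot sequentially" using lim unfolding a_def .
  have "(\<lambda>n. 2 * exp (1 - ln (real n) / 2)) \<longlonglongrightarrow> 0" by real_asymp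
  moreover have "(\<lambda>n. 2 * exp 1 * (2 ^ (k - 1) * fact (k - 1)) * exp (a n)) \<longlonglongrightarrow> 2 * exp 1 * (2 ^ (k - 1) * fact (k - 1)) * 0"
    by (intro tendsto_mult tendsto_const filterlim_compose[OF exp_at_bot alim])
  ultimately have b1: "?b1 \<longlonglongrightarrow> 0" using tendsto_add by fastforce
  have "(\<lambda>n. 1 - k * ln (real n) / n) \<longlonglongrightarrow> 1" "(\<lambda>n. 1 - k / real n) \<longlonglongrightarrow> 1"
    "(\<lambda>n. exp ((k * ln (real n)) ^ 2 / n + 2 * (k * ln (real n) / n))) \<longlonglongrightarrow> 1"
    using k by real_asymp+
  hence "?b2 \<longlonglongrightarrow> 1 / (1 ^ (4 + 4 * k) * 1 ^ (2 * k))"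
    by (intro tendsto_divide tendsto_mult tendsto_power) auto
  hence b2: "?b2 \<longlonglongrightarrow> 1" by simp
  have ev: "\<forall>\<^sub>F n in sequentially. ?prob n \<le> ?b1 n + ?b2 n - 1"
  proof -
    have e0: "\<forall>\<^sub>F n in sequentially. a n \<le> 0" using alim by (simp add: filterlim_at_bot)
    have e1: "\<forall>\<^sub>F n in sequentially. 1 \<le> ln (real n)" by real_asymp
    have e2: "\<forall>\<^sub>F n in sequentially. 1 \<le> c * ln (real n) ^ 3" using c by real_asymp
    have e3: "\<forall>\<^sub>F n in sequentially. 2 * real k + 2 \<le> real n" by real_asymp
    have e4: "\<forall>\<^sub>F n in sequentially. 4 * (k * ln (real n) / (c * ln (real n) ^ 3)) \<le> 1" using c k by real_asymp
    have e5: "\<forall>\<^sub>F n in sequentially. k * ln (real n) / n \<le> 1 / 2" using k by real_asymp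
    have e6: "\<forall>\<^sub>F n in sequentially. (k * ln (real n)) ^ 2 / n \<le> 1 / 2" using k by real_asymp
    have "(\<lambda>n. (1 - k / real n) ^ k) \<longlonglongrightarrow> 1 ^ k" using k by (intro tendsto_power) real_asymp
    hence e7: "\<forall>\<^sub>F n in sequentially. 1 / 2 < (1 - k / real n) ^ k" by (rule order_tendstoD) simp
    show ?thesis
      using e0 e1 e2 e3 e4 e5 e6 e7 P Kbig
    proof eventually_elim
      case (elim n)
      let ?K = "K n" and ?P = "P n" and ?L = "ln (real n)"
      define h where "h = avoid_prob ?P ?K"
      define q where "q = 1 - h"
      define Sm where "Sm = (\<Sum>t<k. (real n * (1 - h)) ^ t / fact t)"
      define b where "b = (1 - k / n) ^ k * (h ^ n * Sm)"
      have n: "2 + 2 * k \<le> n" using elim(4) by linarith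
      have pos: "0 < real n" "0 < real ?P" "0 < real ?K" using n elim(3,9,10) by auto
      have xdef: "x n = real n * real ?K ^ 2 / ?P" by (simp add: x_def)
      have x0: "0 \<le> x n" unfolding xdef by simp
      have xa: "x n = ?L + (real k - 1) * ln ?L + a n" unfolding a_def by simp
      have "ln ?L \<le> ?L" using ln_le_minus_one[of ?L] elim(2) by linarith
      hence "(real k - 1) * ln ?L \<le> (real k - 1) * ?L" using k by (intro mult_left_mono) auto
      hence xL: "x n \<le> k * ?L" using xa elim(1) by (simp add: algebra_simps)
      have K2: "real ?K ^ 2 / ?P = x n / n" using pos by (simp add: xdef)
      have xn: "x n / n \<le> k * ?L / n" using xL by (intro divide_right_mono) auto
      have "real n * ?K / ?P = x n / ?K" using pos by (simp add: xdef power2_eq_square)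
      also have "\<dots> \<le> k * ?L / (c * ?L ^ 3)" using xL x0 elim(3,10) by (intro frac_le) auto
      finally have t1: "4 * (real n * ?K / ?P) \<le> 1" using elim(5) by linarith
      \<comment> \<open>Smallness of \<open>n * K / P\<close> together with \<open>n \<ge> 1\<close>
        provides \<open>4 * K \<le> P\<close>.\<close>
      have "1 * real ?K \<le> real n * ?K" using n by (intro mult_right_mono) auto
      moreover have "4 * (real n * ?K) \<le> ?P" using t1 pos by (simp add: field_simps)
      ultimately have "4 * real ?K \<le> ?P" by linarith
      hence KP: "4 * ?K \<le> ?P" by linarith
      hence KP': "?K \<le> ?P" by simp
      note hb = avoid_prob_bounds[OF KP', folded h_def]
      have q: "0 \<le> q" "q \<le> x n / n" "q \<le> 1 / 2" using hb(2,3) K2 xn elim(6) unfolding q_def by linarith+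
      have h_ge: "1 - k * ?L / n \<le> h" using q xn unfolding q_def by linarith
      have h0: "0 < h" using q(3) unfolding q_def by linarith
      have kn0: "0 < 1 - k / real n" using n by (simp add: field_simps)
      have k2: "0 < 1 - k * ?L / n" using elim(6) by linarith
      have Sm1: "1 \<le> Sm"
      proof -
        have "(\<Sum>t\<in>{0::nat}. (real n * (1 - h)) ^ t / fact t) \<le> Sm"
          unfolding Sm_def using k hb by (intro sum_mono2) auto
        thus ?thesis by simp
      qed
      have Smk: "(real n * q) ^ (k - 1) / fact (k - 1) \<le> Sm"
      proof -
        have "(\<Sum>t\<in>{k - 1}. (real n * (1 - h)) ^ t / fact t) \<le> Sm"
          unfolding Sm_def using k hb by (intro sum_mono2) auto
        thus ?thesis by (simp add: q_def)
      qed
      \<comment> \<open>The inequality \<open>ln (1 - q) \<ge> - q - 2 * q\<^sup>2\<close> for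
        \<open>q \<le> 1 / 2\<close> costs \<open>2 * n * q\<^sup>2 \<le> 1\<close>, which is the
        \<open>1\<close> in the exponent.\<close>
      have hn: "exp (- (n * q) - 1) \<le> h ^ n"
      proof -
        have "q\<^sup>2 \<le> (k * ?L / n)\<^sup>2" using q xn by (intro power_mono) auto
        hence "n * q\<^sup>2 \<le> n * (k * ?L / n)\<^sup>2" by (intro mult_left_mono) auto
        also have "\<dots> = (k * ?L)\<^sup>2 / n" using pos by (simp add: power2_eq_square)
        finally have "n * q\<^sup>2 \<le> 1 / 2" using elim(7) by linarith
        hence "- (n * q) - 1 \<le> n * (- q - 2 * q\<^sup>2)" by (simp add: algebra_simps)
        also have "\<dots> \<le> n * ln (1 - q)"
          using ln_one_minus_pos_lower_bound[of q] q by (intro mult_left_mono) auto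
        finally have "exp (- (n * q) - 1) \<le> exp (n * ln (1 - q))" by simp
        also have "\<dots> = h ^ n" using h0 by (simp add: exp_of_nat_mult q_def)
        finally show ?thesis .
      qed
      have hn0: "0 < h ^ n" using h0 by simp
      have nb: "n * h ^ n * Sm / 2 \<le> n * b"
      proof -
        have "1 / 2 * (n * h ^ n * Sm) \<le> (1 - k / real n) ^ k * (n * h ^ n * Sm)"
          using elim(8) h0 Sm1 by (intro mult_right_mono) auto
        thus ?thesis unfolding b_def by (simp add: mult_ac)
      qed
      have n_exp: "real n = exp ?L" using pos by simp
      have inv: "1 / (n * b) \<le> ?b1 n"
      \<comment> \<open>For small \<open>n * q\<close> the term \<open>t = 0\<close> is enough:
        isolated nodes alone make \<open>n * b\<close> at least of order \<open>sqrt n\<close>.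
        Otherwise the term \<open>t = k - 1\<close> supplies a power of \<open>ln n\<close> that
        cancels the one in \<open>exp (- x n)\<close>.\<close>
      proof (cases "n * q \<le> ?L / 2")
        case True
        have "exp (?L / 2 - 1) \<le> exp (?L + (- (n * q) - 1))" using True by simp
        also have "\<dots> = n * exp (- (n * q) - 1)" unfolding exp_add using n_exp by simp
        also have "\<dots> \<le> n * h ^ n" using hn by (intro mult_left_mono) auto
        also have "\<dots> \<le> n * h ^ n * Sm" using Sm1 hn0 mult_left_mono[of 1 Sm "n * h ^ n"] by simp
        finally have lb: "exp (?L / 2 - 1) / 2 \<le> n * b" using nb by linarith
        have "1 / (n * b) \<le> 1 / (exp (?L / 2 - 1) / 2)" by (rule frac_le[OF _ _ _ lb]) simp_all
        also have "\<dots> = 2 * exp (1 - ?L / 2)" by (simp add: exp_diff)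
        finally show ?thesis by (simp add: add_increasing2)
      next
        case False
        have "exp (- a n) / (exp 1 * ?L ^ (k - 1)) \<le> n * h ^ n"
        proof -
          have nq: "n * q \<le> x n" using q(2) pos by (simp add: field_simps)
          have "exp (- a n) / (exp 1 * ?L ^ (k - 1)) = n * exp (- x n - 1)"
          proof -
            have "exp (- x n - 1) = exp (- a n) / (exp 1 * (exp ?L * exp ((real k - 1) * ln ?L)))"
              unfolding xa exp_add[symmetric] exp_diff[symmetric] by (simp add: algebra_simps)
            also have "(real k - 1) * ln ?L = real (k - 1) * ln ?L" using k by (simp add: of_nat_diff)
            also have "exp (real (k - 1) * ln ?L) = ?L ^ (k - 1)" using elim(2) by (simp only: exp_of_nat_mult) simp
            finally show ?thesis using n_exp pos by simp
          qed
          also have "\<dots> \<le> n * exp (- (n * q) - 1)" using nq by (intro mult_left_mono) auto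
          also have "\<dots> \<le> n * h ^ n" using hn by (intro mult_left_mono) auto
          finally show ?thesis .
        qed
        moreover have "(?L / 2) ^ (k - 1) / fact (k - 1) \<le> Sm"
        proof -
          have "(?L / 2) ^ (k - 1) / fact (k - 1) \<le> (real n * q) ^ (k - 1) / fact (k - 1)"
            using False elim(2) by (intro divide_right_mono power_mono) auto
          thus ?thesis using Smk by linarith
        qed
        ultimately have "exp (- a n) / (exp 1 * ?L ^ (k - 1)) * ((?L / 2) ^ (k - 1) / fact (k - 1)) \<le> n * h ^ n * Sm"
          using elim(2) Sm1 hn0 by (intro mult_mono) auto
        also have "exp (- a n) / (exp 1 * ?L ^ (k - 1)) * ((?L / 2) ^ (k - 1) / fact (k - 1))
            = exp (- a n) / (exp 1 * (2 ^ (k - 1) * fact (k - 1)))"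
          using elim(2) by (simp add: power_divide)
        finally have lb: "exp (- a n) / (exp 1 * (2 ^ (k - 1) * fact (k - 1))) / 2 \<le> n * b"
          using nb by (meson divide_right_mono order_trans zero_le_numeral)
        have "1 / (n * b) \<le> 1 / (exp (- a n) / (exp 1 * (2 ^ (k - 1) * fact (k - 1))) / 2)"
          by (rule frac_le[OF _ _ _ lb]) simp_all
        also have "\<dots> = 2 * exp 1 * (2 ^ (k - 1) * fact (k - 1)) * exp (a n)"
          by (simp add: exp_minus field_simps)
        finally show ?thesis by (simp add: add_increasing)
      qed
      have main: "?prob n \<le> 1 / (n * b) + exp (real n * (real ?K ^ 2 / ?P) ^ 2 + 2 * (real ?K ^ 2 / ?P))
          / (h ^ (4 + 4 * k) * (1 - k / n) ^ (2 * k)) - 1"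
        unfolding b_def h_def Sm_def
        by (rule prob_k_robust_second_moment_le[OF KP n k _ t1]) (use h0 in \<open>simp add: h_def\<close>)
      have "exp (real n * (real ?K ^ 2 / ?P) ^ 2 + 2 * (real ?K ^ 2 / ?P)) / (h ^ (4 + 4 * k) * (1 - k / n) ^ (2 * k)) \<le> ?b2 n"
      proof (rule frac_le)
        have "(x n / n)\<^sup>2 \<le> (k * ?L / n)\<^sup>2" using x0 xn by (intro power_mono) auto
        hence "n * (x n / n)\<^sup>2 \<le> n * (k * ?L / n)\<^sup>2" by (intro mult_left_mono) auto
        also have "\<dots> = (k * ?L)\<^sup>2 / n" using pos by (simp add: power2_eq_square)
        finally show "exp (real n * (real ?K ^ 2 / ?P) ^ 2 + 2 * (real ?K ^ 2 / ?P)) \<le> exp ((k * ?L) ^ 2 / n + 2 * (k * ?L / n))"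
          unfolding K2 using xn by simp
        show "(1 - k * ?L / n) ^ (4 + 4 * k) * (1 - k / real n) ^ (2 * k) \<le> h ^ (4 + 4 * k) * (1 - k / n) ^ (2 * k)"
          using h_ge k2 kn0 by (intro mult_right_mono power_mono) auto
        show "0 < (1 - k * ?L / n) ^ (4 + 4 * k) * (1 - k / real n) ^ (2 * k)" using k2 kn0 by simp
      qed simp
      thus ?case using main inv by linarith
    qed
  qed
  have "(\<lambda>n. ?b1 n + ?b2 n - 1) \<longlonglongrightarrow> 0 + 1 - 1" by (intro tendsto_intros b1 b2)
  hence upper: "(\<lambda>n. ?b1 n + ?b2 n - 1) \<longlonglongrightarrow> 0" by simp
  show ?thesis by (rule tendsto_sandwich[OF _ ev tendsto_const upper]) auto
qed

section \<open>General size distributions\<close>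

text \<open>Chebyshev's inequality at distance \<open>m / L\<close>, with \<open>n\<close> for the
  union bound over the nodes. The quotient is arranged so that for \<open>L = ln n\<close> the
  variance hypothesis says precisely that it tends to 0.\<close>

lemma prob_deviation_le:
  fixes D :: "nat pmf"
  assumes "finite (set_pmf D)" "0 < L" "0 < measure_pmf.expectation D real"
  defines "m \<equiv> measure_pmf.expectation D real"
  shows "n * measure_pmf.prob D {s. m / L \<le> \<bar>real s - m\<bar>}
    \<le> measure_pmf.variance D real / (m\<^sup>2 / (real n * L\<^sup>2))"
proof -
  have "measure_pmf.prob D {s \<in> space (measure_pmf D). m / L \<le> \<bar>real s - measure_pmf.expectation D real\<bar>}
      \<le> measure_pmf.variance D real / (m / L)\<^sup>2"
    using assms by (intro measure_pmf.Chebyshev_inequality) (auto intro!: integrable_measure_pmf_finite)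
  hence "n * measure_pmf.prob D {s. m / L \<le> \<bar>real s - m\<bar>} \<le> n * (measure_pmf.variance D real / (m / L)\<^sup>2)"
    unfolding m_def by (intro mult_left_mono) auto
  thus ?thesis by (simp add: power_divide field_simps)
qed

theorem theorem6:
  fixes k :: nat
    and P :: "nat \<Rightarrow> nat"
    and D :: "nat \<Rightarrow> nat pmf"
    and \<alpha> :: "nat \<Rightarrow> real"
  assumes k_pos: "k \<ge> 1"
    and P_pos: "\<And>n. n \<ge> 1 \<Longrightarrow> P n \<ge> 1"
    and D_supp: "\<And>n. n \<ge> 1 \<Longrightarrow> set_pmf (D n) \<subseteq> {1..P n}"
    and alpha: "\<And>n. n \<ge> 2 \<Longrightarrow>
       (measure_pmf.expectation (D n) real)\<^sup>2 / real (P n) =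
       (ln (real n) + (real k - 1) * ln (ln (real n)) + \<alpha> n) / real n"
    and E_growth: "(\<lambda>n. measure_pmf.expectation (D n) real) \<in> \<Omega>(\<lambda>n. (ln (real n)) ^ 3)"
    and Var_small: "(\<lambda>n. measure_pmf.variance (D n) real) \<in>
       o(\<lambda>n. (measure_pmf.expectation (D n) real)\<^sup>2 / (real n * (ln (real n))\<^sup>2))"
  shows "(filterlim \<alpha> at_bot sequentially \<longrightarrow>
            (\<lambda>n. measure_pmf.prob (intersection_graph_pmf n (P n) (D n))
                   {E. k_robust k {1..n} E}) \<longlonglongrightarrow> 0) \<and>
         (filterlim \<alpha> at_top sequentially \<longrightarrow>
            (\<lambda>n. measure_pmf.prob (intersection_graph_pmf n (P n) (D n))
                   {E. k_robust k {1..n} E}) \<longlonglongrightarrow> 1)"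
proof -
  define m where "m n = measure_pmf.expectation (D n) real" for n
  define v where "v n = measure_pmf.variance (D n) real / ((m n)\<^sup>2 / (real n * (ln (real n))\<^sup>2))" for n
  let ?prob = "\<lambda>n. measure_pmf.prob (intersection_graph_pmf n (P n) (D n)) {E. k_robust k {1..n} E}"
  let ?uprob = "\<lambda>K n. measure_pmf.prob (intersection_graph_pmf n (P n) (return_pmf (K n))) {E. k_robust k {1..n} E}"
  let ?X = "\<lambda>K n. real n * real (K n :: nat) ^ 2 / P n"
  let ?a = "\<lambda>K n. ?X K n - ln (real n) - (real k - 1) * ln (ln (real n))"
  have v: "v \<longlonglongrightarrow> 0" unfolding v_def m_def using Var_small by (rule smalloD_tendsto)
  have m0: "0 \<le> m n" for n unfolding m_def by (intro integral_nonneg_AE) auto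
  obtain c where c: "0 < c" and cm: "\<forall>\<^sub>F n in sequentially. norm (m n) \<ge> c * norm (ln (real n) ^ 3)"
    using landau_omega.bigE[OF E_growth] unfolding m_def by blast
  have mbig: "\<forall>\<^sub>F n in sequentially. c * ln (real n) ^ 3 \<le> m n"
    using cm eventually_ge_at_top[of 1]
  proof eventually_elim
    case (elim n)
    thus ?case using m0[of n] by simp
  qed
  have fin: "finite (set_pmf (D n))" if "1 \<le> n" for n
    using D_supp[OF that] finite_subset by blast
  have supp: "set_pmf (D n) \<subseteq> {..P n}" if "1 \<le> n" for n
    using D_supp[OF that] by auto
  have mP: "m n \<le> P n" if "1 \<le> n" for n
  proof -
    have "m n \<le> measure_pmf.expectation (D n) (\<lambda>_. real (P n))"
      unfolding m_def using supp[OF that] fin[OF that]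
      by (intro integral_mono_AE AE_pmfI) (auto intro!: integrable_measure_pmf_finite)
    thus ?thesis by simp
  qed
  have x0: "real n * (m n)\<^sup>2 / P n = ln (real n) + (real k - 1) * ln (ln (real n)) + \<alpha> n" if "2 \<le> n" for n
  proof -
    have "real n * ((m n)\<^sup>2 / P n) = ln (real n) + (real k - 1) * ln (ln (real n)) + \<alpha> n"
      unfolding m_def alpha[OF that] using that by simp
    thus ?thesis by simp
  qed
  have lnln: "(real k - 1) * ln (ln (real n)) \<le> (real k - 1) * ln (real n)" if "1 \<le> ln (real n)" for n
  proof -
    have "ln (ln (real n)) \<le> ln (real n)" using ln_le_minus_one[of "ln (real n)"] that by linarith
    thus ?thesis using k_pos by (intro mult_left_mono) auto
  qed
  have e1: "\<forall>\<^sub>F n in sequentially. 8 \<le> ln (real n)" by real_asymp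
  have e2: "\<forall>\<^sub>F n in sequentially. ln (real n) \<le> c * ln (real n) ^ 3" using c by real_asymp
  have e3: "\<forall>\<^sub>F n in sequentially. 4 \<le> c * ln (real n) ^ 3" using c by real_asymp
  note ev = e1 e2 e3 mbig eventually_ge_at_top[of "2::nat"]
  show ?thesis
  proof (intro conjI impI)
    assume lim: "filterlim \<alpha> at_bot sequentially"
    \<comment> \<open>Rounding up ensures that a size above \<open>K n\<close> exceeds the mean by
      more than \<open>m n / ln n\<close>.\<close>
    define K where "K n = nat \<lceil>(1 + 1 / ln (real n)) * m n\<rceil>" for n
    have K_ge: "(1 + 1 / ln (real n)) * m n \<le> K n" for n unfolding K_def by (rule real_nat_ceiling_ge)
    have neg: "\<forall>\<^sub>F n in sequentially. \<alpha> n \<le> 0" using lim by (simp add: filterlim_at_bot)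
    have e4: "\<forall>\<^sub>F n in sequentially. 4 * (k * ln (real n)) \<le> real n" using k_pos by real_asymp
    have main: "\<forall>\<^sub>F n in sequentially. ?a K n \<le> \<alpha> n + 8 * k \<and> c * ln (real n) ^ 3 \<le> K n \<and> ?prob n \<le> ?uprob K n + v n"
      using ev neg e4
    proof eventually_elim
      case (elim n)
      let ?L = "ln (real n)"
      have n1: "1 \<le> n" using elim(5) by simp
      have P0: "0 < real (P n)" using P_pos[OF n1] by simp
      have mp: "0 < m n" using elim(1,2,4) by linarith
      have nn: "0 \<le> (1 + 1 / ?L) * m n" using elim(1) mp by simp
      have mK: "m n \<le> K n"
      proof -
        have "1 * m n \<le> (1 + 1 / ?L) * m n" using elim(1) mp by (intro mult_right_mono) auto
        thus ?thesis using K_ge[of n] by linarith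
      qed
      \<comment> \<open>The rounding is absorbed into a second summand \<open>m n / ln n\<close>,
        which is at least 1.\<close>
      have "1 \<le> m n / ?L" using elim(1,2,4) by (simp add: field_simps)
      moreover have "K n \<le> (1 + 1 / ?L) * m n + 1" unfolding K_def using nn by linarith
      moreover have "(1 + 2 / ?L) * m n = (1 + 1 / ?L) * m n + m n / ?L" using elim(1) by (simp add: field_simps)
      ultimately have K_le: "K n \<le> (1 + 2 / ?L) * m n" by linarith
      let ?z = "real n * (m n)\<^sup>2 / P n"
      have x00: "0 \<le> ?z" by simp
      have "?z \<le> ?L + (real k - 1) * ?L"
        using x0[OF elim(5)] elim(6) lnln[of n] elim(1) by linarith
      hence x0L: "?z \<le> k * ?L" by (simp add: algebra_simps)
      have "real (K n) ^ 2 \<le> ((1 + 2 / ?L) * m n)\<^sup>2" using K_le by (intro power_mono) auto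
      hence "?X K n \<le> real n * ((1 + 2 / ?L) * m n)\<^sup>2 / P n"
        by (intro divide_right_mono mult_left_mono) auto
      also have "\<dots> = (1 + 2 / ?L)\<^sup>2 * ?z" by (simp add: power_mult_distrib)
      also have "\<dots> \<le> (1 + 8 / ?L) * ?z"
      proof (rule mult_right_mono[OF _ x00])
        have "(2 / ?L)\<^sup>2 \<le> 2 / ?L" using elim(1) power_decreasing[of 1 2 "2 / ?L"] by simp
        moreover have "(1 + y)\<^sup>2 \<le> 1 + 4 * y" if "0 \<le> y" "y\<^sup>2 \<le> y" for y :: real
          using that by (simp add: power2_sum)
        moreover have "0 \<le> 2 / ?L" using elim(1) by simp
        ultimately have "(1 + 2 / ?L)\<^sup>2 \<le> 1 + 4 * (2 / ?L)" by blast
        thus "(1 + 2 / ?L)\<^sup>2 \<le> 1 + 8 / ?L" by simp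
      qed
      finally have xK: "?X K n \<le> (1 + 8 / ?L) * ?z" .
      \<comment> \<open>The relative error \<open>8 / ln n\<close> becomes the bounded absolute
        error \<open>8 * k\<close> because \<open>\<alpha> n \<le> 0\<close> forces
        \<open>?z \<le> k * ln n\<close>.\<close>
      have "8 / ?L * ?z \<le> 8 / ?L * (k * ?L)" using x0L elim(1) by (intro mult_left_mono) auto
      also have "\<dots> = 8 * k" using elim(1) by simp
      finally have "?X K n \<le> ?z + 8 * k" using xK by (simp only: distrib_right mult_1)
      hence 1: "?a K n \<le> \<alpha> n + 8 * k" using x0[OF elim(5)] by linarith
      \<comment> \<open>\<open>K n\<close> lies above the mean, so that it fits into the pool must
        be derived: \<open>x\<close> for the size \<open>K n\<close> is at most \<open>n\<close>,
        that is, \<open>(K n)\<^sup>2 \<le> P n\<close>.\<close>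
      have KP: "K n \<le> P n"
      proof -
        have "(1 + 8 / ?L) * ?z \<le> 2 * (k * ?L)"
          using elim(1) x00 x0L by (intro mult_mono) auto
        hence "?X K n \<le> real n" using xK elim(7) elim(1) by linarith
        hence "real (K n) ^ 2 \<le> P n" using P0 n1 by (simp add: field_simps)
        moreover have "real (K n) \<le> real (K n) ^ 2" using mK mp by (simp add: power2_eq_square)
        ultimately show ?thesis by linarith
      qed
      have "?prob n \<le> ?uprob K n + n * measure_pmf.prob (D n) {s. K n < s}"
        by (rule prob_k_robust_le_uniform[OF KP supp[OF n1]])
      also have "n * measure_pmf.prob (D n) {s. K n < s} \<le> n * measure_pmf.prob (D n) {s. m n / ?L \<le> \<bar>real s - m n\<bar>}"
      proof (intro mult_left_mono measure_pmf.finite_measure_mono subsetI CollectI)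
        fix s assume "s \<in> {s. K n < s}"
        hence "real (K n) < real s" by simp
        hence "(1 + 1 / ?L) * m n < s" using K_ge[of n] by linarith
        hence "m n / ?L \<le> real s - m n" by (simp add: algebra_simps)
        thus "m n / ?L \<le> \<bar>real s - m n\<bar>" by linarith
      qed auto
      also have "\<dots> \<le> v n" unfolding v_def m_def
        using elim(1) mp fin[OF n1] by (intro prob_deviation_le) (auto simp: m_def)
      finally show ?case using 1 mK elim(4) by linarith
    qed
    have "filterlim (\<lambda>n. \<alpha> n + 8 * k) at_bot sequentially"
    proof -
      have "filterlim (\<lambda>t :: real. t + 8 * k) at_bot at_bot" by real_asymp
      thus ?thesis using lim by (rule filterlim_compose)
    qed
    hence "filterlim (?a K) at_bot sequentially"
      by (rule filterlim_at_bot_mono) (use main in \<open>auto elim!: eventually_mono\<close>)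
    moreover have "\<forall>\<^sub>F n in sequentially. 0 < P n"
      using eventually_ge_at_top[of 1]
    proof eventually_elim
      case (elim n)
      thus ?case using P_pos[of n] by simp
    qed
    moreover have "\<forall>\<^sub>F n in sequentially. c * ln (real n) ^ 3 \<le> K n"
      using main by (rule eventually_mono) simp
    ultimately have "(?uprob K) \<longlonglongrightarrow> 0" by (intro uniform_k_robust_limit_0[OF k_pos c])
    hence up: "(\<lambda>n. ?uprob K n + v n) \<longlonglongrightarrow> 0" using tendsto_add[OF _ v] by fastforce
    show "?prob \<longlonglongrightarrow> 0"
      by (rule tendsto_sandwich[OF _ _ tendsto_const up]) (use main in \<open>auto elim!: eventually_mono\<close>)
  next
    assume lim: "filterlim \<alpha> at_top sequentially"
    define K where "K n = nat \<lfloor>(1 - 1 / ln (real n)) * m n\<rfloor>" for n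
    have nonneg: "\<forall>\<^sub>F n in sequentially. 0 \<le> \<alpha> n" using lim by (simp add: filterlim_at_top)
    have main: "\<forall>\<^sub>F n in sequentially. \<alpha> n / 2 - 4 * k \<le> ?a K n \<and> c / 4 * ln (real n) ^ 3 \<le> K n \<and> K n \<le> P n
        \<and> ?uprob K n - v n \<le> ?prob n"
      using ev nonneg
    proof eventually_elim
      case (elim n)
      let ?L = "ln (real n)"
      have n1: "1 \<le> n" using elim(5) by simp
      have P0: "0 < real (P n)" using P_pos[OF n1] by simp
      have mp: "0 < m n" using elim(1,2,4) by linarith
      have L8: "1 / ?L \<le> 1 / 8" using elim(1) by (intro divide_left_mono) auto
      have nn: "0 \<le> (1 - 1 / ?L) * m n" using L8 mp by (intro mult_nonneg_nonneg) auto
      have K_le: "K n \<le> (1 - 1 / ?L) * m n" unfolding K_def using nn by linarith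
      have K_ge1: "(1 - 1 / ?L) * m n - 1 \<le> K n" unfolding K_def using nn by linarith
      have "1 \<le> m n / ?L" using elim(1,2,4) by (simp add: field_simps)
      moreover have "(1 - 2 / ?L) * m n = (1 - 1 / ?L) * m n - m n / ?L" using elim(1) by (simp add: field_simps)
      ultimately have K_ge: "(1 - 2 / ?L) * m n \<le> K n" using K_ge1 by linarith
      have "1 / 2 * m n \<le> (1 - 2 / ?L) * m n" using L8 mp by (intro mult_right_mono) auto
      hence "m n / 4 \<le> K n" using K_ge mp by linarith
      hence 2: "c / 4 * ?L ^ 3 \<le> K n" using elim(4) by linarith
      have "(1 - 1 / ?L) * m n \<le> 1 * m n" using elim(1) mp by (intro mult_right_mono) auto
      hence KP: "K n \<le> P n" using K_le mP[OF n1] by linarith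
      let ?z = "real n * (m n)\<^sup>2 / P n"
      have x00: "0 \<le> ?z" by simp
      have "(1 - 4 / ?L) * ?z \<le> (1 - 2 / ?L)\<^sup>2 * ?z"
        by (rule mult_right_mono[OF _ x00]) (simp add: power2_diff)
      also have "\<dots> = real n * ((1 - 2 / ?L) * m n)\<^sup>2 / P n" by (simp add: power_mult_distrib)
      also have "\<dots> \<le> ?X K n"
        using K_ge L8 mp by (intro divide_right_mono mult_left_mono power_mono mult_nonneg_nonneg) auto
      finally have xK: "?z - 4 / ?L * ?z \<le> ?X K n" by (simp only: left_diff_distrib mult_1)
      \<comment> \<open>With no upper bound on \<open>\<alpha> n\<close>, the relative error
        \<open>4 / ln n\<close> may cost a multiple of \<open>\<alpha> n\<close>. As
        \<open>ln n \<ge> 8\<close>, this is at most one half, and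
        \<open>\<alpha> n / 2 - 4 * k\<close> still tends to infinity.\<close>
      have "?z \<le> k * ?L + \<alpha> n" using x0[OF elim(5)] lnln[of n] elim(1) by (simp add: algebra_simps)
      hence "4 / ?L * ?z \<le> 4 / ?L * (k * ?L + \<alpha> n)" using elim(1) by (intro mult_left_mono) auto
      also have "\<dots> = 4 * k + 4 * (1 / ?L) * \<alpha> n" using elim(1) by (simp add: field_simps)
      also have "4 * (1 / ?L) * \<alpha> n \<le> 4 * (1 / 8) * \<alpha> n"
        using L8 elim(6) by (intro mult_right_mono) auto
      finally have "4 / ?L * ?z \<le> 4 * k + \<alpha> n / 2" by simp
      hence 1: "\<alpha> n / 2 - 4 * k \<le> ?a K n" using xK x0[OF elim(5)] by linarith
      have "?uprob K n \<le> ?prob n + n * measure_pmf.prob (D n) {s. s < K n}"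
        by (rule prob_k_robust_ge_uniform[OF KP supp[OF n1]])
      also have "n * measure_pmf.prob (D n) {s. s < K n} \<le> n * measure_pmf.prob (D n) {s. m n / ?L \<le> \<bar>real s - m n\<bar>}"
      proof (intro mult_left_mono measure_pmf.finite_measure_mono subsetI CollectI)
        fix s assume "s \<in> {s. s < K n}"
        hence "real s < real (K n)" by simp
        hence "real s < (1 - 1 / ?L) * m n" using K_le by linarith
        hence "m n / ?L \<le> m n - real s" by (simp add: algebra_simps)
        thus "m n / ?L \<le> \<bar>real s - m n\<bar>" by linarith
      qed auto
      also have "\<dots> \<le> v n" unfolding v_def m_def
        using elim(1) mp fin[OF n1] by (intro prob_deviation_le) (auto simp: m_def)
      finally show ?case using 1 2 KP by simp
    qed
    have "filterlim (\<lambda>n. \<alpha> n / 2 - 4 * k) at_top sequentially"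
    proof -
      have "filterlim (\<lambda>t :: real. t / 2 - 4 * k) at_top at_top" by real_asymp
      thus ?thesis using lim by (rule filterlim_compose)
    qed
    hence "filterlim (?a K) at_top sequentially"
      by (rule filterlim_at_top_mono) (use main in \<open>auto elim!: eventually_mono\<close>)
    moreover have "0 < c / 4" using c by simp
    moreover have "\<forall>\<^sub>F n in sequentially. K n \<le> P n" "\<forall>\<^sub>F n in sequentially. c / 4 * ln (real n) ^ 3 \<le> K n"
      using main by (auto elim: eventually_mono)
    ultimately have "(?uprob K) \<longlonglongrightarrow> 1" by (intro uniform_k_robust_limit_1[OF k_pos, of "c / 4"])
    hence lo: "(\<lambda>n. ?uprob K n - v n) \<longlonglongrightarrow> 1" using tendsto_diff[OF _ v] by fastforce
    show "?prob \<longlonglongrightarrow> 1"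
      by (rule tendsto_sandwich[OF _ _ lo tendsto_const]) (use main in \<open>auto elim!: eventually_mono\<close>)
  qed
qed

end
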